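(* Fix $\varepsilon,\delta\in(0,1)$ and $k\in\mathbb{N}$, and let $$\Delta=\min\left(\frac{\varepsilon}{\sqrt{8k\log(1/\delta)}},\ \frac{\varepsilon}{8\log(1/\delta)}\right)<1.$$ Let $\mathcal{M}:(\mathbb{R}^d)^n\to\mathbb{S}^d_+$ be a (randomized) algorithm that, given a dataset of $n$ points in $\mathbb{R}^d$, outputs a positive semidefinite matrix, and suppose that for any neighboring datasets $\mathcal{Y},\mathcal{Y}'$, $$\left\|\mathcal{M}(\mathcal{Y})^{1/2}\mathcal{M}(\mathcal{Y}')^{-1}\mathcal{M}(\mathcal{Y})^{1/2}-I\right\|_F\le\Delta.$$ Consider the Gaussian sampling mechanism which, on input $\Sigma=\mathcal{M}(\mathcal{Y})$ and $k$, draws $g_1,\dots,g_k$ independently from $\mathcal{N}(0,\Sigma)$ and outputs $\widehat{\Sigma}=\frac1k\sum_{i=1}^k g_ig_i^{T}$. Then: (1) the composed mechanism $\mathcal{Y}\mapsto\widehat{\Sigma}$ is $(\varepsilon,\delta)$-differentially private with respect to the dataset $\mathcal{Y}$; and (2) for any $\gamma\in(0,1)$, with probability at least $1-\gamma$ the output satisfies $\|\Sigma^{-1/2}\widehat{\Sigma}\Sigma^{-1/2}-I\|_F\le\rho$ for some $\rho=O\left(\sqrt{\frac{d^2+\log(1/\gamma)}{k}}+\frac{d^2+\log(1/\gamma)}{k}\right)$.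
   Context: $\mathbb{S}^d_+$ is the set of $d\times d$ positive semidefinite matrices. Two datasets are neighboring if they differ in exactly one point. A randomized algorithm $\mathcal{A}$ is $(\varepsilon,\delta)$-differentially private if for all neighboring $\mathcal{Y},\mathcal{Y}'$ and all measurable output sets $S$, $\Pr[\mathcal{A}(\mathcal{Y})\in S]\le e^{\varepsilon}\Pr[\mathcal{A}(\mathcal{Y}')\in S]+\delta$. $\|\cdot\|_F$ is the Frobenius norm.
   Formalization: Claim (1) is proved under the extra condition ε/(8 log(1/δ)) < 1, i.e. δ < exp(-ε/8); with only Δ < 1 it fails for δ very close to 1 (e.g. d=n=1, ε=1/2, log(1/δ)=5e-5, k=1000). Claim (2) needs no extra condition. *)

theory Defs
  imports "HOL-Probability.Probability" "Jordan_Normal_Form.Gauss_Jordan_Elimination"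
begin

unbundle no vec_syntax
unbundle no inner_syntax
hide_type (open) Finite_Cartesian_Product.vec
hide_const (open) Finite_Cartesian_Product.vec Finite_Cartesian_Product.mat
  Finite_Cartesian_Product.row Finite_Cartesian_Product.column

text \<open>
  Matrices are those of Jordan_Normal_Form, whose dimension is a value and not a type: the
  constant hidden in a bound O(...) must not depend on the dimension, so the dimension has to be
  quantified inside the scope of that constant.
\<close>

definition psd_mats :: "nat \<Rightarrow> real mat set" where
  "psd_mats d = {A \<in> carrier_mat d d.
     transpose_mat A = A \<and> (\<forall>v \<in> carrier_vec d. 0 \<le> scalar_prod v (A *\<^sub>v v))}"

text \<open>Only meaningful for positive semidefinite arguments, where the root is unique.\<close>

definition mat_sqrt :: "real mat \<Rightarrow> real mat" where
  "mat_sqrt A = (THE B. B \<in> psd_mats (dim_row A) \<and> B * B = A)"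

text \<open>Only meaningful for invertible square arguments.\<close>

definition mat_inv :: "real mat \<Rightarrow> real mat" where
  "mat_inv A = the (mat_inverse A)"

definition frobenius_norm :: "real mat \<Rightarrow> real" where
  "frobenius_norm A = sqrt (\<Sum>i<dim_row A. \<Sum>j<dim_col A. (A $$ (i, j))\<^sup>2)"

text \<open>The Borel sigma-algebras of the spaces of vectors and matrices, generated by the entries.\<close>

definition vec_borel :: "nat \<Rightarrow> real vec measure" where
  "vec_borel d = vimage_algebra (carrier_vec d)
     (\<lambda>v. \<lambda>i\<in>{..<d}. v $ i) (\<Pi>\<^sub>M i\<in>{..<d}. borel)"

definition mat_borel :: "nat \<Rightarrow> real mat measure" where
  "mat_borel d = vimage_algebra (carrier_mat d d)
     (\<lambda>A. \<lambda>ij\<in>{..<d} \<times> {..<d}. A $$ ij) (\<Pi>\<^sub>M ij\<in>{..<d} \<times> {..<d}. borel)"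

definition psd_borel :: "nat \<Rightarrow> real mat measure" where
  "psd_borel d = restrict_space (mat_borel d) (psd_mats d)"

text \<open>
  \<open>\<N>(0, \<Sigma>)\<close> is the law of \<open>\<Sigma>\<^sup>1\<^sup>/\<^sup>2 z\<close> with \<open>z\<close> standard Gaussian, so that singular
  \<open>\<Sigma>\<close> is covered.
\<close>

definition mvn :: "nat \<Rightarrow> real mat \<Rightarrow> real vec measure" where
  "mvn d \<Sigma> = distr (\<Pi>\<^sub>M i\<in>{..<d}. std_normal_distribution) (vec_borel d)
     (\<lambda>z. mat_sqrt \<Sigma> *\<^sub>v vec d z)"

definition second_moment_mat :: "nat \<Rightarrow> nat \<Rightarrow> (nat \<Rightarrow> real vec) \<Rightarrow> real mat" where
  "second_moment_mat d k g = mat d d (\<lambda>(a, b). (1 / real k) * (\<Sum>i<k. g i $ a * g i $ b))"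

definition gauss_sampling :: "nat \<Rightarrow> nat \<Rightarrow> real mat \<Rightarrow> real mat measure" where
  "gauss_sampling d k \<Sigma> =
     distr (\<Pi>\<^sub>M i\<in>{..<k}. mvn d \<Sigma>) (mat_borel d) (second_moment_mat d k)"

definition datasets :: "nat \<Rightarrow> nat \<Rightarrow> real vec list set" where
  "datasets d n = {Y. length Y = n \<and> set Y \<subseteq> carrier_vec d}"

definition neighboring :: "'a list \<Rightarrow> 'a list \<Rightarrow> bool" where
  "neighboring Y Y' \<longleftrightarrow> length Y = length Y' \<and> card {i. i < length Y \<and> Y ! i \<noteq> Y' ! i} = 1"

text \<open>
  A randomized algorithm is the map from inputs to the laws of its outputs, here on the
  measurable space \<open>N\<close>.
\<close>

definition differentially_private ::
  "real \<Rightarrow> real \<Rightarrow> 'a list set \<Rightarrow> 'b measure \<Rightarrow> ('a list \<Rightarrow> 'b measure) \<Rightarrow> bool" where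
  "differentially_private \<epsilon> \<delta> D N A \<longleftrightarrow>
     (\<forall>Y\<in>D. \<forall>Y'\<in>D. neighboring Y Y' \<longrightarrow>
       (\<forall>S\<in>sets N. measure (A Y) S \<le> exp \<epsilon> * measure (A Y') S + \<delta>))"

text \<open>The requirement that the inverse exists is implicit in writing it.\<close>

definition relatively_close :: "nat \<Rightarrow> real \<Rightarrow> real mat \<Rightarrow> real mat \<Rightarrow> bool" where
  "relatively_close d \<Delta> A B \<longleftrightarrow> invertible_mat B \<and>
     frobenius_norm (mat_sqrt A * mat_inv B * mat_sqrt A - 1\<^sub>m d) \<le> \<Delta>"

definition coupling :: "('a \<times> 'b) measure \<Rightarrow> 'a measure \<Rightarrow> 'b measure \<Rightarrow> bool" where
  "coupling P M N \<longleftrightarrow> sets P = sets (M \<Otimes>\<^sub>M N) \<and> distr P M fst = M \<and> distr P N snd = N"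

text \<open>
  The closeness of the outputs of a randomized \<open>M\<close> on neighboring datasets refers to jointly
  distributed outputs. Only some joint distribution is asked for: for a deterministic \<open>M\<close> (point
  masses) this is the plain inequality between the two outputs; an \<open>M\<close> whose outputs are close for
  almost all values of shared internal coins satisfies it with the law of the pair of outputs, and
  one whose independent runs are always close satisfies it with the product measure. Neighborhood
  being symmetric, the bound is imposed in both orders.
\<close>

definition stable_mechanism ::
  "nat \<Rightarrow> nat \<Rightarrow> real \<Rightarrow> (real vec list \<Rightarrow> real mat measure) \<Rightarrow> bool" where
  "stable_mechanism d n \<Delta> M \<longleftrightarrow>
     (\<forall>Y\<in>datasets d n. \<forall>Y'\<in>datasets d n. neighboring Y Y' \<longrightarrow>
       (\<exists>P. coupling P (M Y) (M Y') \<and>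
         (AE (A, B) in P. relatively_close d \<Delta> A B \<and> relatively_close d \<Delta> B A)))"

end

theory Submission
  imports Defs "Jordan_Normal_Form.Spectral_Radius"
begin

text \<open>
  Privacy: by rotation invariance of the standard Gaussian, the sampling laws for covariances \<open>A\<close> and \<open>B\<close> are images under
  one common linear map of the standard Gaussian sample and of a diagonally rescaled one, where the
  squared inverse scalings are the eigenvalues \<open>1 + \<kappa>\<^sub>j\<close> of \<open>A\<^sup>1\<^sup>/\<^sup>2 B\<^sup>-\<^sup>1 A\<^sup>1\<^sup>/\<^sup>2\<close>. Closeness in both orders gives
  \<open>\<kappa>\<^sub>j \<ge> - 1/2\<close>, and a Chernoff bound with exponent \<open>4 ln (1/\<delta>) / \<epsilon>\<close> shows that the logarithm of the density
  ratio exceeds \<open>\<epsilon>\<close> with probability at most \<open>\<delta>\<close>. The coupling carries this over to random \<open>A\<close>, \<open>B\<close>.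

  Accuracy: whitening reduces to \<open>\<Sigma> = I\<close>. The deviation from the identity has a large inner product
  with one of at most \<open>48\<close> to the power \<open>d\<^sup>2\<close> symmetric matrices of norm at most \<open>1\<close>, and each of these
  inner products is a diagonal quadratic form in Gaussians after a rotation.
\<close>

section \<open>Spectral theorem\<close>

text \<open>A density of N(0, A) against N(0, B) would call for determinants and a linear change of
  variables in Lebesgue measure. This is avoided by splitting the passage from A to B into three
  kinds of factors: orthogonal ones, which leave the law of a standard sample unchanged; a diagonal
  one, for which the density is a product of one-variable ratios; and a common matrix
  \<open>T\<close>, which is mere post-processing of the outcome. Smallness of \<Delta> pays off
  quadratically: in the exponential moments of the log ratio the terms linear in \<kappa> cancel, so
  that k samples cost k times the sum of the \<kappa>_j^2 rather than k times a norm. The term d^2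
  in the accuracy bound is the number of entries of a direction matrix: the net is taken in
  Frobenius norm and costs a factor 48 per entry. Invertibility of \<Sigma> is not assumed of
  \<open>M\<close> directly. It is extracted from stability by comparing a dataset with some
  neighbor, so the accuracy claim holds for almost every \<Sigma>.\<close>

lemma real_symmetric_eigenvector:
  fixes A :: "real mat"
  assumes A: "A \<in> carrier_mat n n" and sym: "transpose_mat A = A" and n: "0 < n"
  obtains e v where "v \<in> carrier_vec n" "v \<noteq> 0\<^sub>v n" "A *\<^sub>v v = e \<cdot>\<^sub>v v"
proof -
  define C where "C = map_mat complex_of_real A"
  have C: "C \<in> carrier_mat n n" using A by (simp add: C_def)
  from spectrum_non_empty[OF C n] obtain z where "z \<in> spectrum C" by auto
  then obtain w where w: "w \<in> carrier_vec n" "w \<noteq> 0\<^sub>v n" "C *\<^sub>v w = z \<cdot>\<^sub>v w"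
    using C by (auto simp: spectrum_def eigenvalue_def eigenvector_def)
  define x where "x = map_vec Re w"
  define y where "y = map_vec Im w"
  have x: "x \<in> carrier_vec n" and y: "y \<in> carrier_vec n" using w by (auto simp: x_def y_def)
  have comp: "(\<Sum>j<n. complex_of_real (A $$ (i,j)) * w $ j) = z * w $ i" if "i < n" for i
    using arg_cong[OF w(3), of "\<lambda>u. u $ i"] that C A w(1)
    by (simp add: C_def scalar_prod_def atLeast0LessThan)
  have Ax: "A *\<^sub>v x = Re z \<cdot>\<^sub>v x - Im z \<cdot>\<^sub>v y"
  proof (rule eq_vecI)
    fix i assume "i < dim_vec (Re z \<cdot>\<^sub>v x - Im z \<cdot>\<^sub>v y)"
    then have i: "i < n" using y by simp
    from arg_cong[OF comp[OF i], of Re]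
    show "(A *\<^sub>v x) $ i = (Re z \<cdot>\<^sub>v x - Im z \<cdot>\<^sub>v y) $ i"
      using A w(1) i by (simp add: x_def y_def scalar_prod_def atLeast0LessThan)
  qed (use A x y in auto)
  have Ay: "A *\<^sub>v y = Re z \<cdot>\<^sub>v y + Im z \<cdot>\<^sub>v x"
  proof (rule eq_vecI)
    fix i assume "i < dim_vec (Re z \<cdot>\<^sub>v y + Im z \<cdot>\<^sub>v x)"
    then have i: "i < n" using x by simp
    from arg_cong[OF comp[OF i], of Im]
    show "(A *\<^sub>v y) $ i = (Re z \<cdot>\<^sub>v y + Im z \<cdot>\<^sub>v x) $ i"
      using A w(1) i by (simp add: x_def y_def scalar_prod_def atLeast0LessThan algebra_simps)
  qed (use A x y in auto)
  \<comment> \<open>A complex eigenvector x + iy gives an invariant pair x, y. Symmetry evaluates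
    this product in two ways, which leaves Im z times |x|^2 + |y|^2 equal to zero; so z is real and
    each nonzero one of x, y is a real eigenvector.\<close>
  have "x \<bullet> (A *\<^sub>v y) = (A *\<^sub>v x) \<bullet> y"
    using transpose_vec_mult_scalar[OF A y x] sym
    by (simp add: comm_scalar_prod[of _ n] A x y)
  moreover have "x \<bullet> (A *\<^sub>v y) = Re z * (x \<bullet> y) + Im z * (x \<bullet> x)"
    using x y by (simp add: Ay scalar_prod_add_distrib[of _ n])
  moreover have "(A *\<^sub>v x) \<bullet> y = Re z * (x \<bullet> y) - Im z * (y \<bullet> y)"
    using x y by (simp add: Ax minus_scalar_prod_distrib[of _ n])
  ultimately have z0: "Im z * (x \<bullet> x + y \<bullet> y) = 0" by (simp add: algebra_simps)
  have pos: "x \<bullet> x \<ge> 0" "y \<bullet> y \<ge> 0"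
    by (auto simp: scalar_prod_def intro!: sum_nonneg)
  have zero: "v = 0\<^sub>v n" if "v \<in> carrier_vec n" "v \<bullet> v = 0" for v :: "real vec"
    using that conjugate_square_eq_0_vec[of v n] by simp
  have "x \<noteq> 0\<^sub>v n \<or> y \<noteq> 0\<^sub>v n"
  proof (rule ccontr)
    assume "\<not> ?thesis"
    then have xy: "x = 0\<^sub>v n" "y = 0\<^sub>v n" by auto
    have "w = 0\<^sub>v n"
    proof (rule eq_vecI)
      fix i assume "i < dim_vec (0\<^sub>v n :: complex vec)"
      then have i: "i < n" by simp
      have "x $ i = 0" "y $ i = 0" using xy i by auto
      then have "Re (w $ i) = 0" "Im (w $ i) = 0" using i w(1) by (auto simp: x_def y_def)
      then show "w $ i = 0\<^sub>v n $ i" using i by (simp add: complex_eq_iff)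
    qed (use w in auto)
    with w show False by simp
  qed
  then have "x \<bullet> x + y \<bullet> y \<noteq> 0" using pos zero[OF x] zero[OF y]
    by (metis add_nonneg_eq_0_iff)
  then have "Im z = 0" using z0 by simp
  then have "A *\<^sub>v x = Re z \<cdot>\<^sub>v x" "A *\<^sub>v y = Re z \<cdot>\<^sub>v y"
    using Ax Ay x y by (auto intro!: eq_vecI)
  with \<open>x \<noteq> 0\<^sub>v n \<or> y \<noteq> 0\<^sub>v n\<close> x y that show ?thesis by blast
qed

definition orthonormal_mat :: "nat \<Rightarrow> real mat \<Rightarrow> bool" where
  "orthonormal_mat d Q \<longleftrightarrow> Q \<in> carrier_mat d d \<and> transpose_mat Q * Q = 1\<^sub>m d"

lemma orthonormal_matD:
  assumes "orthonormal_mat d Q"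
  shows "Q \<in> carrier_mat d d" "transpose_mat Q \<in> carrier_mat d d"
    "transpose_mat Q * Q = 1\<^sub>m d" "Q * transpose_mat Q = 1\<^sub>m d"
  using assms mat_mult_left_right_inverse[of "transpose_mat Q" d Q]
  by (auto simp: orthonormal_mat_def)

lemma orthonormal_transpose:
  assumes "orthonormal_mat d Q"
  shows "orthonormal_mat d (transpose_mat Q)"
  using orthonormal_matD(1,4)[OF assms] by (simp add: orthonormal_mat_def)

lemma orthonormal_mult:
  assumes P: "orthonormal_mat d P" and Q: "orthonormal_mat d Q"
  shows "orthonormal_mat d (P * Q)"
proof -
  note P' = orthonormal_matD[OF P] and Q' = orthonormal_matD[OF Q]
  have "transpose_mat (P * Q) * (P * Q) = transpose_mat Q * (transpose_mat P * P) * Q"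
    using P'(1,2) Q'(1,2) by (simp add: transpose_mult[of _ d d _ d] assoc_mult_mat[of _ d d _ d _ d])
  then show ?thesis using P' Q' by (simp add: orthonormal_mat_def)
qed

text \<open>The Householder reflection along \<open>u = e - v\<close> exchanges two vectors of equal
  length, here the first unit vector and \<open>v\<close>. It degenerates for \<open>v = e\<close>,
  hence the case distinction.\<close>

lemma orthonormal_mat_first_col:
  fixes v :: "real vec"
  assumes v: "v \<in> carrier_vec n" and v1: "v \<bullet> v = 1" and n: "0 < n"
  obtains Q where "orthonormal_mat n Q" "col Q 0 = v"
proof (cases "v = unit_vec n 0")
  case True
  then show ?thesis using that[of "1\<^sub>m n"] n by (auto simp: orthonormal_mat_def)
next
  case False
  define e where "e = (unit_vec n 0 :: real vec)"
  define u where "u = e - v"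
  have e: "e \<in> carrier_vec n" by (simp add: e_def)
  have u: "u \<in> carrier_vec n" using e v by (simp add: u_def)
  have u0: "u \<bullet> u \<noteq> 0"
  proof
    assume "u \<bullet> u = 0"
    then have "u = 0\<^sub>v n" using conjugate_square_eq_0_vec[OF u] by simp
    then have "u $ i = 0" if "i < n" for i using that by simp
    then have "v $ i = e $ i" if "i < n" for i using that v e by (auto simp: u_def)
    then have "v = e" using v e by (intro eq_vecI) auto
    with False show False by (simp add: e_def)
  qed
  \<comment> \<open>Both vectors have length one, so |u|^2 = 2 - 2 v_0 = 2 u_0. This yields
    \<open>c * u $ 0 = 1\<close> and makes the first column equal to
    \<open>e - u = v\<close>.\<close>
  have uu: "u \<bullet> u = 2 * u $ 0"
  proof -
    have "u \<bullet> u = e \<bullet> e - e \<bullet> v - (v \<bullet> e - v \<bullet> v)"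
      unfolding u_def using e v
      by (simp add: minus_scalar_prod_distrib[of _ n] scalar_prod_minus_distrib[of _ n])
    moreover have "e \<bullet> e = 1" "e \<bullet> v = v $ 0" "v \<bullet> e = v $ 0"
      using n v by (auto simp: e_def)
    ultimately show ?thesis using n v v1 by (simp add: u_def e_def)
  qed
  define c where "c = 2 / (u \<bullet> u)"
  define Q where "Q = mat n n (\<lambda>(i,j). (if i = j then 1 else 0) - c * u $ i * u $ j)"
  have "transpose_mat Q * Q = 1\<^sub>m n"
  proof (rule eq_matI)
    fix i j assume "i < dim_row (1\<^sub>m n :: real mat)" "j < dim_col (1\<^sub>m n :: real mat)"
    then have ij: "i < n" "j < n" by auto
    have "(transpose_mat Q * Q) $$ (i,j) =
       (\<Sum>k<n. ((if k = i then 1 else 0) - c * u $ k * u $ i) * ((if k = j then 1 else 0) - c * u $ k * u $ j))"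
      using ij by (simp add: Q_def scalar_prod_def atLeast0LessThan)
    also have "\<dots> = (\<Sum>k<n. (if k = i then (if i = j then 1 else 0) else 0) - (if k = i then c * u $ i * u $ j else 0)
        - (if k = j then c * u $ j * u $ i else 0) + c * c * u $ i * u $ j * (u $ k * u $ k))"
      by (intro sum.cong) (auto simp: algebra_simps)
    also have "\<dots> = (if i = j then 1 else 0) - 2 * c * u $ i * u $ j + c * c * u $ i * u $ j * (u \<bullet> u)"
      using ij u by (simp add: sum.distrib sum_subtractf sum_distrib_left scalar_prod_def atLeast0LessThan sum.delta)
    also have "\<dots> = 1\<^sub>m n $$ (i,j)" using u0 ij by (simp add: c_def field_simps)
    finally show "(transpose_mat Q * Q) $$ (i,j) = 1\<^sub>m n $$ (i,j)" .
  qed (auto simp: Q_def)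
  moreover have "col Q 0 = v"
  proof (rule eq_vecI)
    fix i assume "i < dim_vec v"
    then have i: "i < n" using v by simp
    have "c * u $ 0 = 1" using u0 uu by (simp add: c_def)
    then have c1: "c * u $ i * u $ 0 = u $ i" by (metis mult.assoc mult.commute mult_1)
    have "col Q 0 $ i = (if i = 0 then 1 else 0) - c * u $ i * u $ 0"
      using i n by (simp add: Q_def)
    also have "\<dots> = (if i = 0 then 1 else 0) - u $ i" by (simp only: c1)
    also have "\<dots> = v $ i" using i n v by (simp add: u_def e_def)
    finally show "col Q 0 $ i = v $ i" .
  qed (use v in \<open>auto simp: Q_def\<close>)
  ultimately show ?thesis using that[of Q] by (auto simp: orthonormal_mat_def Q_def)
qed

text \<open>Deflation: in an orthonormal basis that starts with a unit eigenvector, the first column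
  of the matrix is \<open>e\<close> followed by zeros; symmetry clears the first row too, and the
  remaining block is symmetric of size n.\<close>

theorem real_spectral_theorem:
  fixes A :: "real mat"
  assumes "A \<in> carrier_mat n n" "transpose_mat A = A"
  obtains Q l where "orthonormal_mat n Q" "A = Q * mat_diag n l * transpose_mat Q"
proof -
  have "\<exists>Q l. orthonormal_mat n Q \<and> A = Q * mat_diag n l * transpose_mat Q"
    using assms
  proof (induction n arbitrary: A)
    case 0
    then show ?case by (intro exI[of _ "1\<^sub>m 0"] exI) (auto simp: orthonormal_mat_def)
  next
    case (Suc n)
    from real_symmetric_eigenvector[OF Suc.prems] obtain e w
      where w: "w \<in> carrier_vec (Suc n)" "w \<noteq> 0\<^sub>v (Suc n)" "A *\<^sub>v w = e \<cdot>\<^sub>v w" by blast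
    have ww: "w \<bullet> w \<noteq> 0" using conjugate_square_eq_0_vec[OF w(1)] w(2) by simp
    have "w \<bullet> w \<ge> 0" by (auto simp: scalar_prod_def intro!: sum_nonneg)
    with ww have wp: "w \<bullet> w > 0" by simp
    define v where "v = (1 / sqrt (w \<bullet> w)) \<cdot>\<^sub>v w"
    have v: "v \<in> carrier_vec (Suc n)" using w by (simp add: v_def)
    have v1: "v \<bullet> v = 1" using wp w(1) by (simp add: v_def)
    have Av: "A *\<^sub>v v = e \<cdot>\<^sub>v v"
      using w Suc.prems(1) by (simp add: v_def mult_mat_vec[of _ "Suc n" "Suc n"] smult_smult_assoc mult.commute)
    obtain Q where Q: "orthonormal_mat (Suc n) Q" and Q0: "col Q 0 = v"
      using orthonormal_mat_first_col[OF v v1] by auto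
    note Q' = orthonormal_matD[OF Q]
    let ?N = "Suc n"
    define B where "B = transpose_mat Q * A * Q"
    have B: "B \<in> carrier_mat ?N ?N" using Q' Suc.prems by (simp add: B_def)
    have Bsym: "transpose_mat B = B"
      using Q'(1,2) Suc.prems
      by (simp add: B_def transpose_mult[of _ ?N ?N _ ?N] assoc_mult_mat[of _ ?N ?N _ ?N _ ?N])
    have Bsym': "B $$ (i,j) = B $$ (j,i)" if "i < ?N" "j < ?N" for i j
      using arg_cong[OF Bsym, of "\<lambda>M. M $$ (i,j)"] that B by simp
    have AQB: "A = Q * B * transpose_mat Q"
    proof -
      have "Q * B * transpose_mat Q = (Q * transpose_mat Q) * A * (Q * transpose_mat Q)"
        using Q'(1,2) Suc.prems(1) by (simp add: B_def assoc_mult_mat[of _ ?N ?N _ ?N _ ?N])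
      then show ?thesis using Q' Suc.prems by simp
    qed
    have Bcol: "B $$ (i,0) = (if i = 0 then e else 0)" if i: "i < ?N" for i
    proof -
      have "B = transpose_mat Q * (A * Q)"
        using Q'(1,2) Suc.prems(1) by (simp add: B_def assoc_mult_mat[of _ ?N ?N _ ?N _ ?N])
      then have "B $$ (i,0) = col Q i \<bullet> col (A * Q) 0"
        using i Q' Suc.prems by simp
      also have "col (A * Q) 0 = e \<cdot>\<^sub>v col Q 0"
        using Q'(1) Suc.prems(1) Av Q0 by (simp add: col_mult2[of _ ?N ?N _ ?N])
      also have "col Q i \<bullet> (e \<cdot>\<^sub>v col Q 0) = e * (transpose_mat Q * Q) $$ (i,0)"
        using i Q'(1) by simp
      also have "\<dots> = (if i = 0 then e else 0)" using i Q'(3) by simp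
      finally show ?thesis .
    qed
    define D where "D = mat n n (\<lambda>(i,j). B $$ (Suc i, Suc j))"
    have D: "D \<in> carrier_mat n n" by (simp add: D_def)
    have "transpose_mat D = D" using Bsym' by (auto simp: D_def intro!: eq_matI)
    from Suc.IH[OF D this] obtain R l where R: "orthonormal_mat n R"
      and Dl: "D = R * mat_diag n l * transpose_mat R" by auto
    note R' = orthonormal_matD[OF R]
    define P where "P = four_block_mat (1\<^sub>m 1) (0\<^sub>m 1 n) (0\<^sub>m n 1) R"
    have P: "P \<in> carrier_mat ?N ?N" using R'(1)
      unfolding P_def by (metis four_block_carrier_mat one_carrier_mat plus_1_eq_Suc)
    have PT: "transpose_mat P = four_block_mat (1\<^sub>m 1) (0\<^sub>m 1 n) (0\<^sub>m n 1) (transpose_mat R)"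
      unfolding P_def using R'(1) by (subst transpose_four_block_mat) auto
    have "transpose_mat P * P = four_block_mat (1\<^sub>m 1) (0\<^sub>m 1 n) (0\<^sub>m n 1) (1\<^sub>m n)"
      unfolding PT unfolding P_def using R'
      by (subst mult_four_block_mat[of _ 1 1 _ n _ n _ _ 1 _ n]) auto
    then have Po: "orthonormal_mat ?N P" using P by (simp add: orthonormal_mat_def)
    define E where "E = mat_diag ?N (case_nat e l)"
    have E4: "E = four_block_mat (mat 1 1 (\<lambda>_. e)) (0\<^sub>m 1 n) (0\<^sub>m n 1) (mat_diag n l)"
      unfolding E_def mat_diag_def by (rule eq_matI) (auto split: nat.splits)
    have "B = four_block_mat (mat 1 1 (\<lambda>_. e)) (0\<^sub>m 1 n) (0\<^sub>m n 1) D"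
    proof (rule eq_matI)
      let ?F = "four_block_mat (mat 1 1 (\<lambda>_. e)) (0\<^sub>m 1 n) (0\<^sub>m n 1) D"
      fix i j assume "i < dim_row ?F" "j < dim_col ?F"
      then have ij: "i < ?N" "j < ?N" using D by auto
      show "B $$ (i,j) = ?F $$ (i,j)"
        using ij D Bcol[OF ij(1)] Bcol[OF ij(2)] Bsym'[OF ij]
        by (cases i; cases j) (auto simp: D_def)
    qed (use B D in auto)
    also have "\<dots> = P * E * transpose_mat P"
    proof -
      have md: "mat_diag n l \<in> carrier_mat n n" by simp
      have "P * E = four_block_mat (mat 1 1 (\<lambda>_. e)) (0\<^sub>m 1 n) (0\<^sub>m n 1) (R * mat_diag n l)"
        unfolding P_def E4 using R'(1) md
        by (subst mult_four_block_mat[of _ 1 1 _ n _ n _ _ 1 _ n]) (auto simp: left_mult_zero_mat[OF md])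
      also have "\<dots> * transpose_mat P = four_block_mat (mat 1 1 (\<lambda>_. e)) (0\<^sub>m 1 n) (0\<^sub>m n 1) D"
        unfolding PT Dl using R'(1,2) mult_carrier_mat[OF R'(1) md]
          mult_carrier_mat[OF mult_carrier_mat[OF R'(1) md] R'(2)]
        by (subst mult_four_block_mat[of _ 1 1 _ n _ n _ _ 1 _ n])
          (auto simp: right_mult_zero_mat[OF mult_carrier_mat[OF R'(1) md]])
      finally show ?thesis by simp
    qed
    finally have "B = P * E * transpose_mat P" .
    moreover have E: "E \<in> carrier_mat ?N ?N" by (simp add: E_def)
    ultimately have "A = Q * (P * E * transpose_mat P) * transpose_mat Q" using AQB by simp
    also have "\<dots> = (Q * P) * E * transpose_mat (Q * P)"
      using Q'(1,2) P E by (simp add: transpose_mult[of _ ?N ?N _ ?N] assoc_mult_mat[of _ ?N ?N _ ?N _ ?N])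
    finally have "A = (Q * P) * E * transpose_mat (Q * P)" .
    with orthonormal_mult[OF Q Po] show ?case unfolding E_def by blast
  qed
  with that show ?thesis by blast
qed

section \<open>Positive semidefinite matrices\<close>

lemma psd_matsD:
  assumes "A \<in> psd_mats d"
  shows "A \<in> carrier_mat d d" "transpose_mat A = A"
    "v \<in> carrier_vec d \<Longrightarrow> 0 \<le> v \<bullet> (A *\<^sub>v v)"
  using assms by (auto simp: psd_mats_def)

lemma transpose_mat_diag [simp]: "transpose_mat (mat_diag d l) = mat_diag d l"
  by (auto simp: mat_diag_def intro!: eq_matI)

lemma psd_mats_congruence:
  assumes S: "S \<in> psd_mats d" and T: "T \<in> carrier_mat d d"
  shows "T * S * transpose_mat T \<in> psd_mats d"
proof -
  note S' = psd_matsD[OF S]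
  have T': "transpose_mat T \<in> carrier_mat d d" using T by simp
  have "transpose_mat (T * S * transpose_mat T) = T * S * transpose_mat T"
    using S'(1,2) T T' by (simp add: transpose_mult[of _ d d _ d] assoc_mult_mat[of _ d d _ d _ d])
  moreover have "0 \<le> v \<bullet> ((T * S * transpose_mat T) *\<^sub>v v)" if v: "v \<in> carrier_vec d" for v
  proof -
    define w where "w = transpose_mat T *\<^sub>v v"
    have w: "w \<in> carrier_vec d" using T' v by (simp add: w_def)
    have Sw: "S *\<^sub>v w \<in> carrier_vec d" using S'(1) w by simp
    have "(T * S * transpose_mat T) *\<^sub>v v = T *\<^sub>v (S *\<^sub>v w)"
      using S'(1) T T' v by (simp add: w_def assoc_mult_mat_vec[of _ d d _ d])
    then have "v \<bullet> ((T * S * transpose_mat T) *\<^sub>v v) = w \<bullet> (S *\<^sub>v w)"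
      using transpose_vec_mult_scalar[OF T Sw v] by (simp add: w_def)
    then show ?thesis using S'(3)[OF w] by simp
  qed
  ultimately show ?thesis using S'(1) T by (auto simp: psd_mats_def)
qed

lemma mat_diag_mult_vec:
  fixes v :: "real vec"
  assumes v: "v \<in> carrier_vec d"
  shows "mat_diag d l *\<^sub>v v = vec d (\<lambda>i. l i * v $ i)"
proof (rule eq_vecI)
  fix i assume "i < dim_vec (vec d (\<lambda>i. l i * v $ i))"
  then have i: "i < d" by simp
  have "(mat_diag d l *\<^sub>v v) $ i = (\<Sum>j<d. (if i = j then l j else 0) * v $ j)"
    using i v by (simp add: mat_diag_def scalar_prod_def atLeast0LessThan)
  also have "\<dots> = (\<Sum>j<d. if j = i then l i * v $ i else 0)" by (intro sum.cong) auto
  also have "\<dots> = vec d (\<lambda>i. l i * v $ i) $ i" using i by simp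
  finally show "(mat_diag d l *\<^sub>v v) $ i = vec d (\<lambda>i. l i * v $ i) $ i" .
qed (simp add: mat_diag_def)

lemma mat_diag_psd:
  assumes "\<And>i. i < d \<Longrightarrow> 0 \<le> l i"
  shows "mat_diag d l \<in> psd_mats d"
proof -
  have "0 \<le> v \<bullet> (mat_diag d l *\<^sub>v v)" if v: "v \<in> carrier_vec d" for v
  proof -
    have "v \<bullet> (mat_diag d l *\<^sub>v v) = (\<Sum>i<d. l i * (v $ i)\<^sup>2)"
      using v by (simp add: mat_diag_mult_vec scalar_prod_def atLeast0LessThan power2_eq_square ac_simps)
    then show ?thesis using assms by (auto intro!: sum_nonneg)
  qed
  then show ?thesis by (simp add: psd_mats_def)
qed

lemma orthonormal_conj_cancel:
  assumes Q: "orthonormal_mat d Q" and M: "M \<in> carrier_mat d d"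
  shows "transpose_mat Q * (Q * M * transpose_mat Q) * Q = M"
proof -
  note Q' = orthonormal_matD[OF Q]
  have "transpose_mat Q * (Q * M * transpose_mat Q) * Q
      = (transpose_mat Q * Q) * M * (transpose_mat Q * Q)"
    using Q'(1,2) M by (simp add: assoc_mult_mat[of _ d d _ d _ d])
  then show ?thesis using Q'(3) M by simp
qed

lemma orthonormal_conj_mult:
  assumes Q: "orthonormal_mat d Q" and M: "M \<in> carrier_mat d d" "N \<in> carrier_mat d d"
  shows "(Q * M * transpose_mat Q) * (Q * N * transpose_mat Q) = Q * (M * N) * transpose_mat Q"
proof -
  note Q' = orthonormal_matD[OF Q]
  have "(Q * M * transpose_mat Q) * (Q * N * transpose_mat Q)
      = Q * M * (transpose_mat Q * Q) * N * transpose_mat Q"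
    using Q'(1,2) M by (simp add: assoc_mult_mat[of _ d d _ d _ d])
  also have "\<dots> = Q * (M * N) * transpose_mat Q"
    using Q'(1,2,3) M by (simp add: assoc_mult_mat[of _ d d _ d _ d])
  finally show ?thesis .
qed

lemma psd_spectral:
  assumes A: "A \<in> psd_mats d"
  obtains Q l where "orthonormal_mat d Q" "A = Q * mat_diag d l * transpose_mat Q"
    "\<And>i. i < d \<Longrightarrow> 0 \<le> l i"
proof -
  note A' = psd_matsD[OF A]
  obtain Q l where Q: "orthonormal_mat d Q" and eq: "A = Q * mat_diag d l * transpose_mat Q"
    using real_spectral_theorem[OF A'(1,2)] .
  note Q' = orthonormal_matD[OF Q]
  have D: "transpose_mat Q * A * Q = mat_diag d l"
    unfolding eq by (rule orthonormal_conj_cancel[OF Q]) simp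
  have "mat_diag d l \<in> psd_mats d"
    using psd_mats_congruence[OF A Q'(2)] D by simp
  then have "0 \<le> unit_vec d i \<bullet> (mat_diag d l *\<^sub>v unit_vec d i)" if "i < d" for i
    by (rule psd_matsD(3)) simp
  then have "0 \<le> l i" if "i < d" for i
  proof -
    have "unit_vec d i \<bullet> (mat_diag d l *\<^sub>v unit_vec d i) = l i"
      using that scalar_prod_left_unit[of "mat_diag d l *\<^sub>v unit_vec d i" d i]
      by (simp add: mat_diag_mult_vec)
    then show ?thesis using \<open>\<And>i. i < d \<Longrightarrow> 0 \<le> unit_vec d i \<bullet> (mat_diag d l *\<^sub>v unit_vec d i)\<close>[OF that]
      by simp
  qed
  with Q eq that show ?thesis by blast
qed

text \<open>Let v be a unit eigenvector of \<open>B - C\<close> with eigenvalue m. Equal squares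
  make Bv and Cv equally long, so Bv - Cv is orthogonal to Bv + Cv, that is m (v.Bv + v.Cv) = 0. If
  m were nonzero, both nonnegative summands would vanish, and so would their difference, which is m.
  Hence \<open>B - C\<close> has only zero eigenvalues.\<close>

lemma psd_root_unique:
  assumes B: "B \<in> psd_mats d" and C: "C \<in> psd_mats d" and eq: "B * B = C * C"
  shows "B = C"
proof -
  note B' = psd_matsD[OF B] and C' = psd_matsD[OF C]
  have M: "B - C \<in> carrier_mat d d" using minus_carrier_mat[OF C'(1)] .
  have "transpose_mat (B - C) = B - C"
    using B'(1,2) C'(1,2) by (simp add: transpose_minus[of _ d d])
  from real_spectral_theorem[OF M this] obtain Q m
    where Q: "orthonormal_mat d Q" and QM: "B - C = Q * mat_diag d m * transpose_mat Q" .
  note Q' = orthonormal_matD[OF Q]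
  have "m i = 0" if i: "i < d" for i
  proof -
    define v where "v = col Q i"
    have v: "v \<in> carrier_vec d" using Q'(1) i by (simp add: v_def)
    have v1: "v \<bullet> v = 1"
      using arg_cong[OF Q'(3), of "\<lambda>M. M $$ (i,i)"] i Q'(1) by (simp add: v_def)
    have "(B - C) * Q = Q * mat_diag d m"
    proof -
      obtain D where D: "mat_diag d m = D" "D \<in> carrier_mat d d" by (metis mat_diag_dim)
      have "Q * D * transpose_mat Q * Q = Q * D * (transpose_mat Q * Q)"
        using Q'(1,2) D(2) by (simp add: assoc_mult_mat[of _ d d _ d _ d])
      then show ?thesis using Q'(1,3) D by (simp add: QM)
    qed
    then have "col ((B - C) * Q) i = col (Q * mat_diag d m) i" by simp
    moreover have "col ((B - C) * Q) i = (B - C) *\<^sub>v v"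
      using col_mult2[OF M Q'(1) i] by (simp add: v_def)
    moreover have "col (Q * mat_diag d m) i = m i \<cdot>\<^sub>v v"
      using Q'(1) i by (auto simp: v_def mat_diag_mult_right[of _ d d] intro!: eq_vecI)
    ultimately have "(B - C) *\<^sub>v v = m i \<cdot>\<^sub>v v" by simp
    then have diff: "B *\<^sub>v v - C *\<^sub>v v = m i \<cdot>\<^sub>v v"
      using minus_mult_distrib_mat_vec[OF B'(1) C'(1) v] by simp
    define x where "x = B *\<^sub>v v"
    define y where "y = C *\<^sub>v v"
    have x: "x \<in> carrier_vec d" and y: "y \<in> carrier_vec d"
      using B'(1) C'(1) v by (auto simp: x_def y_def)
    have "x \<bullet> x = v \<bullet> ((B * B) *\<^sub>v v)"
      using transpose_vec_mult_scalar[OF B'(1) x v] B' v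
      by (simp add: x_def assoc_mult_mat_vec[of _ d d _ d])
    moreover have "y \<bullet> y = v \<bullet> ((C * C) *\<^sub>v v)"
      using transpose_vec_mult_scalar[OF C'(1) y v] C' v
      by (simp add: y_def assoc_mult_mat_vec[of _ d d _ d])
    ultimately have xy: "x \<bullet> x = y \<bullet> y" using eq by simp
    have "(x - y) \<bullet> (x + y) = x \<bullet> x - y \<bullet> y"
      using x y comm_scalar_prod[OF x y]
      by (simp add: scalar_prod_add_distrib[of _ d] minus_scalar_prod_distrib[of _ d])
    moreover have "(x - y) \<bullet> (x + y) = m i * (v \<bullet> x + v \<bullet> y)"
      using diff x y v by (simp add: x_def[symmetric] y_def[symmetric] scalar_prod_add_distrib[of _ d] distrib_left)
    ultimately have 1: "m i * (v \<bullet> x + v \<bullet> y) = 0" using xy by simp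
    have "v \<bullet> x - v \<bullet> y = v \<bullet> (x - y)" using x y v by (simp add: scalar_prod_minus_distrib[of _ d])
    also have "\<dots> = m i" using diff v v1 by (simp add: x_def y_def)
    finally have 2: "v \<bullet> x - v \<bullet> y = m i" .
    have "0 \<le> v \<bullet> x" "0 \<le> v \<bullet> y" using B'(3)[OF v] C'(3)[OF v] by (auto simp: x_def y_def)
    with 1 2 show "m i = 0" by (auto simp: mult_eq_0_iff)
  qed
  then have "mat_diag d m = 0\<^sub>m d d" by (auto simp: mat_diag_def intro!: eq_matI)
  then have BC: "B - C = 0\<^sub>m d d" using QM Q'(1,2) by simp
  show ?thesis
  proof (rule eq_matI)
    fix i j assume "i < dim_row C" "j < dim_col C"
    then show "B $$ (i,j) = C $$ (i,j)"
      using arg_cong[OF BC, of "\<lambda>M. M $$ (i,j)"] B'(1) C'(1) by simp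
  qed (use B'(1) C'(1) in auto)
qed

lemma mat_sqrt_eqI:
  assumes B: "B \<in> psd_mats d" and "B * B = A"
  shows "mat_sqrt A = B"
proof -
  have "dim_row A = d" using assms psd_matsD(1)[OF B] by auto
  then show ?thesis unfolding mat_sqrt_def
    using assms by (intro the_equality) (auto intro: psd_root_unique)
qed

lemma mat_sqrt_spectral:
  assumes Q: "orthonormal_mat d Q" and l: "\<And>i. i < d \<Longrightarrow> 0 \<le> l i"
  shows "mat_sqrt (Q * mat_diag d l * transpose_mat Q) = Q * mat_diag d (\<lambda>i. sqrt (l i)) * transpose_mat Q"
proof (rule mat_sqrt_eqI)
  show "Q * mat_diag d (\<lambda>i. sqrt (l i)) * transpose_mat Q \<in> psd_mats d"
    using l orthonormal_matD(1)[OF Q] by (intro psd_mats_congruence mat_diag_psd) auto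
  have "mat_diag d (\<lambda>i. sqrt (l i) * sqrt (l i)) = mat_diag d l"
    using l by (auto simp: mat_diag_def intro!: eq_matI)
  then show "Q * mat_diag d (\<lambda>i. sqrt (l i)) * transpose_mat Q *
      (Q * mat_diag d (\<lambda>i. sqrt (l i)) * transpose_mat Q) = Q * mat_diag d l * transpose_mat Q"
    by (subst orthonormal_conj_mult[OF Q]) auto
qed

lemma mat_sqrt_psd:
  assumes "A \<in> psd_mats d"
  shows "mat_sqrt A \<in> psd_mats d" "mat_sqrt A * mat_sqrt A = A"
proof -
  obtain Q l where Q: "orthonormal_mat d Q" and A: "A = Q * mat_diag d l * transpose_mat Q"
    and l: "\<And>i. i < d \<Longrightarrow> 0 \<le> l i" using psd_spectral[OF assms] by blast
  have sqrt: "mat_sqrt A = Q * mat_diag d (\<lambda>i. sqrt (l i)) * transpose_mat Q"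
    unfolding A by (rule mat_sqrt_spectral[OF Q l])
  show "mat_sqrt A \<in> psd_mats d" unfolding sqrt
    using l orthonormal_matD(1)[OF Q] by (intro psd_mats_congruence mat_diag_psd) auto
  have "mat_diag d (\<lambda>i. sqrt (l i) * sqrt (l i)) = mat_diag d l"
    using l by (auto simp: mat_diag_def intro!: eq_matI)
  then show "mat_sqrt A * mat_sqrt A = A" unfolding sqrt
    by (subst orthonormal_conj_mult[OF Q]) (auto simp: A)
qed

section \<open>Inverses of matrices and of square roots\<close>

lemma mat_inv_eqI:
  assumes A: "A \<in> carrier_mat d d" and B: "B \<in> carrier_mat d d" and AB: "A * B = 1\<^sub>m d"
  shows "mat_inv A = B"
proof (cases "mat_inverse A")
  case None
  have "B * A = 1\<^sub>m d" using mat_mult_left_right_inverse[OF A B AB] .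
  then have "A \<in> Units (ring_mat TYPE(real) d ())"
    using A B AB by (auto simp: Units_def ring_mat_def)
  with mat_inverse(1)[OF A None, of "()"] show ?thesis by simp
next
  case (Some C)
  note C = mat_inverse(2)[OF A Some]
  then have C: "C \<in> carrier_mat d d" "C * A = 1\<^sub>m d" by auto
  have "C = C * (A * B)" using AB C by simp
  also have "\<dots> = (C * A) * B" using A B C(1) by (simp add: assoc_mult_mat[of _ d d _ d _ d])
  also have "\<dots> = B" using B C by simp
  finally show ?thesis using Some by (simp add: mat_inv_def)
qed

lemma invertible_mat_obtain:
  assumes "invertible_mat A" and A: "A \<in> carrier_mat d d"
  obtains X where "X \<in> carrier_mat d d" "A * X = 1\<^sub>m d" "X * A = 1\<^sub>m d"
proof -
  obtain X where X: "A * X = 1\<^sub>m d" "X * A = 1\<^sub>m (dim_row X)"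
    using assms by (auto simp: invertible_mat_def inverts_mat_def)
  have "dim_col X = d" using arg_cong[OF X(1), of dim_col] by simp
  moreover have "dim_row X = d" using arg_cong[OF X(2), of dim_col] A by simp
  ultimately show ?thesis using that X by auto
qed

text \<open>If A X = 1, then S (S X) = 1 for the root S of A, so \<open>S * X\<close> inverts the
  root. It is symmetric because its transpose is another inverse of the symmetric S.\<close>

lemma mat_sqrt_invertible:
  assumes A: "A \<in> psd_mats d" and inv: "invertible_mat A"
  obtains R where "R \<in> carrier_mat d d" "transpose_mat R = R"
    "mat_sqrt A * R = 1\<^sub>m d" "R * mat_sqrt A = 1\<^sub>m d"
    "mat_inv (mat_sqrt A) = R" "mat_inv A = R * R"
proof -
  define S where "S = mat_sqrt A"
  have S: "S \<in> carrier_mat d d" "transpose_mat S = S" "S * S = A"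
    using mat_sqrt_psd[OF A] psd_matsD by (auto simp: S_def)
  have A': "A \<in> carrier_mat d d" using psd_matsD[OF A] by simp
  obtain X where X: "X \<in> carrier_mat d d" "A * X = 1\<^sub>m d"
    using invertible_mat_obtain[OF inv A'] .
  define R where "R = S * X"
  have R: "R \<in> carrier_mat d d" using S X by (simp add: R_def)
  have SR: "S * R = 1\<^sub>m d" using S(1) X S(3)
    by (simp add: R_def assoc_mult_mat[of _ d d _ d _ d, symmetric])
  have RS: "R * S = 1\<^sub>m d" by (rule mat_mult_left_right_inverse[OF S(1) R SR])
  have RT: "transpose_mat R = R"
  proof -
    have "transpose_mat R * S = 1\<^sub>m d"
      using arg_cong[OF SR, of transpose_mat] S R by (simp add: transpose_mult[of _ d d _ d])
    then have "transpose_mat R * S * R = R" using R by simp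
    moreover have "transpose_mat R * S * R = transpose_mat R * (S * R)"
      using R S(1) by (simp add: assoc_mult_mat[of _ d d _ d _ d])
    ultimately show ?thesis using SR R by simp
  qed
  have "A * (R * R) = S * (S * R) * R"
    using S R by (simp add: S(3)[symmetric] assoc_mult_mat[of _ d d _ d _ d])
  also have "\<dots> = 1\<^sub>m d" using SR S by simp
  finally have "mat_inv A = R * R" using A' R by (intro mat_inv_eqI) auto
  moreover have "mat_inv S = R" using S(1) R SR by (rule mat_inv_eqI)
  ultimately show ?thesis using that R RT SR RS by (simp add: S_def)
qed

section \<open>The Frobenius norm under orthogonal maps\<close>

lemma frobenius_norm_transpose: "frobenius_norm (transpose_mat A) = frobenius_norm A"
proof -
  have "(\<Sum>i<dim_col A. \<Sum>j<dim_row A. (transpose_mat A $$ (i,j))\<^sup>2) =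
      (\<Sum>i<dim_col A. \<Sum>j<dim_row A. (A $$ (j,i))\<^sup>2)"
    by (intro sum.cong) auto
  also have "\<dots> = (\<Sum>i<dim_row A. \<Sum>j<dim_col A. (A $$ (i,j))\<^sup>2)" by (rule sum.swap)
  finally show ?thesis by (simp add: frobenius_norm_def)
qed

lemma frobenius_norm_cols:
  assumes "A \<in> carrier_mat n d"
  shows "frobenius_norm A = sqrt (\<Sum>j<d. col A j \<bullet> col A j)"
proof -
  have "(\<Sum>i<n. \<Sum>j<d. (A $$ (i,j))\<^sup>2) = (\<Sum>j<d. \<Sum>i<n. (A $$ (i,j))\<^sup>2)" by (rule sum.swap)
  also have "\<dots> = (\<Sum>j<d. col A j \<bullet> col A j)"
    using assms by (intro sum.cong) (auto simp: scalar_prod_def atLeast0LessThan power2_eq_square)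
  finally show ?thesis using assms by (auto simp: frobenius_norm_def)
qed

lemma frobenius_norm_orthonormal_left:
  assumes Q: "orthonormal_mat d Q" and A: "A \<in> carrier_mat d d"
  shows "frobenius_norm (Q * A) = frobenius_norm A"
proof -
  note Q' = orthonormal_matD[OF Q]
  have "col (Q * A) j \<bullet> col (Q * A) j = col A j \<bullet> col A j" if j: "j < d" for j
  proof -
    define v where "v = col A j"
    have v: "v \<in> carrier_vec d" using A j by (simp add: v_def)
    have Qv: "Q *\<^sub>v v \<in> carrier_vec d" using Q' v by simp
    have "(Q *\<^sub>v v) \<bullet> (Q *\<^sub>v v) = (transpose_mat Q *\<^sub>v (Q *\<^sub>v v)) \<bullet> v"
      using transpose_vec_mult_scalar[OF Q'(1) v Qv] by simp
    also have "transpose_mat Q *\<^sub>v (Q *\<^sub>v v) = v"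
      using Q' v by (simp add: assoc_mult_mat_vec[of _ d d _ d, symmetric])
    finally show ?thesis using col_mult2[OF Q'(1) A j] by (simp add: v_def)
  qed
  then show ?thesis using Q'(1) A by (simp add: frobenius_norm_cols[of _ d d])
qed

text \<open>An orthogonal factor on the left acts on each column as an isometry; a transposition
  brings the right factor to the left. The norm of a symmetric matrix is thereby read off its
  eigenvalues.\<close>

lemma frobenius_norm_diag_conj:
  assumes Q: "orthonormal_mat d Q"
  shows "frobenius_norm (Q * mat_diag d l * transpose_mat Q) = sqrt (\<Sum>i<d. (l i)\<^sup>2)"
proof -
  note Q' = orthonormal_matD[OF Q]
  have D: "mat_diag d l \<in> carrier_mat d d" by simp
  have "frobenius_norm (Q * mat_diag d l * transpose_mat Q) = frobenius_norm (Q * (mat_diag d l * transpose_mat Q))"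
    using Q'(1,2) by (simp add: assoc_mult_mat[of _ d d _ d _ d])
  also have "\<dots> = frobenius_norm (mat_diag d l * transpose_mat Q)"
    using Q'(2) D by (intro frobenius_norm_orthonormal_left[OF Q] mult_carrier_mat)
  also have "\<dots> = frobenius_norm (transpose_mat (mat_diag d l * transpose_mat Q))"
    by (simp add: frobenius_norm_transpose)
  also have "transpose_mat (mat_diag d l * transpose_mat Q) = Q * mat_diag d l"
    using Q'(1,2) by (simp add: transpose_mult[of _ d d _ d])
  also have "frobenius_norm \<dots> = frobenius_norm (mat_diag d l)"
    by (intro frobenius_norm_orthonormal_left[OF Q]) auto
  also have "\<dots> = sqrt (\<Sum>i<d. (l i)\<^sup>2)"
  proof -
    have "(\<Sum>j<d. (mat_diag d l $$ (i,j))\<^sup>2) = (l i)\<^sup>2" if "i < d" for i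
    proof -
      have "(\<Sum>j<d. (mat_diag d l $$ (i,j))\<^sup>2) = (\<Sum>j<d. if j = i then (l i)\<^sup>2 else 0)"
        using that by (intro sum.cong) (auto simp: mat_diag_def)
      then show ?thesis using that by simp
    qed
    then show ?thesis by (simp add: frobenius_norm_def mat_diag_def)
  qed
  finally show ?thesis .
qed

lemma mat_diag_cong: "(\<And>i. i < d \<Longrightarrow> f i = g i) \<Longrightarrow> mat_diag d f = mat_diag d g"
  by (auto simp: mat_diag_def intro!: eq_matI)

lemma mat_diag_conj_minus_one:
  assumes Q: "orthonormal_mat d Q"
  shows "Q * mat_diag d l * transpose_mat Q - 1\<^sub>m d = Q * mat_diag d (\<lambda>i. l i - 1) * transpose_mat Q"
proof -
  note Q' = orthonormal_matD[OF Q]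
  obtain D where D: "mat_diag d l = D" "D \<in> carrier_mat d d" by (metis mat_diag_dim)
  have "mat_diag d (\<lambda>i. l i - 1) = D - 1\<^sub>m d"
    unfolding D(1)[symmetric] by (auto simp: mat_diag_def intro!: eq_matI)
  then have "Q * mat_diag d (\<lambda>i. l i - 1) * transpose_mat Q
      = (Q * D - Q * 1\<^sub>m d) * transpose_mat Q"
    using Q'(1) D(2) by (simp add: mult_minus_distrib_mat[of _ d d])
  also have "\<dots> = Q * D * transpose_mat Q - 1\<^sub>m d"
    using Q' D(2) by (simp add: minus_mult_distrib_mat[of _ d d])
  finally show ?thesis by (simp add: D(1))
qed

text \<open>Simultaneous diagonalization of the two covariances. Diagonalize A^(1/2) B^(-1) A^(1/2)
  by an orthogonal W with eigenvalues \<mu> and put T = A^(1/2) W; then A = T T^t and B = T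
  diag(1/\<mu>) T^t. The symmetric roots differ from T and from T diag(1/sqrt \<mu>) only by
  orthogonal factors on the right, to which Gaussian samples are insensitive. The two orders of
  closeness become the bounds on \<mu> and on 1/\<mu>.\<close>

lemma relatively_close_factorization:
  assumes A: "A \<in> psd_mats d" and B: "B \<in> psd_mats d"
    and AB: "relatively_close d \<Delta> A B" and BA: "relatively_close d \<Delta> B A"
  obtains T U V \<mu> where "T \<in> carrier_mat d d" "orthonormal_mat d U" "orthonormal_mat d V"
    "mat_sqrt A = T * U" "mat_sqrt B = T * mat_diag d (\<lambda>i. 1 / sqrt (\<mu> i)) * V"
    "\<And>i. i < d \<Longrightarrow> 0 < \<mu> i"
    "sqrt (\<Sum>i<d. (\<mu> i - 1)\<^sup>2) \<le> \<Delta>" "sqrt (\<Sum>i<d. (1 / \<mu> i - 1)\<^sup>2) \<le> \<Delta>"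
proof -
  obtain R where R: "R \<in> carrier_mat d d" "transpose_mat R = R"
    "mat_sqrt A * R = 1\<^sub>m d" "R * mat_sqrt A = 1\<^sub>m d" "mat_inv A = R * R"
    using mat_sqrt_invertible[OF A] BA by (auto simp: relatively_close_def)
  obtain S where S: "S \<in> carrier_mat d d" "transpose_mat S = S"
    "mat_sqrt B * S = 1\<^sub>m d" "S * mat_sqrt B = 1\<^sub>m d" "mat_inv B = S * S"
    using mat_sqrt_invertible[OF B] AB by (auto simp: relatively_close_def)
  define P where "P = mat_sqrt A"
  define Y where "Y = mat_sqrt B"
  have P: "P \<in> carrier_mat d d" "transpose_mat P = P" "P * R = 1\<^sub>m d" "R * P = 1\<^sub>m d"
    using psd_matsD[OF mat_sqrt_psd(1)[OF A]] R by (auto simp: P_def)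
  have Y: "Y \<in> carrier_mat d d" "transpose_mat Y = Y" "Y * S = 1\<^sub>m d" "S * Y = 1\<^sub>m d"
    using psd_matsD[OF mat_sqrt_psd(1)[OF B]] S by (auto simp: Y_def)
  \<comment> \<open>The comparison matrix \<open>K\<close> is \<open>N\<close> times its transpose,
    hence positive semidefinite; the inverse \<open>N'\<close> of \<open>N\<close> will exclude the
    eigenvalue zero.\<close>
  define N where "N = P * S"
  define N' where "N' = Y * R"
  have N: "N \<in> carrier_mat d d" and N': "N' \<in> carrier_mat d d"
    using P(1) Y(1) R(1) S(1) by (auto simp: N_def N'_def)
  have "N * N' = P * (S * Y) * R" using P(1) Y(1) R(1) S(1)
    by (simp add: N_def N'_def assoc_mult_mat[of _ d d _ d _ d])
  then have NN': "N * N' = 1\<^sub>m d" using P Y by simp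
  then have N'N: "N' * N = 1\<^sub>m d" using mat_mult_left_right_inverse[OF N N'] by simp
  define K where "K = N * transpose_mat N"
  have NT: "transpose_mat N = S * P" using P(1,2) S(1,2) by (simp add: N_def transpose_mult[of _ d d _ d])
  have K: "K = P * (S * S) * P" using P(1) S(1)
    unfolding K_def NT unfolding N_def by (simp add: assoc_mult_mat[of _ d d _ d _ d])
  have one_psd: "1\<^sub>m d \<in> psd_mats d" using mat_diag_psd[of d "\<lambda>_. 1"] by simp
  have "K \<in> psd_mats d" using psd_mats_congruence[OF one_psd N] N by (simp add: K_def)
  then obtain W \<mu> where W: "orthonormal_mat d W" and KW: "K = W * mat_diag d \<mu> * transpose_mat W"
    and \<mu>0: "\<And>i. i < d \<Longrightarrow> 0 \<le> \<mu> i" using psd_spectral by blast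
  note W' = orthonormal_matD[OF W]
  have KD: "transpose_mat W * K * W = mat_diag d \<mu>"
    unfolding KW by (rule orthonormal_conj_cancel[OF W]) simp
  have \<mu>: "0 < \<mu> i" if i: "i < d" for i
  proof -
    define w where "w = col W i"
    have w: "w \<in> carrier_vec d" using W'(1) i by (simp add: w_def)
    have "\<mu> i \<noteq> 0"
    proof
      assume "\<mu> i = 0"
      \<comment> \<open>Row i of \<open>X\<close> has squared length \<open>\<mu> i\<close>, so it
        would be zero, although \<open>X\<close> has the right inverse
        \<open>N' * W\<close>.\<close>
      define X where "X = transpose_mat W * N"
      have X: "X \<in> carrier_mat d d" using W' N by (simp add: X_def)
      have "X * transpose_mat X = mat_diag d \<mu>"
        using W'(1,2) N KD by (simp add: X_def K_def transpose_mult[of _ d d _ d] assoc_mult_mat[of _ d d _ d _ d])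
      then have "(X * transpose_mat X) $$ (i,i) = 0" using i \<open>\<mu> i = 0\<close> by (simp add: mat_diag_def)
      then have "row X i \<bullet> row X i = 0" using X i by simp
      then have "row X i = 0\<^sub>v d" using X i conjugate_square_eq_0_vec[of "row X i" d] by simp
      then have "row (X * (N' * W)) i = 0\<^sub>v d"
        using X N' W'(1) i by (intro eq_vecI) auto
      moreover have "X * (N' * W) = 1\<^sub>m d"
      proof -
        have "X * (N' * W) = transpose_mat W * (N * N') * W"
          using W'(1,2) N N' by (simp add: X_def assoc_mult_mat[of _ d d _ d _ d])
        then show ?thesis using NN' W' by simp
      qed
      ultimately have "(1\<^sub>m d :: real mat) $$ (i,i) = 0" using i by (metis index_row(1) index_one_mat(2,3) index_zero_vec(1))
      then show False using i by simp
    qed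
    with \<mu>0[OF i] show ?thesis by simp
  qed
  define h where "h = (\<lambda>i. 1 / sqrt (\<mu> i))"
  define H where "H = mat_diag d h"
  have H: "H \<in> carrier_mat d d" "transpose_mat H = H" by (auto simp: H_def)
  define T where "T = P * W"
  have T: "T \<in> carrier_mat d d" using P W' by (simp add: T_def)
  have PT: "P = T * transpose_mat W"
    using P(1) W' by (simp add: T_def assoc_mult_mat[of _ d d _ d _ d])
  \<comment> \<open>Chosen so that \<open>Y * V = T * H\<close>. It is orthonormal because its Gram
    matrix is \<open>H\<close> times the diagonalized \<open>K\<close> times \<open>H\<close>, with
    entries h \<mu> h = 1.\<close>
  define V where "V = S * T * H"
  have V: "V \<in> carrier_mat d d" using S(1) T H(1) by (simp add: V_def)
  have VT: "transpose_mat V = H * (transpose_mat W * P * S)"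
    using S(1,2) W'(1,2) P(1,2) H
    by (simp add: V_def T_def transpose_mult[of _ d d _ d] assoc_mult_mat[of _ d d _ d _ d])
  have "transpose_mat V * V = H * (transpose_mat W * (P * (S * S) * P) * W) * H"
    unfolding VT using S(1) W'(1,2) P(1) H(1)
    by (simp add: V_def T_def assoc_mult_mat[of _ d d _ d _ d])
  also have "\<dots> = mat_diag d (\<lambda>i. h i * \<mu> i * h i)"
    using KD by (simp add: K[symmetric] H_def)
  also have "\<dots> = mat_diag d (\<lambda>i. 1)"
  proof (rule mat_diag_cong)
    fix i assume "i < d"
    then have m: "0 < \<mu> i" by (rule \<mu>)
    then have "\<mu> i = sqrt (\<mu> i) * sqrt (\<mu> i)" by simp
    then show "h i * \<mu> i * h i = 1" using m by (simp add: h_def field_simps)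
  qed
  finally have Vo: "orthonormal_mat d V" using V by (simp add: orthonormal_mat_def)
  note V' = orthonormal_matD[OF Vo]
  have "Y * V = T * H"
  proof -
    have "Y * V = (Y * S) * (T * H)"
      using Y(1) S(1) T H(1) by (simp add: V_def assoc_mult_mat[of _ d d _ d _ d])
    then show ?thesis using Y(3) T H(1) by simp
  qed
  then have "Y * (V * transpose_mat V) = T * H * transpose_mat V"
    using Y(1) V'(1,2) by (simp add: assoc_mult_mat[of _ d d _ d _ d, symmetric])
  then have OV: "Y = T * H * transpose_mat V" using Y(1) V'(4) by simp
  \<comment> \<open>Since R P = 1, the product \<open>R * Y\<close> collapses to W H V^t. The
    reversed comparison matrix is therefore diagonal in the basis \<open>V\<close>, with eigenvalues
    h^2 = 1/\<mu>.\<close>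
  have K2: "Y * (R * R) * Y = V * mat_diag d (\<lambda>i. 1 / \<mu> i) * transpose_mat V"
  proof -
    have "R * Y = (R * P) * (W * H * transpose_mat V)"
      unfolding OV T_def using R(1) P(1) W'(1) H(1) V'(2)
      by (simp add: assoc_mult_mat[of _ d d _ d _ d])
    then have RO: "R * Y = W * H * transpose_mat V"
      using P(4) left_mult_one_mat[OF mult_carrier_mat[OF mult_carrier_mat[OF W'(1) H(1)] V'(2)]] by simp
    have "Y * R = transpose_mat (R * Y)" using R(1,2) Y(1,2) by (simp add: transpose_mult[of _ d d _ d])
    also have "\<dots> = V * (H * transpose_mat W)"
      unfolding RO using W'(1,2) H V'(1,2) by (simp add: transpose_mult[of _ d d _ d])
    finally have OR: "Y * R = V * (H * transpose_mat W)" .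
    have "Y * (R * R) * Y = (Y * R) * (R * Y)"
      using R(1) Y(1) by (simp add: assoc_mult_mat[of _ d d _ d _ d])
    also have "\<dots> = V * H * (transpose_mat W * W) * H * transpose_mat V"
      unfolding RO OR using W'(1,2) H(1) V'(1,2) by (simp add: assoc_mult_mat[of _ d d _ d _ d])
    also have "\<dots> = V * (H * H) * transpose_mat V"
      using W'(3) H(1) V'(1,2) by (simp add: assoc_mult_mat[of _ d d _ d _ d])
    also have "H * H = mat_diag d (\<lambda>i. 1 / \<mu> i)"
      unfolding H_def mat_diag_diag by (rule mat_diag_cong) (use \<mu> in \<open>auto simp: h_def abs_of_pos\<close>)
    finally show ?thesis .
  qed
  have "sqrt (\<Sum>i<d. (\<mu> i - 1)\<^sup>2) \<le> \<Delta>"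
  proof -
    have "frobenius_norm (K - 1\<^sub>m d) \<le> \<Delta>"
      using AB by (simp add: relatively_close_def K P_def S(5))
    then show ?thesis unfolding KW mat_diag_conj_minus_one[OF W] frobenius_norm_diag_conj[OF W] .
  qed
  moreover have "sqrt (\<Sum>i<d. (1 / \<mu> i - 1)\<^sup>2) \<le> \<Delta>"
  proof -
    have "frobenius_norm (Y * (R * R) * Y - 1\<^sub>m d) \<le> \<Delta>"
      using BA by (simp add: relatively_close_def Y_def R(5))
    then show ?thesis unfolding K2 mat_diag_conj_minus_one[OF Vo] frobenius_norm_diag_conj[OF Vo] .
  qed
  ultimately show ?thesis
    using that[OF T orthonormal_transpose[OF W] orthonormal_transpose[OF Vo], of \<mu>] PT OV \<mu>
    by (simp add: P_def Y_def H_def h_def)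
qed

section \<open>Second moment matrices\<close>

lemma second_moment_mat_carrier [simp]: "second_moment_mat d k g \<in> carrier_mat d d"
  by (simp add: second_moment_mat_def)

lemma second_moment_mat_mult:
  assumes T: "T \<in> carrier_mat d d" and z: "\<And>i. i < k \<Longrightarrow> z i \<in> carrier_vec d"
  shows "second_moment_mat d k (\<lambda>i. T *\<^sub>v z i) = T * second_moment_mat d k z * transpose_mat T"
proof (rule eq_matI)
  let ?S = "second_moment_mat d k z"
  fix a b assume "a < dim_row (T * ?S * transpose_mat T)" "b < dim_col (T * ?S * transpose_mat T)"
  then have ab: "a < d" "b < d" using T by auto
  have "(T * ?S * transpose_mat T) $$ (a,b)
      = (\<Sum>q<d. (\<Sum>p<d. T $$ (a,p) * (1 / real k * (\<Sum>i<k. z i $ p * z i $ q))) * T $$ (b,q))"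
    using T ab by (simp add: second_moment_mat_def scalar_prod_def atLeast0LessThan)
  also have "\<dots> = (\<Sum>q<d. \<Sum>p<d. \<Sum>i<k. 1 / real k * (T $$ (a,p) * z i $ p) * (T $$ (b,q) * z i $ q))"
    by (simp add: sum_distrib_left sum_distrib_right ac_simps)
  also have "\<dots> = (\<Sum>i<k. \<Sum>q<d. \<Sum>p<d. 1 / real k * (T $$ (a,p) * z i $ p) * (T $$ (b,q) * z i $ q))"
    by (subst (2) sum.swap, subst sum.swap) simp
  also have "\<dots> = 1 / real k * (\<Sum>i<k. (\<Sum>p<d. T $$ (a,p) * z i $ p) * (\<Sum>q<d. T $$ (b,q) * z i $ q))"
    by (simp add: sum_distrib_left sum_distrib_right ac_simps)
  also have "\<dots> = 1 / real k * (\<Sum>i<k. (T *\<^sub>v z i) $ a * (T *\<^sub>v z i) $ b)"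
  proof -
    have "(T *\<^sub>v z i) $ c = (\<Sum>p<d. T $$ (c,p) * z i $ p)" if "i < k" "c < d" for i c
      using T z[OF that(1)] that(2) by (simp add: scalar_prod_def atLeast0LessThan)
    then show ?thesis using ab by simp
  qed
  finally show "second_moment_mat d k (\<lambda>i. T *\<^sub>v z i) $$ (a,b) = (T * ?S * transpose_mat T) $$ (a,b)"
    using ab by (simp add: second_moment_mat_def)
qed (use T in \<open>auto simp: second_moment_mat_def\<close>)

section \<open>Matrix powers and polynomial approximation of the root\<close>

lemma orthonormal_conj_entry:
  assumes Q: "orthonormal_mat d Q" and ab: "a < d" "b < d"
  shows "(Q * mat_diag d l * transpose_mat Q) $$ (a,b) = (\<Sum>j<d. Q $$ (a,j) * l j * Q $$ (b,j))"
  using orthonormal_matD(1)[OF Q] ab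
  by (simp add: mat_diag_mult_right[of _ d d] scalar_prod_def atLeast0LessThan)

lemma orthonormal_conj_pow:
  assumes Q: "orthonormal_mat d Q"
  shows "(Q * mat_diag d l * transpose_mat Q) ^\<^sub>m i = Q * mat_diag d (\<lambda>j. l j ^ i) * transpose_mat Q"
proof (induction i)
  case 0
  then show ?case using orthonormal_matD[OF Q] by auto
next
  case (Suc i)
  then show ?case by (simp add: orthonormal_conj_mult[OF Q] mult.commute)
qed

text \<open>Polynomials that converge to the square root pointwise on the half line converge, when
  evaluated at a positive semidefinite matrix, to its square root; this makes the root measurable.\<close>

lemma mat_sqrt_polynomial_limit:
  obtains c :: "nat \<Rightarrow> nat \<Rightarrow> real" and N :: "nat \<Rightarrow> nat" where
    "\<And>d A a b. A \<in> psd_mats d \<Longrightarrow> a < d \<Longrightarrow> b < d \<Longrightarrow>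
      (\<lambda>n. \<Sum>i\<le>N n. c n i * (A ^\<^sub>m i) $$ (a,b)) \<longlonglongrightarrow> mat_sqrt A $$ (a,b)"
proof -
  \<comment> \<open>The intervals grow while the errors shrink: no single interval contains the
    eigenvalues of all matrices, but each eigenvalue lies in all but finitely many of these.\<close>
  have "\<exists>c (N::nat). \<forall>x\<in>{0..real n}. \<bar>sqrt x - (\<Sum>i\<le>N. c i * x ^ i)\<bar> < 1 / real (Suc n)" for n :: nat
  proof -
    have "continuous_on {0..real n} sqrt" by (intro continuous_intros)
    then obtain g where g: "real_polynomial_function g" "\<And>x. x \<in> {0..real n} \<Longrightarrow> \<bar>sqrt x - g x\<bar> < 1 / real (Suc n)"
      using Stone_Weierstrass_real_polynomial_function[of "{0..real n}" sqrt "1 / real (Suc n)"]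
      by (metis compact_Icc of_nat_0_less_iff zero_less_Suc zero_less_divide_1_iff)
    obtain c N where "g = (\<lambda>x. \<Sum>i\<le>N. c i * x ^ i)"
      using g(1) by (auto simp: real_polynomial_function_iff_sum)
    with g(2) show ?thesis by blast
  qed
  then obtain c N where cN: "\<And>n x. x \<in> {0..real n} \<Longrightarrow>
      \<bar>sqrt x - (\<Sum>i\<le>(N n :: nat). c n i * x ^ i)\<bar> < 1 / real (Suc n)" by metis
  have lim: "(\<lambda>n. \<Sum>i\<le>N n. c n i * x ^ i) \<longlonglongrightarrow> sqrt x" if "0 \<le> x" for x
  proof (rule LIMSEQ_I)
    fix r :: real assume "0 < r"
    obtain m where m: "x \<le> real m" using real_arch_simple by blast
    obtain m' where m': "1 / real (Suc m') < r" using nat_approx_posE[OF \<open>0 < r\<close>] by auto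
    have "norm ((\<Sum>i\<le>N n. c n i * x ^ i) - sqrt x) < r" if n: "max m m' \<le> n" for n
    proof -
      have "\<bar>sqrt x - (\<Sum>i\<le>N n. c n i * x ^ i)\<bar> < 1 / real (Suc n)"
        using m n \<open>0 \<le> x\<close> by (intro cN) auto
      also have "\<dots> \<le> 1 / real (Suc m')" using n by (intro divide_left_mono) auto
      finally show ?thesis using m' by simp
    qed
    then show "\<exists>n0. \<forall>n\<ge>n0. norm ((\<Sum>i\<le>N n. c n i * x ^ i) - sqrt x) < r" by blast
  qed
  have "(\<lambda>n. \<Sum>i\<le>N n. c n i * (A ^\<^sub>m i) $$ (a,b)) \<longlonglongrightarrow> mat_sqrt A $$ (a,b)"
    if A: "A \<in> psd_mats d" and ab: "a < d" "b < d" for d A a b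
  proof -
    obtain Q l where Q: "orthonormal_mat d Q" and AQ: "A = Q * mat_diag d l * transpose_mat Q"
      and l: "\<And>i. i < d \<Longrightarrow> 0 \<le> l i" using psd_spectral[OF A] by blast
    have "(\<Sum>i\<le>N n. c n i * (A ^\<^sub>m i) $$ (a,b))
        = (\<Sum>j<d. Q $$ (a,j) * (\<Sum>i\<le>N n. c n i * l j ^ i) * Q $$ (b,j))" for n
    proof -
      have "(\<Sum>i\<le>N n. c n i * (A ^\<^sub>m i) $$ (a,b))
          = (\<Sum>i\<le>N n. \<Sum>j<d. Q $$ (a,j) * (c n i * l j ^ i) * Q $$ (b,j))"
        unfolding AQ orthonormal_conj_pow[OF Q] orthonormal_conj_entry[OF Q ab]
        by (simp add: sum_distrib_left ac_simps)
      also have "\<dots> = (\<Sum>j<d. Q $$ (a,j) * (\<Sum>i\<le>N n. c n i * l j ^ i) * Q $$ (b,j))"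
        by (subst sum.swap) (simp add: sum_distrib_left sum_distrib_right)
      finally show ?thesis .
    qed
    moreover have "(\<lambda>n. \<Sum>j<d. Q $$ (a,j) * (\<Sum>i\<le>N n. c n i * l j ^ i) * Q $$ (b,j))
        \<longlonglongrightarrow> (\<Sum>j<d. Q $$ (a,j) * sqrt (l j) * Q $$ (b,j))"
      using l lim by (intro tendsto_intros) auto
    ultimately show ?thesis
      by (simp add: AQ mat_sqrt_spectral[OF Q l] orthonormal_conj_entry[OF Q ab])
  qed
  with that show ?thesis by blast
qed

section \<open>Rotation invariance of Gaussian samples\<close>

text \<open>The preimage of a box is a box, and a product of sigma-finite measures is determined on
  boxes. Sigma-finiteness of the images is a separate assumption because maps do not preserve it;
  the same holds for densities in the next lemma.\<close>

lemma distr_PiM_componentwise: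
  assumes I: "finite I" and f: "\<And>i. f i \<in> measurable (M i) (N i)"
    and M: "\<And>i. sigma_finite_measure (M i)"
    and D: "\<And>i. sigma_finite_measure (distr (M i) (N i) (f i))"
  shows "distr (PiM I M) (PiM I N) (\<lambda>x. \<lambda>i\<in>I. f i (x i)) = PiM I (\<lambda>i. distr (M i) (N i) (f i))"
proof -
  note f[measurable]
  interpret M: product_sigma_finite M using M by (simp add: product_sigma_finite_def)
  interpret D: product_sigma_finite "\<lambda>i. distr (M i) (N i) (f i)"
    using D by (simp add: product_sigma_finite_def)
  have F[measurable]: "(\<lambda>x. \<lambda>i\<in>I. f i (x i)) \<in> measurable (PiM I M) (PiM I N)"
    by (rule measurable_restrict) measurable
  show ?thesis
  proof (rule D.PiM_eqI[OF I])
    show "sets (distr (PiM I M) (PiM I N) (\<lambda>x. \<lambda>i\<in>I. f i (x i))) = sets (PiM I (\<lambda>i. distr (M i) (N i) (f i)))"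
      by (simp cong: sets_PiM_cong)
    fix A assume "\<And>i. i \<in> I \<Longrightarrow> A i \<in> sets (distr (M i) (N i) (f i))"
    then have A: "\<And>i. i \<in> I \<Longrightarrow> A i \<in> sets (N i)" by simp
    then have AP: "Pi\<^sub>E I A \<in> sets (PiM I N)" using I by (intro sets_PiM_I_finite) auto
    have "(\<lambda>x. \<lambda>i\<in>I. f i (x i)) -` Pi\<^sub>E I A \<inter> space (PiM I M)
        = Pi\<^sub>E I (\<lambda>i. f i -` A i \<inter> space (M i))"
      by (auto simp: space_PiM PiE_iff)
    then have "emeasure (distr (PiM I M) (PiM I N) (\<lambda>x. \<lambda>i\<in>I. f i (x i))) (Pi\<^sub>E I A)
        = emeasure (PiM I M) (Pi\<^sub>E I (\<lambda>i. f i -` A i \<inter> space (M i)))"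
      using AP by (simp add: emeasure_distr)
    also have "\<dots> = (\<Prod>i\<in>I. emeasure (M i) (f i -` A i \<inter> space (M i)))"
      using I A measurable_sets[OF f] by (intro M.emeasure_PiM) auto
    also have "\<dots> = (\<Prod>i\<in>I. emeasure (distr (M i) (N i) (f i)) (A i))"
      using A by (intro prod.cong) (auto simp: emeasure_distr)
    finally show "emeasure (distr (PiM I M) (PiM I N) (\<lambda>x. \<lambda>i\<in>I. f i (x i))) (Pi\<^sub>E I A)
        = (\<Prod>i\<in>I. emeasure (distr (M i) (N i) (f i)) (A i))" .
  qed
qed

lemma PiM_density:
  assumes I: "finite I" and f: "\<And>i. f i \<in> borel_measurable (M i)"
    and M: "\<And>i. sigma_finite_measure (M i)"
    and D: "\<And>i. sigma_finite_measure (density (M i) (f i))"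
  shows "PiM I (\<lambda>i. density (M i) (f i)) = density (PiM I M) (\<lambda>x. \<Prod>i\<in>I. f i (x i))"
proof -
  note f[measurable]
  interpret M: product_sigma_finite M using M by (simp add: product_sigma_finite_def)
  interpret D: product_sigma_finite "\<lambda>i. density (M i) (f i)"
    using D by (simp add: product_sigma_finite_def)
  show ?thesis
  proof (rule D.PiM_eqI[OF I, symmetric])
    show "sets (density (PiM I M) (\<lambda>x. \<Prod>i\<in>I. f i (x i))) = sets (PiM I (\<lambda>i. density (M i) (f i)))"
      by (simp cong: sets_PiM_cong)
    fix A assume "\<And>i. i \<in> I \<Longrightarrow> A i \<in> sets (density (M i) (f i))"
    then have A: "\<And>i. i \<in> I \<Longrightarrow> A i \<in> sets (M i)" by simp
    then have AP: "Pi\<^sub>E I A \<in> sets (PiM I M)" using I by (intro sets_PiM_I_finite) auto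
    have "emeasure (density (PiM I M) (\<lambda>x. \<Prod>i\<in>I. f i (x i))) (Pi\<^sub>E I A)
        = (\<integral>\<^sup>+x. (\<Prod>i\<in>I. f i (x i)) * indicator (Pi\<^sub>E I A) x \<partial>PiM I M)"
      using AP by (subst emeasure_density) auto
    also have "\<dots> = (\<integral>\<^sup>+x. (\<Prod>i\<in>I. f i (x i) * indicator (A i) (x i)) \<partial>PiM I M)"
    proof (rule nn_integral_cong)
      fix x assume x: "x \<in> space (PiM I M)"
      \<comment> \<open>A point of the product space is already \<open>undefined\<close> outside I,
        so membership in the box only concerns the coordinates in I.\<close>
      have "indicator (Pi\<^sub>E I A) x = (\<Prod>i\<in>I. indicator (A i) (x i) :: ennreal)"
        using I x by (auto simp: indicator_def space_PiM PiE_iff prod_eq_1_iff intro!: prod_zero)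
      then show "(\<Prod>i\<in>I. f i (x i)) * indicator (Pi\<^sub>E I A) x = (\<Prod>i\<in>I. f i (x i) * indicator (A i) (x i))"
        by (simp add: prod.distrib)
    qed
    also have "\<dots> = (\<Prod>i\<in>I. \<integral>\<^sup>+x. f i x * indicator (A i) x \<partial>M i)"
      using A I by (intro M.product_nn_integral_prod) auto
    also have "\<dots> = (\<Prod>i\<in>I. emeasure (density (M i) (f i)) (A i))"
      using A by (intro prod.cong) (auto simp: emeasure_density)
    finally show "emeasure (density (PiM I M) (\<lambda>x. \<Prod>i\<in>I. f i (x i))) (Pi\<^sub>E I A)
        = (\<Prod>i\<in>I. emeasure (density (M i) (f i)) (A i))" .
  qed
qed

lemma lborel_isometry:
  fixes c t :: real
  assumes "\<bar>c\<bar> = 1"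
  shows "distr lborel lborel (\<lambda>x. t + c * x) = lborel"
proof -
  have "distr lborel lborel (\<lambda>x. t + c * x) = distr lborel borel (\<lambda>x. t + c * x)"
    by (rule distr_cong) auto
  then show ?thesis
    using lborel_real_affine[of c t] assms by (auto simp: density_1)
qed

text \<open>The two instances in use are \<open>c = 1\<close>, a translation, and
  \<open>c = -1\<close>, a point reflection; they are the substitutions of the invariance argument
  for orthogonal matrices.\<close>

lemma nn_integral_PiM_lborel_isometry:
  fixes c :: real and t :: "nat \<Rightarrow> real"
  assumes c: "\<bar>c\<bar> = 1" and g[measurable]: "g \<in> borel_measurable (PiM {..<d} (\<lambda>_. lborel))"
  shows "(\<integral>\<^sup>+x. g (\<lambda>i\<in>{..<d}. t i + c * x i) \<partial>PiM {..<d} (\<lambda>_. lborel)) = (\<integral>\<^sup>+x. g x \<partial>PiM {..<d} (\<lambda>_. lborel))"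
proof -
  let ?L = "PiM {..<d} (\<lambda>_. lborel :: real measure)"
  have m[measurable]: "(\<lambda>x. \<lambda>i\<in>{..<d}. t i + c * x i) \<in> measurable ?L ?L"
    by (rule measurable_restrict) measurable
  have "distr ?L ?L (\<lambda>x. \<lambda>i\<in>{..<d}. t i + c * x i) = PiM {..<d} (\<lambda>i. distr lborel lborel (\<lambda>x. t i + c * x))"
    by (rule distr_PiM_componentwise) (auto simp: lborel_isometry[OF c] lborel.sigma_finite_measure_axioms)
  also have "\<dots> = ?L" by (simp add: lborel_isometry[OF c])
  finally have "distr ?L ?L (\<lambda>x. \<lambda>i\<in>{..<d}. t i + c * x i) = ?L" .
  then have "(\<integral>\<^sup>+x. g x \<partial>?L) = (\<integral>\<^sup>+x. g x \<partial>distr ?L ?L (\<lambda>x. \<lambda>i\<in>{..<d}. t i + c * x i))" by simp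
  also have "\<dots> = (\<integral>\<^sup>+x. g (\<lambda>i\<in>{..<d}. t i + c * x i) \<partial>?L)" by (subst nn_integral_distr) auto
  finally show ?thesis ..
qed

section \<open>Standard Gaussian vectors and their invariance\<close>

abbreviation gaussian :: "nat \<Rightarrow> (nat \<Rightarrow> real) measure" where
  "gaussian d \<equiv> PiM {..<d} (\<lambda>_. std_normal_distribution)"

abbreviation gaussian_sample :: "nat \<Rightarrow> nat \<Rightarrow> (nat \<Rightarrow> nat \<Rightarrow> real) measure" where
  "gaussian_sample k d \<equiv> PiM {..<k} (\<lambda>_. gaussian d)"

lemma prob_space_std_normal: "prob_space std_normal_distribution"
  by (rule prob_space_normal_density) simp

lemma prob_space_gaussian: "prob_space (gaussian d)"
  by (intro prob_space_PiM prob_space_std_normal)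

lemma prob_space_gaussian_sample: "prob_space (gaussian_sample k d)"
  by (intro prob_space_PiM prob_space_gaussian)

definition gaussian_pdf :: "nat \<Rightarrow> (nat \<Rightarrow> real) \<Rightarrow> ennreal" where
  "gaussian_pdf d x = (\<Prod>i<d. ennreal (std_normal_density (x i)))"

lemma gaussian_pdf_measurable [measurable]:
  "gaussian_pdf d \<in> borel_measurable (PiM {..<d} (\<lambda>_. lborel))"
  unfolding gaussian_pdf_def by measurable

lemma gaussian_density: "gaussian d = density (PiM {..<d} (\<lambda>_. lborel)) (gaussian_pdf d)"
  unfolding gaussian_pdf_def[abs_def]
  by (rule PiM_density)
    (auto simp: lborel.sigma_finite_measure_axioms intro!: prob_space_imp_sigma_finite prob_space_std_normal)

text \<open>The matrix-vector product for vectors kept as points of a product measure space; the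
  restriction to \<open>{..<d}\<close> returns the result to that space.\<close>

definition mat_act :: "nat \<Rightarrow> real mat \<Rightarrow> (nat \<Rightarrow> real) \<Rightarrow> nat \<Rightarrow> real" where
  "mat_act d Q x = (\<lambda>i\<in>{..<d}. \<Sum>j<d. Q $$ (i,j) * x j)"

lemma mat_act_measurable [measurable]:
  "mat_act d Q \<in> measurable (PiM {..<d} (\<lambda>_. lborel)) (PiM {..<d} (\<lambda>_. lborel))"
  unfolding mat_act_def by (rule measurable_restrict) measurable

lemma mat_act_measurable_gaussian [measurable]: "mat_act d Q \<in> measurable (gaussian d) (gaussian d)"
  unfolding mat_act_def by (rule measurable_restrict) measurable

lemma vec_mat_act: "Q \<in> carrier_mat d d \<Longrightarrow> vec d (mat_act d Q x) = Q *\<^sub>v vec d x"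
  by (auto simp: mat_act_def scalar_prod_def atLeast0LessThan intro!: eq_vecI)

lemma sum_squares_mat_act:
  assumes Q: "orthonormal_mat d Q"
  shows "(\<Sum>i<d. (mat_act d Q x i)\<^sup>2) = (\<Sum>i<d. (x i)\<^sup>2)"
proof -
  note Q' = orthonormal_matD[OF Q]
  have sq: "(\<Sum>i<d. (y i)\<^sup>2) = vec d y \<bullet> vec d y" for y :: "nat \<Rightarrow> real"
    by (simp add: scalar_prod_def atLeast0LessThan power2_eq_square)
  define v where "v = vec d x"
  have v: "v \<in> carrier_vec d" by (simp add: v_def)
  have Qv: "Q *\<^sub>v v \<in> carrier_vec d" using Q' v by simp
  have "(Q *\<^sub>v v) \<bullet> (Q *\<^sub>v v) = (transpose_mat Q *\<^sub>v (Q *\<^sub>v v)) \<bullet> v"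
    using transpose_vec_mult_scalar[OF Q'(1) v Qv] by simp
  also have "transpose_mat Q *\<^sub>v (Q *\<^sub>v v) = v"
    using Q' v by (simp add: assoc_mult_mat_vec[of _ d d _ d, symmetric])
  finally show ?thesis by (simp add: sq vec_mat_act[OF Q'(1)] v_def)
qed

lemma gaussian_pdf_orthonormal:
  assumes Q: "orthonormal_mat d Q"
  shows "gaussian_pdf d (mat_act d Q x) = gaussian_pdf d x"
proof -
  have "gaussian_pdf d y = ennreal ((1 / sqrt (2 * pi)) ^ d * exp (- (\<Sum>i<d. (y i)\<^sup>2) / 2))" for y
    by (simp add: gaussian_pdf_def prod_ennreal std_normal_density_def prod.distrib exp_sum[symmetric]
        sum_negf sum_divide_distrib power_divide prod_dividef)
  then show ?thesis by (simp add: sum_squares_mat_act[OF Q])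
qed

text \<open>The reflection that sends x to Q^t y - x is carried by Q to the one that sends Qx to y -
  Qx. As a substitution it exchanges the two arguments in the double integral of the next
  lemma.\<close>

lemma mat_act_reflect:
  assumes Q: "orthonormal_mat d Q"
  shows "mat_act d Q (\<lambda>i\<in>{..<d}. mat_act d (transpose_mat Q) y i + (-1) * x i) = (\<lambda>i\<in>{..<d}. y i + (-1) * mat_act d Q x i)"
proof
  fix i
  show "mat_act d Q (\<lambda>i\<in>{..<d}. mat_act d (transpose_mat Q) y i + (-1) * x i) i
      = (\<lambda>i\<in>{..<d}. y i + (-1) * mat_act d Q x i) i"
  proof (cases "i < d")
    case i: True
    note Q' = orthonormal_matD[OF Q]
    have "(\<Sum>j<d. Q $$ (i,j) * mat_act d (transpose_mat Q) y j) = vec d (mat_act d Q (mat_act d (transpose_mat Q) y)) $ i"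
      using i by (simp add: mat_act_def)
    also have "\<dots> = (Q *\<^sub>v (transpose_mat Q *\<^sub>v vec d y)) $ i" by (simp add: vec_mat_act Q')
    also have "\<dots> = y i" using i Q' by (simp add: assoc_mult_mat_vec[of _ d d _ d, symmetric])
    finally have "(\<Sum>j<d. Q $$ (i,j) * mat_act d (transpose_mat Q) y j) = y i" .
    moreover have "mat_act d Q (\<lambda>i\<in>{..<d}. mat_act d (transpose_mat Q) y i + (-1) * x i) i
        = (\<Sum>j<d. Q $$ (i,j) * mat_act d (transpose_mat Q) y j) - (\<Sum>j<d. Q $$ (i,j) * x j)"
      using i by (subst mat_act_def) (simp add: algebra_simps sum_subtractf)
    ultimately show ?thesis using i by (simp add: mat_act_def[of d Q x])
  qed (simp add: mat_act_def)
qed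

text \<open>The argument is the one for uniqueness of Haar measure: the Gaussian density \<open>f\<close> is invariant
  under \<open>Q\<close> and has mass one, and \<open>\<integral>\<integral> e(Qx) f(y - Qx) dy dx\<close> is evaluated in the two orders.\<close>

lemma nn_integral_PiM_lborel_orthonormal:
  assumes Q: "orthonormal_mat d Q" and e[measurable]: "e \<in> borel_measurable (PiM {..<d} (\<lambda>_. lborel))"
  shows "(\<integral>\<^sup>+x. e (mat_act d Q x) \<partial>PiM {..<d} (\<lambda>_. lborel)) = (\<integral>\<^sup>+x. e x \<partial>PiM {..<d} (\<lambda>_. lborel))"
proof -
  let ?L = "PiM {..<d} (\<lambda>_. lborel :: real measure)"
  interpret product_sigma_finite "\<lambda>_. lborel :: real measure" ..
  interpret L: sigma_finite_measure ?L by (rule sigma_finite) simp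
  interpret LL: pair_sigma_finite ?L ?L ..
  let ?f = "gaussian_pdf d"
  have f1: "(\<integral>\<^sup>+x. ?f x \<partial>?L) = 1"
  proof -
    have "(\<integral>\<^sup>+x. ?f x \<partial>?L) = emeasure (density ?L ?f) (space ?L)"
      by (subst emeasure_density) (auto intro!: nn_integral_cong)
    also have "\<dots> = emeasure (gaussian d) (space (gaussian d))" by (simp add: gaussian_density)
    finally show ?thesis using prob_space.emeasure_space_1[OF prob_space_gaussian] by simp
  qed
  note fQ = gaussian_pdf_orthonormal[OF Q]
  define sub where "sub y x = (\<lambda>i\<in>{..<d}. y i + (-1) * x i)" for y x :: "nat \<Rightarrow> real"
  have sub[measurable]: "(\<lambda>p. sub (fst p) (snd p)) \<in> measurable (?L \<Otimes>\<^sub>M ?L) ?L"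
    unfolding sub_def by (rule measurable_restrict) measurable
  have sub_l: "(\<lambda>i\<in>{..<d}. - z i + 1 * y i) = sub y z" for y z by (auto simp: sub_def)
  have trans: "(\<integral>\<^sup>+y. g (sub y z) \<partial>?L) = (\<integral>\<^sup>+y. g y \<partial>?L)"
    if "g \<in> borel_measurable ?L" for g z
    using nn_integral_PiM_lborel_isometry[of 1 g d "\<lambda>i. - z i"] that by (simp only: sub_l abs_one)
  have m1[measurable]: "(\<lambda>p. sub (snd p) (mat_act d Q (fst p))) \<in> measurable (?L \<Otimes>\<^sub>M ?L) ?L"
  proof -
    have "(\<lambda>p. (snd p, mat_act d Q (fst p))) \<in> measurable (?L \<Otimes>\<^sub>M ?L) (?L \<Otimes>\<^sub>M ?L)" by measurable
    from measurable_compose[OF this sub] show ?thesis by simp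
  qed
  have "(\<integral>\<^sup>+x. e (mat_act d Q x) \<partial>?L) = (\<integral>\<^sup>+x. \<integral>\<^sup>+y. e (mat_act d Q x) * ?f (sub y (mat_act d Q x)) \<partial>?L \<partial>?L)"
  proof (rule nn_integral_cong)
    fix x assume x: "x \<in> space ?L"
    have [measurable]: "(\<lambda>y. sub y (mat_act d Q x)) \<in> measurable ?L ?L"
      unfolding sub_def by (rule measurable_restrict) measurable
    show "e (mat_act d Q x) = (\<integral>\<^sup>+y. e (mat_act d Q x) * ?f (sub y (mat_act d Q x)) \<partial>?L)"
      by (subst nn_integral_cmult) (auto simp: trans f1)
  qed
  also have "\<dots> = (\<integral>\<^sup>+y. \<integral>\<^sup>+x. e (mat_act d Q x) * ?f (sub y (mat_act d Q x)) \<partial>?L \<partial>?L)"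
    by (rule LL.Fubini'[symmetric]) (simp add: split_beta')
  \<comment> \<open>The reflection through Q^t y exchanges Qx and y - Qx. Afterwards the density
    stands at Qx, where its invariance removes Q, and a translation in y detaches \<open>e\<close>
    from x.\<close>
  also have "\<dots> = (\<integral>\<^sup>+y. \<integral>\<^sup>+x. e (sub y (mat_act d Q x)) * ?f (mat_act d Q x) \<partial>?L \<partial>?L)"
  proof (rule nn_integral_cong)
    fix y assume y: "y \<in> space ?L"
    define g where "g x = e (mat_act d Q x) * ?f (sub y (mat_act d Q x))" for x
    have [measurable]: "sub y \<in> measurable ?L ?L"
      unfolding sub_def by (rule measurable_restrict) measurable
    have g: "g \<in> borel_measurable ?L" unfolding g_def by measurable
    have subsub: "sub y (sub y (mat_act d Q x)) = mat_act d Q x" for x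
      by (auto simp: sub_def mat_act_def)
    have refl: "mat_act d Q (sub (mat_act d (transpose_mat Q) y) x) = sub y (mat_act d Q x)" for x
      using mat_act_reflect[OF Q] by (simp only: sub_def)
    have "(\<integral>\<^sup>+x. g x \<partial>?L) = (\<integral>\<^sup>+x. g (\<lambda>i\<in>{..<d}. mat_act d (transpose_mat Q) y i + (-1) * x i) \<partial>?L)"
      using g by (subst nn_integral_PiM_lborel_isometry) auto
    also have "\<dots> = (\<integral>\<^sup>+x. e (sub y (mat_act d Q x)) * ?f (mat_act d Q x) \<partial>?L)"
      unfolding g_def sub_def[symmetric] refl subsub ..
    finally show "(\<integral>\<^sup>+x. e (mat_act d Q x) * ?f (sub y (mat_act d Q x)) \<partial>?L)
        = (\<integral>\<^sup>+x. e (sub y (mat_act d Q x)) * ?f (mat_act d Q x) \<partial>?L)" by (simp add: g_def)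
  qed
  also have "\<dots> = (\<integral>\<^sup>+y. \<integral>\<^sup>+x. e (sub y (mat_act d Q x)) * ?f x \<partial>?L \<partial>?L)" by (simp add: gaussian_pdf_orthonormal[OF Q])
  also have "\<dots> = (\<integral>\<^sup>+x. \<integral>\<^sup>+y. e (sub y (mat_act d Q x)) * ?f x \<partial>?L \<partial>?L)"
    by (rule LL.Fubini') (simp add: split_beta')
  also have "\<dots> = (\<integral>\<^sup>+x. (\<integral>\<^sup>+y. e y \<partial>?L) * ?f x \<partial>?L)"
  proof (rule nn_integral_cong)
    fix x assume x: "x \<in> space ?L"
    have [measurable]: "(\<lambda>y. sub y (mat_act d Q x)) \<in> measurable ?L ?L"
      unfolding sub_def by (rule measurable_restrict) measurable
    show "(\<integral>\<^sup>+y. e (sub y (mat_act d Q x)) * ?f x \<partial>?L) = (\<integral>\<^sup>+y. e y \<partial>?L) * ?f x"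
      by (subst nn_integral_multc) (auto simp: trans)
  qed
  also have "\<dots> = (\<integral>\<^sup>+y. e y \<partial>?L)" by (subst nn_integral_cmult) (auto simp: f1)
  finally show ?thesis .
qed

lemma gaussian_orthonormal_invariant:
  assumes Q: "orthonormal_mat d Q"
  shows "distr (gaussian d) (gaussian d) (mat_act d Q) = gaussian d"
proof (rule measure_eqI)
  let ?L = "PiM {..<d} (\<lambda>_. lborel :: real measure)"
  let ?f = "gaussian_pdf d"
  fix E assume "E \<in> sets (distr (gaussian d) (gaussian d) (mat_act d Q))"
  then have E[measurable]: "E \<in> sets ?L" by (simp cong: sets_PiM_cong)
  have "emeasure (distr (gaussian d) (gaussian d) (mat_act d Q)) E
      = (\<integral>\<^sup>+x. ?f x * indicator E (mat_act d Q x) \<partial>?L)"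
    unfolding gaussian_density by (subst emeasure_distr)
     (auto simp: emeasure_density intro!: nn_integral_cong split: split_indicator)
  also have "\<dots> = (\<integral>\<^sup>+x. (\<lambda>y. ?f y * indicator E y) (mat_act d Q x) \<partial>?L)" by (simp add: gaussian_pdf_orthonormal[OF Q])
  also have "\<dots> = (\<integral>\<^sup>+x. ?f x * indicator E x \<partial>?L)"
    by (rule nn_integral_PiM_lborel_orthonormal[OF Q]) measurable
  also have "\<dots> = emeasure (gaussian d) E" unfolding gaussian_density by (subst emeasure_density) auto
  finally show "emeasure (distr (gaussian d) (gaussian d) (mat_act d Q)) E = emeasure (gaussian d) E" .
qed simp

lemma gaussian_sample_orthonormal_invariant:
  assumes Q: "orthonormal_mat d Q"
  shows "distr (gaussian_sample k d) (gaussian_sample k d) (\<lambda>\<omega>. \<lambda>i\<in>{..<k}. mat_act d Q (\<omega> i)) = gaussian_sample k d"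
  by (subst distr_PiM_componentwise)
    (auto simp: gaussian_orthonormal_invariant[OF Q] intro!: prob_space_imp_sigma_finite prob_space_gaussian)

section \<open>Scaled Gaussian samples\<close>

text \<open>For negative y, the derivative of ln (1 + x) - x + x^2 is x (2x + 1) / (1 + x), which is
  nonpositive on [-1/2, 0]. This is the origin of the threshold -1/2 that \<kappa> has to respect
  later.\<close>

lemma ln_one_plus_lower_bound:
  fixes y :: real
  assumes "- 1 / 2 \<le> y"
  shows "y - y\<^sup>2 \<le> ln (1 + y)"
proof (cases "y \<ge> 0")
  case True
  show ?thesis
  proof (cases "y \<le> 1")
    case False
    then have "y - y\<^sup>2 \<le> 0" by (simp add: power2_eq_square)
    also have "0 \<le> ln (1 + y)" using True by simp
    finally show ?thesis .
  qed (use True ln_one_plus_pos_lower_bound in auto)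
next
  case False
  let ?f = "\<lambda>x. ln (1 + x) - x + x\<^sup>2 :: real"
  have "?f 0 \<le> ?f y"
  proof (rule DERIV_nonpos_imp_nonincreasing[of y 0 ?f])
    fix x assume x: "y \<le> x" "x \<le> 0"
    then have x1: "0 < 1 + x" using assms by simp
    have "(?f has_real_derivative 1 / (1 + x) - 1 + 2 * x) (at x)"
      using x1 by (auto intro!: derivative_eq_intros)
    moreover have "1 / (1 + x) - 1 + 2 * x = x * (2 * x + 1) / (1 + x)"
      using x1 by (simp add: field_simps)
    moreover have "x * (2 * x + 1) / (1 + x) \<le> 0"
      using x x1 assms by (intro divide_nonpos_pos mult_nonpos_nonneg) auto
    ultimately show "\<exists>z. (?f has_real_derivative z) (at x) \<and> z \<le> 0" by metis
  qed (use False in auto)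
  then show ?thesis by simp
qed

lemma inverse_sqrt_le_exp:
  fixes x :: real
  assumes "x \<le> 1 / 2"
  shows "1 / sqrt (1 - x) \<le> exp ((x + x\<^sup>2) / 2)"
proof -
  have "1 / sqrt (1 - x) = exp (- ln (1 - x) / 2)"
    using assms by (simp add: exp_minus ln_sqrt[symmetric] inverse_eq_divide)
  also have "\<dots> \<le> exp ((x + x\<^sup>2) / 2)"
    using ln_one_plus_lower_bound[of "- x"] assms by simp
  finally show ?thesis .
qed

text \<open>Tilting the standard normal density by exp (c x^2) produces a multiple of the normal
  density with variance 1 / (1 - 2c), which exists precisely for c < 1/2.\<close>

lemma nn_integral_exp_square_std_normal:
  assumes c: "c < 1 / 2"
  shows "(\<integral>\<^sup>+x. ennreal (exp (c * x\<^sup>2)) \<partial>std_normal_distribution) = ennreal (1 / sqrt (1 - 2 * c))"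
proof -
  define \<sigma> where "\<sigma> = 1 / sqrt (1 - 2 * c)"
  have \<sigma>: "0 < \<sigma>" using c by (simp add: \<sigma>_def)
  have \<sigma>2: "\<sigma>\<^sup>2 = 1 / (1 - 2 * c)" using c by (simp add: \<sigma>_def power_divide)
  have eq: "std_normal_density x * exp (c * x\<^sup>2) = \<sigma> * normal_density 0 \<sigma> x" for x
  proof -
    have "std_normal_density x * exp (c * x\<^sup>2) = 1 / sqrt (2 * pi) * exp (- x\<^sup>2 / 2 + c * x\<^sup>2)"
      by (simp only: std_normal_density_def exp_add mult.assoc)
    also have "- x\<^sup>2 / 2 + c * x\<^sup>2 = - (x - 0)\<^sup>2 / (2 * \<sigma>\<^sup>2)"
      using c by (simp add: \<sigma>2 field_simps)
    also have "1 / sqrt (2 * pi) = \<sigma> * (1 / sqrt (2 * pi * \<sigma>\<^sup>2))"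
      using \<sigma> by (simp add: real_sqrt_mult)
    finally show ?thesis by (simp add: normal_density_def)
  qed
  have "(\<integral>\<^sup>+x. ennreal (exp (c * x\<^sup>2)) \<partial>std_normal_distribution)
      = (\<integral>\<^sup>+x. ennreal (std_normal_density x) * ennreal (exp (c * x\<^sup>2)) \<partial>lborel)"
    by (subst nn_integral_density) auto
  also have "\<dots> = (\<integral>\<^sup>+x. ennreal \<sigma> * ennreal (normal_density 0 \<sigma> x) \<partial>lborel)"
    using \<sigma> by (simp add: ennreal_mult[symmetric] eq)
  also have "\<dots> = ennreal \<sigma> * (\<integral>\<^sup>+x. ennreal (normal_density 0 \<sigma> x) \<partial>lborel)"
    by (rule nn_integral_cmult) measurable
  also have "(\<integral>\<^sup>+x. ennreal (normal_density 0 \<sigma> x) \<partial>lborel) = emeasure (density lborel (normal_density 0 \<sigma>)) (space lborel)"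
    by (subst emeasure_density) auto
  also have "\<dots> = 1"
    using prob_space.emeasure_space_1[OF prob_space_normal_density[OF \<sigma>, of 0]] by simp
  finally show ?thesis by (simp add: \<sigma>_def)
qed

text \<open>Centering contributes exp (- c), which cancels the linear part of the bound on 1 / sqrt
  (1 - 2c); what stays is (2c)^2 / 2. The limit 1/4 keeps 2c within the range of that bound.\<close>

lemma nn_integral_exp_centered_square_le:
  assumes c: "\<bar>c\<bar> \<le> 1 / 4"
  shows "(\<integral>\<^sup>+x. ennreal (exp (c * (x\<^sup>2 - 1))) \<partial>std_normal_distribution) \<le> ennreal (exp (2 * c\<^sup>2))"
proof -
  have "(\<integral>\<^sup>+x. ennreal (exp (c * (x\<^sup>2 - 1))) \<partial>std_normal_distribution)
      = (\<integral>\<^sup>+x. ennreal (exp (- c)) * ennreal (exp (c * x\<^sup>2)) \<partial>std_normal_distribution)"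
    by (intro nn_integral_cong) (simp add: ennreal_mult[symmetric] exp_add[symmetric] algebra_simps)
  also have "\<dots> = ennreal (exp (- c)) * ennreal (1 / sqrt (1 - 2 * c))"
    using c by (subst nn_integral_cmult) (auto simp: nn_integral_exp_square_std_normal)
  also have "\<dots> = ennreal (exp (- c) * (1 / sqrt (1 - 2 * c)))"
    using c by (subst ennreal_mult) auto
  also have "exp (- c) * (1 / sqrt (1 - 2 * c)) \<le> exp (- c) * exp ((2 * c + (2 * c)\<^sup>2) / 2)"
    using c by (intro mult_left_mono inverse_sqrt_le_exp) auto
  also have "\<dots> = exp (2 * c\<^sup>2)" by (simp add: exp_add[symmetric] power2_eq_square field_simps)
  finally show ?thesis by (simp add: ennreal_leI)
qed

text \<open>The exponent is s times the log density ratio of one coordinate. The bound ln (1 +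
  \<kappa>) \<ge> \<kappa> - \<kappa>^2 contributes - s\<kappa>/2 and the Gaussian integral
  contributes + s\<kappa>/2. These cancel, and only terms of second order in \<kappa>
  survive.\<close>

lemma nn_integral_exp_log_ratio_le:
  assumes s: "0 < s" and \<kappa>: "- 1 / 2 \<le> \<kappa>" "s * \<kappa> \<le> 1 / 2"
  shows "(\<integral>\<^sup>+x. ennreal (exp (s * (\<kappa> * x\<^sup>2 / 2 - ln (1 + \<kappa>) / 2))) \<partial>std_normal_distribution)
    \<le> ennreal (exp ((s\<^sup>2 + s) / 2 * \<kappa>\<^sup>2))"
proof -
  have "(\<integral>\<^sup>+x. ennreal (exp (s * (\<kappa> * x\<^sup>2 / 2 - ln (1 + \<kappa>) / 2))) \<partial>std_normal_distribution)
      = (\<integral>\<^sup>+x. ennreal (exp (- s * ln (1 + \<kappa>) / 2)) * ennreal (exp (s * \<kappa> / 2 * x\<^sup>2)) \<partial>std_normal_distribution)"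
    by (intro nn_integral_cong) (simp add: ennreal_mult[symmetric] exp_add[symmetric] algebra_simps)
  also have "\<dots> = ennreal (exp (- s * ln (1 + \<kappa>) / 2)) * ennreal (1 / sqrt (1 - 2 * (s * \<kappa> / 2)))"
    using nn_integral_exp_square_std_normal[of "s * \<kappa> / 2"] \<kappa> by (subst nn_integral_cmult) auto
  also have "\<dots> = ennreal (exp (- s * ln (1 + \<kappa>) / 2) * (1 / sqrt (1 - s * \<kappa>)))"
    using \<kappa> by (subst ennreal_mult) auto
  also have "exp (- s * ln (1 + \<kappa>) / 2) * (1 / sqrt (1 - s * \<kappa>))
      \<le> exp (- s * (\<kappa> - \<kappa>\<^sup>2) / 2) * exp ((s * \<kappa> + (s * \<kappa>)\<^sup>2) / 2)"
    using s \<kappa> ln_one_plus_lower_bound[OF \<kappa>(1)] by (intro mult_mono inverse_sqrt_le_exp) auto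
  also have "\<dots> = exp ((s\<^sup>2 + s) / 2 * \<kappa>\<^sup>2)"
    by (simp add: exp_add[symmetric] power2_eq_square field_simps)
  finally show ?thesis by (simp add: ennreal_leI)
qed

lemma nn_integral_exp_sum_gaussian_sample:
  fixes \<phi> :: "nat \<Rightarrow> real \<Rightarrow> real"
  assumes [measurable]: "\<And>j. \<phi> j \<in> borel_measurable borel"
  shows "(\<integral>\<^sup>+\<omega>. ennreal (exp (\<Sum>i<k. \<Sum>j<d. \<phi> j (\<omega> i j))) \<partial>gaussian_sample k d)
    = (\<Prod>j<d. \<integral>\<^sup>+x. ennreal (exp (\<phi> j x)) \<partial>std_normal_distribution) ^ k"
proof -
  interpret N: product_sigma_finite "\<lambda>_::nat. std_normal_distribution"
    by (intro product_sigma_finite.intro prob_space_imp_sigma_finite prob_space_std_normal)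
  interpret G: product_sigma_finite "\<lambda>_::nat. gaussian d"
    by (intro product_sigma_finite.intro prob_space_imp_sigma_finite prob_space_gaussian)
  have "(\<integral>\<^sup>+\<omega>. ennreal (exp (\<Sum>i<k. \<Sum>j<d. \<phi> j (\<omega> i j))) \<partial>gaussian_sample k d)
      = (\<integral>\<^sup>+\<omega>. (\<Prod>i<k. \<Prod>j<d. ennreal (exp (\<phi> j (\<omega> i j)))) \<partial>gaussian_sample k d)"
    by (simp add: exp_sum prod_ennreal prod_nonneg)
  also have "\<dots> = (\<Prod>i<k. \<integral>\<^sup>+x. (\<Prod>j<d. ennreal (exp (\<phi> j (x j)))) \<partial>gaussian d)"
    by (rule G.product_nn_integral_prod) auto
  also have "(\<integral>\<^sup>+x. (\<Prod>j<d. ennreal (exp (\<phi> j (x j)))) \<partial>gaussian d)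
      = (\<Prod>j<d. \<integral>\<^sup>+x. ennreal (exp (\<phi> j x)) \<partial>std_normal_distribution)"
    by (rule N.product_nn_integral_prod) auto
  finally show ?thesis by simp
qed

lemma nn_integral_exp_sum_gaussian_sample_le:
  fixes \<phi> :: "nat \<Rightarrow> real \<Rightarrow> real"
  assumes \<phi>: "\<And>j. \<phi> j \<in> borel_measurable borel"
    and le: "\<And>j. j < d \<Longrightarrow> (\<integral>\<^sup>+x. ennreal (exp (\<phi> j x)) \<partial>std_normal_distribution) \<le> ennreal (exp (b j))"
  shows "(\<integral>\<^sup>+\<omega>. ennreal (exp (\<Sum>i<k. \<Sum>j<d. \<phi> j (\<omega> i j))) \<partial>gaussian_sample k d)
    \<le> ennreal (exp (real k * (\<Sum>j<d. b j)))"
proof -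
  have "(\<Prod>j<d. \<integral>\<^sup>+x. ennreal (exp (\<phi> j x)) \<partial>std_normal_distribution) \<le> (\<Prod>j<d. ennreal (exp (b j)))"
    using le by (induction d) (auto intro!: mult_mono)
  also have "\<dots> = ennreal (exp (\<Sum>j<d. b j))" by (simp add: exp_sum prod_ennreal)
  finally have "(\<Prod>j<d. \<integral>\<^sup>+x. ennreal (exp (\<phi> j x)) \<partial>std_normal_distribution) ^ k \<le> ennreal (exp (\<Sum>j<d. b j)) ^ k"
    by (intro power_mono) auto
  then show ?thesis
    by (simp add: nn_integral_exp_sum_gaussian_sample[OF \<phi>] ennreal_power exp_of_nat_mult)
qed

text \<open>The density is the ratio of N(0, 1) to N(0, 1 / (1 + \<kappa>)). Its constant - ln (1 +
  \<kappa>) / 2 is the logarithm of the scaling \<sigma>, which is also the Jacobian of the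
  substitution x to \<sigma> x.\<close>

lemma std_normal_density_scaled:
  assumes \<kappa>: "- 1 < \<kappa>"
  shows "density (distr std_normal_distribution std_normal_distribution (\<lambda>x. 1 / sqrt (1 + \<kappa>) * x))
      (\<lambda>x. ennreal (exp (\<kappa> * x\<^sup>2 / 2 - ln (1 + \<kappa>) / 2))) = std_normal_distribution" (is "?D = ?N")
proof (rule measure_eqI)
  define \<sigma> where "\<sigma> = 1 / sqrt (1 + \<kappa>)"
  have \<sigma>: "0 < \<sigma>" and \<sigma>2: "\<sigma>\<^sup>2 = 1 / (1 + \<kappa>)" using \<kappa> by (auto simp: \<sigma>_def power_divide)
  fix E assume "E \<in> sets ?D"
  then have E[measurable]: "E \<in> sets borel" by simp
  have eq: "std_normal_density x * exp (\<kappa> * (\<sigma> * x)\<^sup>2 / 2 - ln (1 + \<kappa>) / 2) = \<sigma> * std_normal_density (\<sigma> * x)" for x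
  proof -
    have "exp (- ln (1 + \<kappa>) / 2) = \<sigma>"
      using \<kappa> by (simp add: \<sigma>_def exp_minus ln_sqrt[symmetric] inverse_eq_divide)
    moreover have "- x\<^sup>2 / 2 + \<kappa> * (\<sigma> * x)\<^sup>2 / 2 = - (\<sigma> * x)\<^sup>2 / 2"
      using \<kappa> by (simp add: power_mult_distrib \<sigma>2 field_simps)
    moreover have "std_normal_density x * exp (\<kappa> * (\<sigma> * x)\<^sup>2 / 2 - ln (1 + \<kappa>) / 2)
        = 1 / sqrt (2 * pi) * exp (- x\<^sup>2 / 2 + \<kappa> * (\<sigma> * x)\<^sup>2 / 2) * exp (- ln (1 + \<kappa>) / 2)"
      unfolding std_normal_density_def mult.assoc exp_add[symmetric] by (simp add: algebra_simps)
    ultimately show ?thesis by (simp add: std_normal_density_def)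
  qed
  have "emeasure ?D E = (\<integral>\<^sup>+x. ennreal (exp (\<kappa> * x\<^sup>2 / 2 - ln (1 + \<kappa>) / 2)) * indicator E x
      \<partial>distr std_normal_distribution std_normal_distribution (\<lambda>x. \<sigma> * x))"
    unfolding \<sigma>_def by (rule emeasure_density) auto
  also have "\<dots> = (\<integral>\<^sup>+x. ennreal (exp (\<kappa> * (\<sigma> * x)\<^sup>2 / 2 - ln (1 + \<kappa>) / 2)) * indicator E (\<sigma> * x)
      \<partial>std_normal_distribution)"
    by (rule nn_integral_distr) auto
  also have "\<dots> = (\<integral>\<^sup>+x. ennreal (std_normal_density x) *
      (ennreal (exp (\<kappa> * (\<sigma> * x)\<^sup>2 / 2 - ln (1 + \<kappa>) / 2)) * indicator E (\<sigma> * x)) \<partial>lborel)"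
    by (rule nn_integral_density) auto
  also have "\<dots> = (\<integral>\<^sup>+x. ennreal \<sigma> * (ennreal (std_normal_density (0 + \<sigma> * x)) * indicator E (0 + \<sigma> * x)) \<partial>lborel)"
  proof (rule nn_integral_cong)
    fix x
    have "ennreal (std_normal_density x) * ennreal (exp (\<kappa> * (\<sigma> * x)\<^sup>2 / 2 - ln (1 + \<kappa>) / 2))
        = ennreal \<sigma> * ennreal (std_normal_density (\<sigma> * x))"
      using \<sigma> by (simp only: ennreal_mult[symmetric] eq less_imp_le normal_density_nonneg exp_ge_zero)
    then show "ennreal (std_normal_density x) *
      (ennreal (exp (\<kappa> * (\<sigma> * x)\<^sup>2 / 2 - ln (1 + \<kappa>) / 2)) * indicator E (\<sigma> * x))
      = ennreal \<sigma> * (ennreal (std_normal_density (0 + \<sigma> * x)) * indicator E (0 + \<sigma> * x))"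
      by (simp add: mult.assoc[symmetric])
  qed
  also have "\<dots> = (\<integral>\<^sup>+x. ennreal (std_normal_density x) * indicator E x \<partial>lborel)"
    using \<sigma> by (subst (2) nn_integral_real_affine[where c=\<sigma> and t=0]) (auto simp: nn_integral_cmult)
  also have "\<dots> = emeasure ?N E" by (rule emeasure_density[symmetric]) auto
  finally show "emeasure ?D E = emeasure ?N E" .
qed simp

section \<open>Density ratio of a sample against its scaling\<close>

lemma sample_entry_measurable:
  assumes "i < k" "j < d"
  shows "(\<lambda>\<omega>. \<omega> i j) \<in> measurable (gaussian_sample k d) borel"
proof -
  have "(\<lambda>\<omega>. \<omega> i j) \<in> measurable (gaussian_sample k d) std_normal_distribution"
    using assms by (intro measurable_compose[OF measurable_component_singleton[of i "{..<k}" "\<lambda>_. gaussian d"]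
          measurable_component_singleton]) auto
  then show ?thesis by simp
qed

lemma sample_sum_measurable:
  assumes "\<And>j. \<phi> j \<in> borel_measurable borel"
  shows "(\<lambda>\<omega>. \<Sum>i<k. \<Sum>j<d. \<phi> j (\<omega> i j) :: real) \<in> borel_measurable (gaussian_sample k d)"
  using assms by (intro borel_measurable_sum measurable_compose[OF sample_entry_measurable]) auto

definition scale_sample :: "nat \<Rightarrow> nat \<Rightarrow> (nat \<Rightarrow> real) \<Rightarrow> (nat \<Rightarrow> nat \<Rightarrow> real) \<Rightarrow> nat \<Rightarrow> nat \<Rightarrow> real" where
  "scale_sample k d \<sigma> \<omega> = (\<lambda>i\<in>{..<k}. \<lambda>j\<in>{..<d}. \<sigma> j * \<omega> i j)"

lemma scale_sample_measurable [measurable]: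
  "scale_sample k d \<sigma> \<in> measurable (gaussian_sample k d) (gaussian_sample k d)"
  unfolding scale_sample_def
  by (intro measurable_restrict) (simp, intro borel_measurable_times sample_entry_measurable, auto)

text \<open>The scaled law serves as base measure because the privacy inequality bounds the unscaled
  probability by an integral of the ratio against the scaled law.\<close>

lemma gaussian_sample_density_scaled:
  assumes \<kappa>: "\<And>j. - 1 < \<kappa> j"
  shows "gaussian_sample k d =
    density (distr (gaussian_sample k d) (gaussian_sample k d) (scale_sample k d (\<lambda>j. 1 / sqrt (1 + \<kappa> j))))
      (\<lambda>\<omega>. ennreal (exp (\<Sum>i<k. \<Sum>j<d. \<kappa> j * (\<omega> i j)\<^sup>2 / 2 - ln (1 + \<kappa> j) / 2)))"
proof -
  let ?N = "std_normal_distribution"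
  let ?s = "\<lambda>j x. 1 / sqrt (1 + \<kappa> j) * x"
  let ?r = "\<lambda>j x. ennreal (exp (\<kappa> j * x\<^sup>2 / 2 - ln (1 + \<kappa> j) / 2))"
  let ?sc = "\<lambda>x. \<lambda>j\<in>{..<d}. ?s j (x j)"
  have Np: "prob_space (distr ?N ?N (?s j))" for j
    by (intro prob_space.prob_space_distr prob_space_std_normal) simp
  have N1: "sigma_finite_measure (density (distr ?N ?N (?s j)) (?r j))" for j
    by (simp only: std_normal_density_scaled[OF \<kappa>] prob_space_imp_sigma_finite[OF prob_space_std_normal])
  have scm[measurable]: "?sc \<in> measurable (gaussian d) (gaussian d)"
    by (rule measurable_restrict) measurable
  have Gp: "prob_space (distr (gaussian d) (gaussian d) ?sc)"
    by (intro prob_space.prob_space_distr prob_space_gaussian scm)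
  have 1: "distr (gaussian d) (gaussian d) ?sc = PiM {..<d} (\<lambda>j. distr ?N ?N (?s j))"
    using Np by (intro distr_PiM_componentwise) (auto intro!: prob_space_imp_sigma_finite prob_space_std_normal)
  have "gaussian d = PiM {..<d} (\<lambda>j. density (distr ?N ?N (?s j)) (?r j))"
    by (simp only: std_normal_density_scaled[OF \<kappa>])
  also have "\<dots> = density (PiM {..<d} (\<lambda>j. distr ?N ?N (?s j))) (\<lambda>x. \<Prod>j<d. ?r j (x j))"
    by (rule PiM_density[OF _ _ prob_space_imp_sigma_finite[OF Np] N1]) auto
  finally have 2: "density (distr (gaussian d) (gaussian d) ?sc) (\<lambda>x. \<Prod>j<d. ?r j (x j)) = gaussian d"
    unfolding 1 by (rule sym)
  have rm: "(\<lambda>x. \<Prod>j<d. ?r j (x j)) \<in> borel_measurable (gaussian d)" by measurable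
  have N2: "sigma_finite_measure (density (distr (gaussian d) (gaussian d) ?sc) (\<lambda>x. \<Prod>j<d. ?r j (x j)))"
    by (simp only: 2 prob_space_imp_sigma_finite[OF prob_space_gaussian])
  have 3: "distr (gaussian_sample k d) (gaussian_sample k d) (scale_sample k d (\<lambda>j. 1 / sqrt (1 + \<kappa> j)))
      = PiM {..<k} (\<lambda>_. distr (gaussian d) (gaussian d) ?sc)"
    unfolding scale_sample_def
    by (rule distr_PiM_componentwise[where f="\<lambda>_. ?sc", OF _ scm prob_space_imp_sigma_finite[OF prob_space_gaussian]
          prob_space_imp_sigma_finite[OF Gp]]) simp
  have "gaussian_sample k d = PiM {..<k} (\<lambda>_. density (distr (gaussian d) (gaussian d) ?sc) (\<lambda>x. \<Prod>j<d. ?r j (x j)))"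
    by (simp only: 2)
  also have "\<dots> = density (PiM {..<k} (\<lambda>_. distr (gaussian d) (gaussian d) ?sc)) (\<lambda>\<omega>. \<Prod>i<k. \<Prod>j<d. ?r j (\<omega> i j))"
    by (rule PiM_density[OF _ _ prob_space_imp_sigma_finite[OF Gp] N2]) (simp_all add: rm)
  also have "(\<lambda>\<omega>. \<Prod>i<k. \<Prod>j<d. ?r j (\<omega> i j))
      = (\<lambda>\<omega>. ennreal (exp (\<Sum>i<k. \<Sum>j<d. \<kappa> j * (\<omega> i j)\<^sup>2 / 2 - ln (1 + \<kappa> j) / 2)))"
    by (simp add: exp_sum prod_ennreal prod_nonneg)
  finally show ?thesis unfolding 3 .
qed

text \<open>Where the log ratio is at most \<epsilon>, the density is at most exp \<epsilon>; the
  rest of the event is charged to the probability, under \<open>P\<close> itself, that the log ratio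
  is larger.\<close>

lemma density_ratio_hockey_stick:
  assumes P: "prob_space P" "prob_space P'" and R[measurable]: "R \<in> borel_measurable P'"
    and eq: "P = density P' (\<lambda>x. ennreal (exp (R x)))" and E[measurable]: "E \<in> sets P'"
  shows "measure P E \<le> exp \<epsilon> * measure P' E + measure P {x \<in> space P. \<epsilon> < R x}"
proof -
  interpret P: prob_space P by fact
  interpret P': prob_space P' by fact
  have sets: "sets P = sets P'" and space: "space P = space P'" by (auto simp: eq)
  let ?B = "{x \<in> space P'. \<epsilon> < R x}"
  have B: "?B \<in> sets P'" by measurable
  have "measure P E \<le> measure P (E - ?B) + measure P ?B"
  proof -
    have "measure P E \<le> measure P ((E - ?B) \<union> ?B)"
      using E B by (intro P.finite_measure_mono) (auto simp: sets)
    also have "\<dots> \<le> measure P (E - ?B) + measure P ?B"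
      using E B by (intro measure_Un_le) (auto simp: sets)
    finally show ?thesis .
  qed
  moreover have "measure P (E - ?B) \<le> exp \<epsilon> * measure P' E"
  proof -
    have "emeasure P (E - ?B) = (\<integral>\<^sup>+x. ennreal (exp (R x)) * indicator (E - ?B) x \<partial>P')"
      unfolding eq using E B by (subst emeasure_density) auto
    also have "\<dots> \<le> (\<integral>\<^sup>+x. ennreal (exp \<epsilon>) * indicator E x \<partial>P')"
      using sets.sets_into_space[OF E]
      by (intro nn_integral_mono) (auto split: split_indicator intro!: ennreal_leI)
    also have "\<dots> = ennreal (exp \<epsilon> * measure P' E)"
      using E by (simp add: nn_integral_cmult P'.emeasure_eq_measure ennreal_mult)
    finally show ?thesis by (simp add: P.emeasure_eq_measure)
  qed
  ultimately show ?thesis by (simp add: space)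
qed

text \<open>The two terms of the minimum act separately. The second bounds each \<kappa>_j by
  \<epsilon> / (8L) with L = ln (1/\<delta>), so the exponential moments are controlled; the first
  bounds k times the sum of the \<kappa>_j^2 by \<epsilon>^2 / (8L), which is the budget of the
  Chernoff exponent.\<close>

lemma gaussian_sample_scaling_private:
  fixes \<kappa> :: "nat \<Rightarrow> real"
  assumes \<epsilon>: "0 < \<epsilon>" and \<delta>: "0 < \<delta>" "\<delta> < 1" and \<epsilon>8: "\<epsilon> / (8 * ln (1 / \<delta>)) < 1" and k: "1 \<le> k"
    and \<Delta>: "\<Delta> = min (\<epsilon> / sqrt (8 * real k * ln (1 / \<delta>))) (\<epsilon> / (8 * ln (1 / \<delta>)))"
    and \<kappa>: "\<And>j. - 1 / 2 \<le> \<kappa> j" and sum: "sqrt (\<Sum>j<d. (\<kappa> j)\<^sup>2) \<le> \<Delta>"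
    and E: "E \<in> sets (gaussian_sample k d)"
  shows "measure (gaussian_sample k d) E \<le> exp \<epsilon> *
    measure (distr (gaussian_sample k d) (gaussian_sample k d) (scale_sample k d (\<lambda>j. 1 / sqrt (1 + \<kappa> j)))) E + \<delta>"
proof -
  define L where "L = ln (1 / \<delta>)"
  have L: "0 < L" using \<delta> by (simp add: L_def)
  have \<delta>L: "\<delta> = exp (- L)" using \<delta> by (simp add: L_def ln_div)
  \<comment> \<open>The largest exponent for which \<kappa>_j \<le> \<epsilon> / (8L) guarantees s
    \<kappa>_j \<le> 1/2.\<close>
  define s where "s = 4 * L / \<epsilon>"
  have s: "0 < s" using L \<epsilon> by (simp add: s_def)
  have \<epsilon>L: "\<epsilon> < 8 * L" using \<epsilon>8 L by (simp add: L_def)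
  define R where "R \<omega> = (\<Sum>i<k. \<Sum>j<d. \<kappa> j * (\<omega> i j)\<^sup>2 / 2 - ln (1 + \<kappa> j) / 2)" for \<omega> :: "nat \<Rightarrow> nat \<Rightarrow> real"
  let ?G = "gaussian_sample k d"
  let ?G' = "distr ?G ?G (scale_sample k d (\<lambda>j. 1 / sqrt (1 + \<kappa> j)))"
  have Rm[measurable]: "R \<in> borel_measurable ?G" unfolding R_def by (intro sample_sum_measurable) measurable
  have sumsq: "(\<Sum>j<d. (\<kappa> j)\<^sup>2) \<ge> 0" by (intro sum_nonneg) auto
  have \<Delta>0: "0 \<le> \<Delta>" using sum sumsq by (meson order_trans real_sqrt_ge_zero)
  have s\<kappa>: "s * \<kappa> j \<le> 1 / 2" if "j < d" for j
  proof -
    have "(\<kappa> j)\<^sup>2 \<le> (\<Sum>j<d. (\<kappa> j)\<^sup>2)" using that by (intro member_le_sum) auto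
    then have "\<kappa> j \<le> sqrt (\<Sum>j<d. (\<kappa> j)\<^sup>2)" by (rule real_le_rsqrt)
    also have "\<dots> \<le> \<epsilon> / (8 * L)" using sum \<Delta> by (simp add: L_def)
    finally have "s * \<kappa> j \<le> s * (\<epsilon> / (8 * L))" using s by (intro mult_left_mono) auto
    also have "\<dots> = 1 / 2" using \<epsilon> L by (simp add: s_def)
    finally show ?thesis .
  qed
  have budget: "real k * (\<Sum>j<d. (\<kappa> j)\<^sup>2) \<le> \<epsilon>\<^sup>2 / (8 * L)"
  proof -
    have "(\<Sum>j<d. (\<kappa> j)\<^sup>2) \<le> (\<epsilon> / sqrt (8 * real k * L))\<^sup>2"
      using power_mono[of "sqrt (\<Sum>j<d. (\<kappa> j)\<^sup>2)" "\<epsilon> / sqrt (8 * real k * L)" 2] sum sumsq \<Delta>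
      by (simp add: L_def)
    also have "\<dots> = \<epsilon>\<^sup>2 / (8 * real k * L)" using L by (simp add: power_divide)
    finally show ?thesis using k L by (simp add: field_simps)
  qed
  have "emeasure ?G {\<omega> \<in> space ?G. \<epsilon> < R \<omega>} \<le> ennreal \<delta>"
  proof -
    have "emeasure ?G {\<omega> \<in> space ?G. \<epsilon> < R \<omega>} = (\<integral>\<^sup>+\<omega>. indicator {\<omega> \<in> space ?G. \<epsilon> < R \<omega>} \<omega> \<partial>?G)"
      by (simp add: nn_integral_indicator)
    also have "\<dots> \<le> (\<integral>\<^sup>+\<omega>. ennreal (exp (- s * \<epsilon>)) * ennreal (exp (s * R \<omega>)) \<partial>?G)"
    proof (rule nn_integral_mono)
      fix \<omega>
      have "1 \<le> exp (s * (R \<omega> - \<epsilon>))" if "\<epsilon> < R \<omega>" using that s by simp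
      then show "indicator {\<omega> \<in> space ?G. \<epsilon> < R \<omega>} \<omega> \<le> ennreal (exp (- s * \<epsilon>)) * ennreal (exp (s * R \<omega>))"
        by (auto simp: ennreal_mult[symmetric] exp_add[symmetric] algebra_simps split: split_indicator)
    qed
    also have "\<dots> = ennreal (exp (- s * \<epsilon>)) * (\<integral>\<^sup>+\<omega>. ennreal (exp (s * R \<omega>)) \<partial>?G)"
      by (rule nn_integral_cmult) measurable
    also have "(\<integral>\<^sup>+\<omega>. ennreal (exp (s * R \<omega>)) \<partial>?G) = (\<integral>\<^sup>+\<omega>. ennreal (exp
        (\<Sum>i<k. \<Sum>j<d. (\<lambda>x. s * (\<kappa> j * x\<^sup>2 / 2 - ln (1 + \<kappa> j) / 2)) (\<omega> i j))) \<partial>?G)"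
      by (simp add: R_def sum_distrib_left)
    also have "\<dots> \<le> ennreal (exp (real k * (\<Sum>j<d. (s\<^sup>2 + s) / 2 * (\<kappa> j)\<^sup>2)))"
      by (rule nn_integral_exp_sum_gaussian_sample_le[OF _ nn_integral_exp_log_ratio_le[OF s \<kappa> s\<kappa>]]) measurable
    also have "ennreal (exp (- s * \<epsilon>)) * \<dots> = ennreal (exp (- s * \<epsilon> + (s\<^sup>2 + s) / 2 * (real k * (\<Sum>j<d. (\<kappa> j)\<^sup>2))))"
      by (simp add: ennreal_mult[symmetric] exp_add[symmetric] sum_distrib_left ac_simps)
    \<comment> \<open>With s \<epsilon> = 4L the exponent is at most -4L + L + \<epsilon>/4: the
      summand L comes from s^2 and \<epsilon>/4 from s. It stays below -L because \<epsilon> <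
      8L.\<close>
    also have "\<dots> \<le> ennreal (exp (- L))"
    proof -
      have "(s\<^sup>2 + s) / 2 * (real k * (\<Sum>j<d. (\<kappa> j)\<^sup>2)) \<le> (s\<^sup>2 + s) / 2 * (\<epsilon>\<^sup>2 / (8 * L))"
        using s budget by (intro mult_left_mono) auto
      also have "\<dots> = L + \<epsilon> / 4" using \<epsilon> L by (simp add: s_def power2_eq_square field_simps)
      finally have "- s * \<epsilon> + (s\<^sup>2 + s) / 2 * (real k * (\<Sum>j<d. (\<kappa> j)\<^sup>2)) \<le> - L"
        using \<epsilon>L \<epsilon> by (simp add: s_def)
      then show ?thesis by (intro ennreal_leI) simp
    qed
    finally show ?thesis by (simp add: \<delta>L mult_left_mono)
  qed
  then have tail: "measure ?G {\<omega> \<in> space ?G. \<epsilon> < R \<omega>} \<le> \<delta>"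
    using \<delta> finite_measure.emeasure_eq_measure[OF prob_space.finite_measure[OF prob_space_gaussian_sample]]
    by simp
  have "measure ?G E \<le> exp \<epsilon> * measure ?G' E + measure ?G {\<omega> \<in> space ?G. \<epsilon> < R \<omega>}"
  proof (rule density_ratio_hockey_stick)
    show "prob_space ?G'" by (intro prob_space.prob_space_distr prob_space_gaussian_sample) measurable
    have "- 1 < \<kappa> j" for j using \<kappa>[of j] by simp
    from gaussian_sample_density_scaled[OF this]
    show "?G = density ?G' (\<lambda>\<omega>. ennreal (exp (R \<omega>)))" by (simp add: R_def)
  qed (use E in \<open>auto intro: prob_space_gaussian_sample\<close>)
  with tail show ?thesis by simp
qed

section \<open>Concentration of the sample covariance\<close>

definition sample_deviation :: "nat \<Rightarrow> (nat \<Rightarrow> nat \<Rightarrow> real) \<Rightarrow> nat \<Rightarrow> nat \<Rightarrow> real" where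
  "sample_deviation k \<omega> a b = 1 / real k * (\<Sum>i<k. \<omega> i a * \<omega> i b) - (if a = b then 1 else 0)"

lemma sample_deviation_measurable:
  assumes "a < d" "b < d"
  shows "(\<lambda>\<omega>. sample_deviation k \<omega> a b) \<in> borel_measurable (gaussian_sample k d)"
  unfolding sample_deviation_def
  by (intro borel_measurable_diff borel_measurable_times borel_measurable_sum borel_measurable_const
      sample_entry_measurable) (use assms in auto)

lemma sample_deviation_inner_measurable:
  "(\<lambda>\<omega>. \<Sum>a<d. \<Sum>b<d. U a b * sample_deviation k \<omega> a b) \<in> borel_measurable (gaussian_sample k d)"
  by (intro borel_measurable_sum borel_measurable_times borel_measurable_const sample_deviation_measurable) auto

lemma sum_rotate3:
  "(\<Sum>a\<in>A. \<Sum>b\<in>B. \<Sum>i\<in>C. f a b i) = (\<Sum>i\<in>C. \<Sum>a\<in>A. \<Sum>b\<in>B. f a b i)"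
  for f :: "'a \<Rightarrow> 'b \<Rightarrow> 'c \<Rightarrow> real"
proof -
  have "(\<Sum>b\<in>B. \<Sum>i\<in>C. f a b i) = (\<Sum>i\<in>C. \<Sum>b\<in>B. f a b i)" for a by (rule sum.swap)
  then have "(\<Sum>a\<in>A. \<Sum>b\<in>B. \<Sum>i\<in>C. f a b i) = (\<Sum>a\<in>A. \<Sum>i\<in>C. \<Sum>b\<in>B. f a b i)" by simp
  also have "\<dots> = (\<Sum>i\<in>C. \<Sum>a\<in>A. \<Sum>b\<in>B. f a b i)" by (rule sum.swap)
  finally show ?thesis .
qed

text \<open>For U = Q diag(l) Q^t, the inner product of U with x x^t is the sum of l_j (Q^t x)_j^2,
  while the trace of U is the sum of the l_j. Subtracting the identity thus centers each
  square.\<close>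

lemma sample_deviation_inner_diag:
  assumes Q: "orthonormal_mat d Q" and k: "1 \<le> k"
    and U: "\<And>a b. a < d \<Longrightarrow> b < d \<Longrightarrow> U a b = (\<Sum>j<d. Q $$ (a,j) * l j * Q $$ (b,j))"
  shows "(\<Sum>a<d. \<Sum>b<d. U a b * sample_deviation k \<omega> a b)
    = (\<Sum>i<k. \<Sum>j<d. l j / real k * ((mat_act d (transpose_mat Q) (\<omega> i) j)\<^sup>2 - 1))"
proof -
  note Q' = orthonormal_matD[OF Q]
  have quad: "(\<Sum>a<d. \<Sum>b<d. U a b * (x a * x b)) = (\<Sum>j<d. l j * (mat_act d (transpose_mat Q) x j)\<^sup>2)" for x
  proof -
    have "(\<Sum>a<d. \<Sum>b<d. U a b * (x a * x b))
        = (\<Sum>a<d. \<Sum>b<d. \<Sum>j<d. l j * (Q $$ (a,j) * x a) * (Q $$ (b,j) * x b))"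
      by (simp add: U sum_distrib_left sum_distrib_right ac_simps)
    also have "\<dots> = (\<Sum>j<d. \<Sum>a<d. \<Sum>b<d. l j * (Q $$ (a,j) * x a) * (Q $$ (b,j) * x b))"
      by (rule sum_rotate3)
    also have "\<dots> = (\<Sum>j<d. l j * ((\<Sum>a<d. Q $$ (a,j) * x a) * (\<Sum>b<d. Q $$ (b,j) * x b)))"
      by (simp add: sum_product sum_distrib_left ac_simps)
    also have "\<dots> = (\<Sum>j<d. l j * (mat_act d (transpose_mat Q) x j)\<^sup>2)"
      using Q'(1) by (intro sum.cong) (auto simp: mat_act_def power2_eq_square)
    finally show ?thesis .
  qed
  have tr: "(\<Sum>a<d. U a a) = (\<Sum>j<d. l j)"
  proof -
    have "(\<Sum>a<d. U a a) = (\<Sum>j<d. \<Sum>a<d. l j * (Q $$ (a,j) * Q $$ (a,j)))"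
      by (subst sum.swap) (simp add: U ac_simps)
    also have "\<dots> = (\<Sum>j<d. l j * (transpose_mat Q * Q) $$ (j,j))"
      using Q'(1) by (intro sum.cong) (auto simp: scalar_prod_def atLeast0LessThan sum_distrib_left)
    finally show ?thesis using Q'(3) by simp
  qed
  have "(\<Sum>a<d. \<Sum>b<d. U a b * sample_deviation k \<omega> a b)
      = (\<Sum>a<d. \<Sum>b<d. (\<Sum>i<k. 1 / real k * (U a b * (\<omega> i a * \<omega> i b))) - (if b = a then U a a else 0))"
    by (intro sum.cong) (auto simp: sample_deviation_def sum_distrib_left algebra_simps)
  also have "\<dots> = (\<Sum>a<d. \<Sum>b<d. \<Sum>i<k. 1 / real k * (U a b * (\<omega> i a * \<omega> i b))) - (\<Sum>a<d. U a a)"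
    by (simp add: sum_subtractf)
  also have "(\<Sum>a<d. \<Sum>b<d. \<Sum>i<k. 1 / real k * (U a b * (\<omega> i a * \<omega> i b)))
      = (\<Sum>i<k. 1 / real k * (\<Sum>a<d. \<Sum>b<d. U a b * (\<omega> i a * \<omega> i b)))"
    by (subst sum_rotate3) (simp add: sum_distrib_left)
  also have "\<dots> - (\<Sum>a<d. U a a) = (\<Sum>i<k. 1 / real k * (\<Sum>j<d. l j * (mat_act d (transpose_mat Q) (\<omega> i) j)\<^sup>2)
      - 1 / real k * (\<Sum>j<d. l j))"
    using k by (simp add: quad tr sum_subtractf)
  also have "\<dots> = (\<Sum>i<k. \<Sum>j<d. l j / real k * ((mat_act d (transpose_mat Q) (\<omega> i) j)\<^sup>2 - 1))"
    by (intro sum.cong refl, simp only: sum_distrib_left sum_subtractf[symmetric], intro sum.cong refl)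
      (simp add: diff_divide_distrib algebra_simps)
  finally show ?thesis .
qed

text \<open>Rotation invariance turns the diagonal form into a sum over independent coordinates with
  coefficients s l_j / k. The norm of U bounds the sum of the l_j^2, hence the exponent; in
  particular |l_j| \<le> 1, so s \<le> k/4 keeps every coefficient within 1/4.\<close>

lemma sample_deviation_inner_mgf:
  assumes sym: "\<And>a b. a < d \<Longrightarrow> b < d \<Longrightarrow> U a b = U b a" and U1: "(\<Sum>a<d. \<Sum>b<d. (U a b)\<^sup>2) \<le> 1"
    and k: "1 \<le> k" and s: "0 \<le> s" "s \<le> real k / 4"
  shows "(\<integral>\<^sup>+\<omega>. ennreal (exp (s * (\<Sum>a<d. \<Sum>b<d. U a b * sample_deviation k \<omega> a b))) \<partial>gaussian_sample k d)
    \<le> ennreal (exp (2 * s\<^sup>2 / real k))"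
proof -
  let ?G = "gaussian_sample k d"
  define M where "M = mat d d (\<lambda>(a,b). U a b)"
  have M: "M \<in> carrier_mat d d" by (simp add: M_def)
  have "transpose_mat M = M" using sym by (auto simp: M_def intro!: eq_matI)
  from real_spectral_theorem[OF M this] obtain Q l where Q: "orthonormal_mat d Q"
    and MQ: "M = Q * mat_diag d l * transpose_mat Q" .
  have U: "U a b = (\<Sum>j<d. Q $$ (a,j) * l j * Q $$ (b,j))" if "a < d" "b < d" for a b
    using orthonormal_conj_entry[OF Q that, of l] that by (simp add: MQ[symmetric] M_def)
  have l1: "(\<Sum>j<d. (l j)\<^sup>2) \<le> 1"
  proof -
    have "frobenius_norm M \<le> 1" using U1 by (simp add: frobenius_norm_def M_def)
    then show ?thesis by (simp add: MQ frobenius_norm_diag_conj[OF Q])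
  qed
  have l4: "\<bar>s * l j / real k\<bar> \<le> 1 / 4" if "j < d" for j
  proof -
    have "(l j)\<^sup>2 \<le> (\<Sum>j<d. (l j)\<^sup>2)" using that by (intro member_le_sum) auto
    also note l1
    finally have "\<bar>l j\<bar> \<le> 1" by (simp only: abs_square_le_1)
    then have "s * \<bar>l j\<bar> \<le> real k / 4 * 1" using s by (intro mult_mono) auto
    then show ?thesis using k s by (simp add: abs_mult field_simps)
  qed
  define g where "g \<omega> = ennreal (exp (\<Sum>i<k. \<Sum>j<d. (\<lambda>x. s * l j / real k * (x\<^sup>2 - 1)) (\<omega> i j)))"
    for \<omega> :: "nat \<Rightarrow> nat \<Rightarrow> real"
  have "(\<lambda>\<omega>. \<Sum>i<k. \<Sum>j<d. (\<lambda>x. s * l j / real k * (x\<^sup>2 - 1)) (\<omega> i j)) \<in> borel_measurable ?G"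
    by (rule sample_sum_measurable[where \<phi>="\<lambda>j x. s * l j / real k * (x\<^sup>2 - 1)"]) measurable
  then have g[measurable]: "g \<in> borel_measurable ?G"
    unfolding g_def by (rule measurable_compose[where g="\<lambda>x. ennreal (exp x)"]) measurable
  let ?rot = "\<lambda>\<omega>. \<lambda>i\<in>{..<k}. mat_act d (transpose_mat Q) (\<omega> i)"
  have rot[measurable]: "?rot \<in> measurable ?G ?G" by (rule measurable_restrict) measurable
  have "(\<integral>\<^sup>+\<omega>. ennreal (exp (s * (\<Sum>a<d. \<Sum>b<d. U a b * sample_deviation k \<omega> a b))) \<partial>?G)
      = (\<integral>\<^sup>+\<omega>. g (?rot \<omega>) \<partial>?G)"
    by (simp add: sample_deviation_inner_diag[OF Q k U] g_def sum_distrib_left ac_simps)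
  also have "\<dots> = (\<integral>\<^sup>+\<omega>. g \<omega> \<partial>distr ?G ?G ?rot)" by (simp add: nn_integral_distr)
  also have "\<dots> = (\<integral>\<^sup>+\<omega>. g \<omega> \<partial>?G)"
    by (simp only: gaussian_sample_orthonormal_invariant[OF orthonormal_transpose[OF Q]])
  also have "\<dots> \<le> ennreal (exp (real k * (\<Sum>j<d. 2 * (s * l j / real k)\<^sup>2)))"
    unfolding g_def
    by (rule nn_integral_exp_sum_gaussian_sample_le[OF _ nn_integral_exp_centered_square_le[OF l4]]) measurable
  also have "\<dots> \<le> ennreal (exp (2 * s\<^sup>2 / real k))"
  proof -
    have "real k * (\<Sum>j<d. 2 * (s * l j / real k)\<^sup>2) = 2 * s\<^sup>2 / real k * (\<Sum>j<d. (l j)\<^sup>2)"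
      using k by (simp add: sum_distrib_left power_mult_distrib power_divide power2_eq_square ac_simps sum_divide_distrib)
    also have "\<dots> \<le> 2 * s\<^sup>2 / real k * 1" using l1 by (intro mult_left_mono) auto
    finally show ?thesis by (intro ennreal_leI) simp
  qed
  finally show ?thesis .
qed

text \<open>Chernoff bound with the exponent \<open>s\<close> left free: its choice differs between
  small deviations, where the tail is Gaussian, and large ones, where it is exponential.\<close>

lemma sample_deviation_inner_tail:
  assumes sym: "\<And>a b. a < d \<Longrightarrow> b < d \<Longrightarrow> U a b = U b a" and U1: "(\<Sum>a<d. \<Sum>b<d. (U a b)\<^sup>2) \<le> 1"
    and k: "1 \<le> k" and s: "0 \<le> s" "s \<le> real k / 4"
  shows "measure (gaussian_sample k d)
      {\<omega> \<in> space (gaussian_sample k d). r \<le> (\<Sum>a<d. \<Sum>b<d. U a b * sample_deviation k \<omega> a b)}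
    \<le> exp (2 * s\<^sup>2 / real k - s * r)"
proof -
  let ?G = "gaussian_sample k d"
  let ?X = "\<lambda>\<omega>. \<Sum>a<d. \<Sum>b<d. U a b * sample_deviation k \<omega> a b"
  interpret G: prob_space ?G by (rule prob_space_gaussian_sample)
  have X[measurable]: "?X \<in> borel_measurable ?G" by (rule sample_deviation_inner_measurable)
  have S: "{\<omega> \<in> space ?G. r \<le> ?X \<omega>} \<in> sets ?G" using X by (rule borel_measurable_le[OF borel_measurable_const])
  have "emeasure ?G {\<omega> \<in> space ?G. r \<le> ?X \<omega>} = (\<integral>\<^sup>+\<omega>. indicator {\<omega> \<in> space ?G. r \<le> ?X \<omega>} \<omega> \<partial>?G)"
    using S by (simp add: nn_integral_indicator)
  also have "\<dots> \<le> (\<integral>\<^sup>+\<omega>. ennreal (exp (- s * r)) * ennreal (exp (s * ?X \<omega>)) \<partial>?G)"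
  proof (rule nn_integral_mono)
    fix \<omega>
    have "1 \<le> exp (s * (?X \<omega> - r))" if "r \<le> ?X \<omega>" using that s by simp
    then show "indicator {\<omega> \<in> space ?G. r \<le> ?X \<omega>} \<omega> \<le> ennreal (exp (- s * r)) * ennreal (exp (s * ?X \<omega>))"
      by (auto simp: ennreal_mult[symmetric] exp_add[symmetric] right_diff_distrib split: split_indicator)
  qed
  also have "\<dots> = ennreal (exp (- s * r)) * (\<integral>\<^sup>+\<omega>. ennreal (exp (s * ?X \<omega>)) \<partial>?G)"
    using X by (intro nn_integral_cmult) measurable
  also have "\<dots> \<le> ennreal (exp (- s * r)) * ennreal (exp (2 * s\<^sup>2 / real k))"
    by (intro mult_left_mono sample_deviation_inner_mgf[OF sym U1 k s]) auto
  also have "\<dots> = ennreal (exp (2 * s\<^sup>2 / real k - s * r))"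
    by (simp add: ennreal_mult[symmetric] exp_add[symmetric])
  finally show ?thesis by (simp add: G.emeasure_eq_measure)
qed

section \<open>A finite net of directions in Frobenius norm\<close>

definition grid :: "nat \<Rightarrow> (nat \<times> nat \<Rightarrow> int) set" where
  "grid d = {m \<in> PiE ({..<d} \<times> {..<d}) (\<lambda>_. {- int (2 * d)..int (2 * d)}).
     (\<Sum>p\<in>{..<d} \<times> {..<d}. (m p)\<^sup>2) \<le> 4 * (int d)\<^sup>2}"

text \<open>The two-sided geometric series 1 + 2 (1/2 + 1/4 + ...) has value 3; it is the total
  weight of one entry in the count below.\<close>

lemma sum_half_power_int_le: "(\<Sum>j\<in>{- int n..int n}. (1 / 2 :: real) ^ nat \<bar>j\<bar>) \<le> 3"
proof -
  have "(\<Sum>j\<in>{- int n..int n}. (1 / 2 :: real) ^ nat \<bar>j\<bar>) = 3 - 2 * (1 / 2) ^ n"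
  proof (induction n)
    case (Suc n)
    let ?f = "\<lambda>j. (1 / 2 :: real) ^ nat \<bar>j\<bar>"
    have set: "{- int (Suc n)..int (Suc n)} = insert (- int (Suc n)) (insert (int (Suc n)) {- int n..int n})"
      by auto
    have new: "- int (Suc n) \<notin> insert (int (Suc n)) {- int n..int n}" "int (Suc n) \<notin> {- int n..int n}"
      by auto
    have "sum ?f {- int (Suc n)..int (Suc n)} = ?f (- int (Suc n)) + (?f (int (Suc n)) + sum ?f {- int n..int n})"
      unfolding set using sum.insert[OF _ new(1), of ?f] sum.insert[OF _ new(2), of ?f]
      by (simp only: finite_insert finite_atLeastAtMost_int simp_thms)
    moreover have "?f (- int (Suc n)) = (1 / 2) ^ Suc n" "?f (int (Suc n)) = (1 / 2) ^ Suc n"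
      by (simp_all only: abs_minus_cancel abs_of_nat nat_int)
    ultimately have "sum ?f {- int (Suc n)..int (Suc n)} = (1 / 2) ^ Suc n + ((1 / 2) ^ Suc n + (3 - 2 * (1 / 2) ^ n))"
      using Suc.IH by (simp only:)
    also have "\<dots> = 3 - 2 * (1 / 2) ^ Suc n" by simp
    finally show ?case .
  qed simp
  then show ?thesis by simp
qed

lemma grid_subset: "grid d \<subseteq> PiE ({..<d} \<times> {..<d}) (\<lambda>_. {- int (2 * d)..int (2 * d)})"
  unfolding grid_def by blast

lemma finite_grid: "finite (grid d)"
  by (rule finite_subset[OF grid_subset finite_PiE]) simp_all

text \<open>A member m stands for the direction m / (2d), so the sum condition in
  \<open>grid\<close> says that its norm is at most 1. For integers |x| \<le> x^2, so the absolute
  entries sum to at most 4 d^2 and the weight 2^(- sum |m|) is at least 16^(- d^2). Summed over the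
  whole box this weight factors into d^2 sums of size at most 3, and 16 times 3 is 48.\<close>

lemma card_grid_le: "real (card (grid d)) \<le> 48 ^ (d\<^sup>2)"
proof -
  let ?S = "{..<d} \<times> {..<d}"
  let ?B = "{- int (2 * d)..int (2 * d)}"
  let ?w = "\<lambda>m. \<Prod>p\<in>?S. (1 / 2 :: real) ^ nat \<bar>m p\<bar>"
  have w: "1 \<le> 16 ^ (d\<^sup>2) * ?w m" if m: "m \<in> grid d" for m
  proof -
    have "int (\<Sum>p\<in>?S. nat \<bar>m p\<bar>) \<le> (\<Sum>p\<in>?S. (m p)\<^sup>2)"
    proof -
      have "\<bar>x\<bar> \<le> x\<^sup>2" for x :: int
        using self_le_power[of "\<bar>x\<bar>" 2] by (cases "x = 0") auto
      then show ?thesis by (simp add: sum_mono)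
    qed
    also have "\<dots> \<le> int (4 * d\<^sup>2)" using m by (simp add: grid_def)
    finally have "(\<Sum>p\<in>?S. nat \<bar>m p\<bar>) \<le> 4 * d\<^sup>2" by (simp only: of_nat_le_iff)
    then have "(1 / 2 :: real) ^ (4 * d\<^sup>2) \<le> (1 / 2) ^ (\<Sum>p\<in>?S. nat \<bar>m p\<bar>)"
      by (intro power_decreasing) auto
    then have "16 ^ (d\<^sup>2) * (1 / 2 :: real) ^ (4 * d\<^sup>2) \<le> 16 ^ (d\<^sup>2) * ?w m"
      by (simp add: power_sum)
    moreover have "16 ^ (d\<^sup>2) * (1 / 2 :: real) ^ (4 * d\<^sup>2) = 1"
      by (simp add: power_mult power_mult_distrib[symmetric] power_divide)
    ultimately show ?thesis by simp
  qed
  have "real (card (grid d)) = (\<Sum>m\<in>grid d. 1)" by simp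
  also have "\<dots> \<le> (\<Sum>m\<in>grid d. 16 ^ (d\<^sup>2) * ?w m)" by (intro sum_mono w)
  also have "\<dots> \<le> (\<Sum>m\<in>PiE ?S (\<lambda>_. ?B). 16 ^ (d\<^sup>2) * ?w m)"
  proof (rule sum_mono2[OF _ grid_subset])
    show "finite (PiE ?S (\<lambda>_. ?B))" by (rule finite_PiE) simp_all
    show "0 \<le> 16 ^ (d\<^sup>2) * ?w m" for m :: "nat \<times> nat \<Rightarrow> int"
      by (intro mult_nonneg_nonneg prod_nonneg) simp_all
  qed
  also have "\<dots> = 16 ^ (d\<^sup>2) * (\<Prod>p\<in>?S. \<Sum>j\<in>?B. (1 / 2 :: real) ^ nat \<bar>j\<bar>)"
    using prod_sum_PiE[of ?S "\<lambda>_. ?B" "\<lambda>_ j. (1 / 2 :: real) ^ nat \<bar>j\<bar>"] by (simp add: sum_distrib_left)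
  also have "\<dots> \<le> 16 ^ (d\<^sup>2) * (\<Prod>p\<in>?S. 3)"
    by (intro mult_left_mono prod_mono conjI sum_half_power_int_le sum_nonneg) simp_all
  also have "\<dots> = 48 ^ (d\<^sup>2)"
    by (simp add: card_cartesian_product power2_eq_square power_mult_distrib[symmetric])
  finally show ?thesis .
qed

text \<open>The direction \<open>X / r\<close> of a symmetric matrix of norm \<open>r\<close> is rounded towards zero, entry by
  entry, to a multiple of \<open>1 / (2d)\<close>; rounding to the nearest multiple could leave the unit ball.\<close>

lemma grid_direction:
  fixes X :: "nat \<Rightarrow> nat \<Rightarrow> real"
  assumes d: "1 \<le> d" and sym: "\<And>a b. a < d \<Longrightarrow> b < d \<Longrightarrow> X a b = X b a"
    and r: "0 < r" "r\<^sup>2 = (\<Sum>a<d. \<Sum>b<d. (X a b)\<^sup>2)"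
  obtains m where "m \<in> grid d" "\<And>a b. a < d \<Longrightarrow> b < d \<Longrightarrow> m (a,b) = m (b,a)"
    "r / 4 \<le> (\<Sum>a<d. \<Sum>b<d. real_of_int (m (a,b)) / (2 * real d) * X a b)"
proof -
  define t where "t y = (if 0 \<le> y then \<lfloor>y\<rfloor> else \<lceil>y\<rceil>)" for y :: real
  have t_abs: "\<bar>real_of_int (t y)\<bar> \<le> \<bar>y\<bar>" for y unfolding t_def by (auto; linarith)
  \<comment> \<open>Rounding moves y by less than one, so the product with y loses at most
    |y|.\<close>
  have t_mult: "y\<^sup>2 - \<bar>y\<bar> \<le> real_of_int (t y) * y" for y
  proof (cases "0 \<le> y")
    case True
    then have "(y - 1) * y \<le> real_of_int \<lfloor>y\<rfloor> * y" by (intro mult_right_mono) linarith+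
    with True show ?thesis by (simp add: t_def power2_eq_square algebra_simps)
  next
    case False
    then have "(y + 1) * y \<le> real_of_int \<lceil>y\<rceil> * y" by (intro mult_right_mono_neg) linarith+
    with False show ?thesis by (simp add: t_def power2_eq_square algebra_simps)
  qed
  define D where "D = 2 * real d"
  have D: "0 < D" using d by (simp add: D_def)
  define m where "m = (\<lambda>p\<in>{..<d} \<times> {..<d}. t (D * X (fst p) (snd p) / r))"
  have m: "m (a,b) = t (D * X a b / r)" if "a < d" "b < d" for a b using that by (simp add: m_def)
  have X_le: "(X a b)\<^sup>2 \<le> r\<^sup>2" if "a < d" "b < d" for a b
  proof -
    have "(X a b)\<^sup>2 \<le> (\<Sum>b<d. (X a b)\<^sup>2)" using that by (intro member_le_sum) auto
    also have "\<dots> \<le> (\<Sum>a<d. \<Sum>b<d. (X a b)\<^sup>2)"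
      using that by (intro member_le_sum[where f="\<lambda>a. \<Sum>b<d. (X a b)\<^sup>2"]) (auto intro: sum_nonneg)
    finally show ?thesis using r by simp
  qed
  have m_abs: "\<bar>m (a,b)\<bar> \<le> int (2 * d)" if "a < d" "b < d" for a b
  proof -
    have "\<bar>X a b\<bar> \<le> r" using X_le[OF that] r(1) abs_le_square_iff[of "X a b" r] by simp
    then have "\<bar>D * X a b / r\<bar> \<le> D" using D r(1) by (simp add: abs_mult field_simps)
    then have "\<bar>real_of_int (m (a,b))\<bar> \<le> D" using t_abs[of "D * X a b / r"] by (simp add: m[OF that])
    then show ?thesis by (simp add: D_def)
  qed
  have "(\<Sum>p\<in>{..<d} \<times> {..<d}. (real_of_int (m p))\<^sup>2) \<le> (\<Sum>p\<in>{..<d} \<times> {..<d}. (D / r)\<^sup>2 * (X (fst p) (snd p))\<^sup>2)"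
  proof (rule sum_mono)
    fix p assume "p \<in> {..<d} \<times> {..<d}"
    then obtain a b where p: "p = (a,b)" "a < d" "b < d" by auto
    have "(real_of_int (m p))\<^sup>2 \<le> (D * X a b / r)\<^sup>2"
      unfolding p(1) m[OF p(2,3)] by (rule abs_le_square_iff[THEN iffD1, OF t_abs])
    then show "(real_of_int (m p))\<^sup>2 \<le> (D / r)\<^sup>2 * (X (fst p) (snd p))\<^sup>2"
      by (simp add: p power_mult_distrib power_divide)
  qed
  also have "\<dots> = (D / r)\<^sup>2 * r\<^sup>2"
    by (simp add: sum_distrib_left[symmetric] r(2) sum.cartesian_product split_beta')
  also have "\<dots> = 4 * (real d)\<^sup>2" using r(1) by (simp add: D_def power_divide power_mult_distrib)
  finally have "real_of_int (\<Sum>p\<in>{..<d} \<times> {..<d}. (m p)\<^sup>2) \<le> real_of_int (4 * (int d)\<^sup>2)" by simp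
  then have "(\<Sum>p\<in>{..<d} \<times> {..<d}. (m p)\<^sup>2) \<le> 4 * (int d)\<^sup>2" by (simp only: of_int_le_iff)
  moreover have "m \<in> PiE ({..<d} \<times> {..<d}) (\<lambda>_. {- int (2 * d)..int (2 * d)})"
  proof (rule PiE_I)
    fix p assume "p \<in> {..<d} \<times> {..<d}"
    then obtain a b where p: "p = (a,b)" "a < d" "b < d" by auto
    show "m p \<in> {- int (2 * d)..int (2 * d)}" using m_abs[OF p(2,3)] by (simp add: p(1) abs_le_iff)
  next
    fix p assume "p \<notin> {..<d} \<times> {..<d}"
    then show "m p = undefined" by (simp add: m_def restrict_def)
  qed
  ultimately have grid: "m \<in> grid d" by (simp add: grid_def)
  \<comment> \<open>With D = 2d, rounding costs an entry of size x at most x/D. The inequality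
    between the means splits this into x^2 / (2r), half of the main term, and r / (2 D^2) = r / (8
    d^2); the latter sum to r/8 over the d^2 entries.\<close>
  have "r / 4 \<le> r / 2 - r / 8" using r(1) by simp
  also have "\<dots> = (\<Sum>a<d. \<Sum>b<d. (X a b)\<^sup>2 / (2 * r) - r / (8 * (real d)\<^sup>2))"
  proof -
    have "(\<Sum>a<d. \<Sum>b<d. (X a b)\<^sup>2 / (2 * r) - r / (8 * (real d)\<^sup>2)) = r\<^sup>2 / (2 * r) - real d * (real d * (r / (8 * (real d)\<^sup>2)))"
      by (simp add: sum_subtractf sum_divide_distrib[symmetric] r(2))
    also have "\<dots> = r / 2 - r / 8" using r(1) d by (simp add: power2_eq_square)
    finally show ?thesis by simp
  qed
  also have "\<dots> \<le> (\<Sum>a<d. \<Sum>b<d. real_of_int (m (a,b)) / (2 * real d) * X a b)"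
  proof (intro sum_mono)
    fix a b assume "a \<in> {..<d}" "b \<in> {..<d}"
    then have ab: "a < d" "b < d" by auto
    define x where "x = \<bar>X a b\<bar>"
    have x: "(X a b)\<^sup>2 = x\<^sup>2" by (simp add: x_def)
    have e1: "\<bar>D * X a b / r\<bar> = D * x / r" using D r(1) by (simp add: x_def abs_mult)
    have e2: "(D * X a b / r)\<^sup>2 = D\<^sup>2 * x\<^sup>2 / r\<^sup>2" by (simp add: power_divide power_mult_distrib x)
    have "(D * X a b / r)\<^sup>2 - \<bar>D * X a b / r\<bar> \<le> real_of_int (m (a,b)) * (D * X a b / r)"
      unfolding m[OF ab] by (rule t_mult)
    then have "((D * X a b / r)\<^sup>2 - \<bar>D * X a b / r\<bar>) * (r / D\<^sup>2) \<le> real_of_int (m (a,b)) * (D * X a b / r) * (r / D\<^sup>2)"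
      using r(1) D by (intro mult_right_mono) auto
    moreover have "((D * X a b / r)\<^sup>2 - \<bar>D * X a b / r\<bar>) * (r / D\<^sup>2) = x\<^sup>2 / r - x / D"
      unfolding e1 e2 using r(1) D by (simp add: power2_eq_square field_simps)
    moreover have "real_of_int (m (a,b)) * (D * X a b / r) * (r / D\<^sup>2) = real_of_int (m (a,b)) / (2 * real d) * X a b"
      using r(1) D by (simp add: power2_eq_square D_def)
    moreover have "x / D \<le> x\<^sup>2 / (2 * r) + r / (2 * D\<^sup>2)"
    proof -
      have "0 \<le> (x / r - 1 / D)\<^sup>2 * (r / 2)" using r(1) by simp
      also have "\<dots> = x\<^sup>2 / (2 * r) + r / (2 * D\<^sup>2) - x / D"
        using r(1) D by (simp add: power2_eq_square field_simps)
      finally show ?thesis by simp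
    qed
    moreover have "r / (2 * D\<^sup>2) = r / (8 * (real d)\<^sup>2)" by (simp add: D_def power_mult_distrib)
    moreover have "x\<^sup>2 / r = x\<^sup>2 / (2 * r) + x\<^sup>2 / (2 * r)" using r(1) by (simp add: field_simps)
    ultimately show "(X a b)\<^sup>2 / (2 * r) - r / (8 * (real d)\<^sup>2) \<le> real_of_int (m (a,b)) / (2 * real d) * X a b"
      unfolding x by linarith
  qed
  finally show ?thesis using that[OF grid] m sym by simp
qed

text \<open>Union bound over the symmetric members of the grid, symmetry being what allows each
  direction to be diagonalized. A deviation above \<rho> has inner product at least \<rho>/4 with
  one of them, which accounts for the 4 in the exponent.\<close>

lemma sample_deviation_norm_tail:
  assumes d: "1 \<le> d" and k: "1 \<le> k" and s: "0 \<le> s" "s \<le> real k / 4" and \<rho>: "0 \<le> \<rho>"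
  shows "measure (gaussian_sample k d)
      {\<omega> \<in> space (gaussian_sample k d). \<rho> < sqrt (\<Sum>a<d. \<Sum>b<d. (sample_deviation k \<omega> a b)\<^sup>2)}
    \<le> 48 ^ (d\<^sup>2) * exp (2 * s\<^sup>2 / real k - s * \<rho> / 4)"
proof -
  let ?G = "gaussian_sample k d"
  interpret G: prob_space ?G by (rule prob_space_gaussian_sample)
  define M where "M = {m \<in> grid d. \<forall>a<d. \<forall>b<d. m (a,b) = m (b,a)}"
  have M: "finite M" unfolding M_def using finite_grid by (rule rev_finite_subset) auto
  define U where "U m a b = real_of_int (m (a,b)) / (2 * real d)" for m :: "nat \<times> nat \<Rightarrow> int" and a b
  let ?F = "\<lambda>m. {\<omega> \<in> space ?G. \<rho> / 4 \<le> (\<Sum>a<d. \<Sum>b<d. U m a b * sample_deviation k \<omega> a b)}"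
  have F: "?F m \<in> sets ?G" for m
    by (rule borel_measurable_le[OF borel_measurable_const sample_deviation_inner_measurable])
  have "{\<omega> \<in> space ?G. \<rho> < sqrt (\<Sum>a<d. \<Sum>b<d. (sample_deviation k \<omega> a b)\<^sup>2)} \<subseteq> (\<Union>m\<in>M. ?F m)"
  proof
    fix \<omega> assume \<omega>: "\<omega> \<in> {\<omega> \<in> space ?G. \<rho> < sqrt (\<Sum>a<d. \<Sum>b<d. (sample_deviation k \<omega> a b)\<^sup>2)}"
    define r where "r = sqrt (\<Sum>a<d. \<Sum>b<d. (sample_deviation k \<omega> a b)\<^sup>2)"
    have r: "\<rho> < r" using \<omega> by (simp add: r_def)
    have r2: "r\<^sup>2 = (\<Sum>a<d. \<Sum>b<d. (sample_deviation k \<omega> a b)\<^sup>2)"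
      by (simp add: r_def sum_nonneg)
    have sd: "sample_deviation k \<omega> a b = sample_deviation k \<omega> b a" for a b
      by (simp add: sample_deviation_def mult.commute)
    have r0: "0 < r" using r \<rho> by simp
    obtain m where m: "m \<in> grid d" "\<And>a b. a < d \<Longrightarrow> b < d \<Longrightarrow> m (a,b) = m (b,a)"
      "r / 4 \<le> (\<Sum>a<d. \<Sum>b<d. real_of_int (m (a,b)) / (2 * real d) * sample_deviation k \<omega> a b)"
      by (rule grid_direction[OF d sd r0 r2]) (rule that)
    have "m \<in> M" unfolding M_def using m(1,2) by blast
    moreover have "\<rho> / 4 \<le> (\<Sum>a<d. \<Sum>b<d. U m a b * sample_deviation k \<omega> a b)"
      unfolding U_def using m(3) r by linarith
    moreover have "\<omega> \<in> space ?G" using \<omega> by (rule CollectE) (rule conjunct1)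
    ultimately show "\<omega> \<in> (\<Union>m\<in>M. ?F m)" by blast
  qed
  then have "measure ?G {\<omega> \<in> space ?G. \<rho> < sqrt (\<Sum>a<d. \<Sum>b<d. (sample_deviation k \<omega> a b)\<^sup>2)}
      \<le> measure ?G (\<Union>m\<in>M. ?F m)"
    using sets.finite_UN[OF M F] by (rule G.finite_measure_mono)
  also have "\<dots> \<le> (\<Sum>m\<in>M. measure ?G (?F m))"
    by (rule G.finite_measure_subadditive_finite[OF M]) (use F in blast)
  also have "\<dots> \<le> (\<Sum>m\<in>M. exp (2 * s\<^sup>2 / real k - s * (\<rho> / 4)))"
  proof (intro sum_mono sample_deviation_inner_tail[OF _ _ k s])
    fix m assume m: "m \<in> M"
    then show "U m a b = U m b a" if "a < d" "b < d" for a b using that by (simp add: U_def M_def)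
    have "(\<Sum>a<d. \<Sum>b<d. (U m a b)\<^sup>2) = (\<Sum>p\<in>{..<d} \<times> {..<d}. (real_of_int (m p))\<^sup>2) / (4 * (real d)\<^sup>2)"
      by (simp add: U_def power_divide power_mult_distrib sum.cartesian_product split_beta' sum_divide_distrib)
    also have "\<dots> = real_of_int (\<Sum>p\<in>{..<d} \<times> {..<d}. (m p)\<^sup>2) / (4 * (real d)\<^sup>2)" by simp
    also have "\<dots> \<le> real_of_int (4 * (int d)\<^sup>2) / (4 * (real d)\<^sup>2)"
    proof (rule divide_right_mono)
      have "(\<Sum>p\<in>{..<d} \<times> {..<d}. (m p)\<^sup>2) \<le> 4 * (int d)\<^sup>2" using m unfolding M_def grid_def by blast
      then show "real_of_int (\<Sum>p\<in>{..<d} \<times> {..<d}. (m p)\<^sup>2) \<le> real_of_int (4 * (int d)\<^sup>2)"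
        by (simp only: of_int_le_iff)
    qed simp
    also have "\<dots> = 1" using d by simp
    finally show "(\<Sum>a<d. \<Sum>b<d. (U m a b)\<^sup>2) \<le> 1" .
  qed
  also have "\<dots> = real (card M) * exp (2 * s\<^sup>2 / real k - s * \<rho> / 4)" by simp
  also have "\<dots> \<le> 48 ^ (d\<^sup>2) * exp (2 * s\<^sup>2 / real k - s * \<rho> / 4)"
  proof (intro mult_right_mono)
    have "card M \<le> card (grid d)" by (intro card_mono finite_grid) (auto simp: M_def)
    then show "real (card M) \<le> 48 ^ (d\<^sup>2)" using card_grid_le[of d] by linarith
  qed auto
  finally show ?thesis .
qed

text \<open>The square root term of the bound pays for t \<le> k/16 and the linear term for larger
  t. In both regimes the exponent falls to -6t, where -6 d^2 absorbs the size of the net.\<close>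

lemma sample_deviation_norm_bound:
  assumes d: "1 \<le> d" and k: "1 \<le> k" and \<gamma>: "0 < \<gamma>" "\<gamma> < 1"
  defines "t \<equiv> (real d)\<^sup>2 + ln (1 / \<gamma>)"
  shows "measure (gaussian_sample k d) {\<omega> \<in> space (gaussian_sample k d).
      128 * (sqrt (t / real k) + t / real k) < sqrt (\<Sum>a<d. \<Sum>b<d. (sample_deviation k \<omega> a b)\<^sup>2)} \<le> \<gamma>"
proof -
  have t: "0 < t" using d \<gamma> by (simp add: t_def add_pos_pos)
  have k0: "0 < real k" using k by simp
  define \<rho> where "\<rho> = 128 * (sqrt (t / real k) + t / real k)"
  have \<rho>: "0 \<le> \<rho>" using t k0 by (simp add: \<rho>_def)
  obtain s where s: "0 \<le> s" "s \<le> real k / 4" and opt: "2 * s\<^sup>2 / real k - s * \<rho> / 4 \<le> - 6 * t"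
  proof (cases "t \<le> real k / 16")
    case True
    \<comment> \<open>Balances s^2 / k against s sqrt (t/k): both equal t. The choice is admissible
      because t \<le> k/16 gives k t \<le> (k/4)^2.\<close>
    define s where "s = sqrt (real k * t)"
    have s2: "s\<^sup>2 = real k * t" using t k0 by (simp add: s_def)
    have "s\<^sup>2 \<le> (real k / 4)\<^sup>2"
      unfolding s2 using mult_left_mono[OF True, of "real k"] by (simp add: power2_eq_square)
    then have "s \<le> real k / 4" by (rule power2_le_imp_le) simp
    moreover have "0 \<le> s" using t k0 by (simp add: s_def)
    moreover have "2 * s\<^sup>2 / real k - s * \<rho> / 4 \<le> - 6 * t"
    proof -
      have "s * sqrt (t / real k) = sqrt ((real k * t) * (t / real k))" 
        unfolding s_def by (rule real_sqrt_mult[symmetric])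
      also have "(real k * t) * (t / real k) = t\<^sup>2" using k0 by (simp add: power2_eq_square)
      finally have st: "s * sqrt (t / real k) = t" using t by simp
      have "128 * t \<le> s * \<rho>"
      proof -
        have "s * \<rho> = 128 * (s * sqrt (t / real k)) + 128 * (s * (t / real k))"
          by (simp add: \<rho>_def algebra_simps)
        moreover have "0 \<le> s * (t / real k)" using \<open>0 \<le> s\<close> t k0 by simp
        ultimately show ?thesis using st by simp
      qed
      moreover have "2 * s\<^sup>2 / real k = 2 * t" using k0 by (simp add: s2)
      ultimately show ?thesis using t by simp
    qed
    ultimately show ?thesis using that by blast
  next
    case False
    \<comment> \<open>Now s is the largest admissible value k/4. As k < 16t, the quadratic term k/8
      is below 2t, while s \<rho> / 4 is at least 8t; this case fixes the constant 128.\<close>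
    have "128 * (t / real k) \<le> \<rho>" using t k0 by (simp add: \<rho>_def)
    then have "real k / 4 * (128 * (t / real k)) \<le> real k / 4 * \<rho>" using k0 by (intro mult_left_mono) auto
    then have "32 * t \<le> real k / 4 * \<rho>" using k0 by simp
    moreover have "2 * (real k / 4)\<^sup>2 / real k = real k / 8" using k0 by (simp add: power2_eq_square)
    ultimately have "2 * (real k / 4)\<^sup>2 / real k - real k / 4 * \<rho> / 4 \<le> - 6 * t" using False by simp
    then show ?thesis using that[of "real k / 4"] k0 by simp
  qed
  have "measure (gaussian_sample k d) {\<omega> \<in> space (gaussian_sample k d).
      \<rho> < sqrt (\<Sum>a<d. \<Sum>b<d. (sample_deviation k \<omega> a b)\<^sup>2)}
      \<le> 48 ^ (d\<^sup>2) * exp (2 * s\<^sup>2 / real k - s * \<rho> / 4)"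
    by (rule sample_deviation_norm_tail[OF d k s \<rho>])
  \<comment> \<open>The factor 6 is chosen since 48 \<le> 2^6 \<le> exp 6.\<close>
  also have "\<dots> \<le> exp 6 ^ (d\<^sup>2) * exp (- 6 * t)"
  proof (intro mult_mono power_mono)
    have "(2::real) ^ 6 \<le> exp 1 ^ 6" using exp_ge_add_one_self[of 1] by (intro power_mono) auto
    also have "exp 1 ^ 6 = exp (6::real)" by (simp add: exp_of_nat_mult[symmetric])
    finally show "48 \<le> exp (6::real)" by simp
  qed (use opt in auto)
  also have "\<dots> = exp (6 * (real d)\<^sup>2 - 6 * t)"
    by (simp add: exp_of_nat_mult[symmetric] exp_add[symmetric] mult.commute)
  also have "\<dots> \<le> exp (- ln (1 / \<gamma>))"
  proof -
    have "0 \<le> ln (1 / \<gamma>)" using \<gamma> by simp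
    then have "6 * (real d)\<^sup>2 - 6 * t \<le> - ln (1 / \<gamma>)" by (simp only: t_def distrib_left)
    then show ?thesis by simp
  qed
  also have "\<dots> = \<gamma>" using \<gamma> by (simp add: ln_div)
  finally show ?thesis by (simp add: \<rho>_def)
qed

section \<open>The Gaussian sampling mechanism\<close>

lemma space_mat_borel [simp]: "space (mat_borel d) = carrier_mat d d"
  by (simp add: mat_borel_def)

lemma space_vec_borel [simp]: "space (vec_borel d) = carrier_vec d"
  by (simp add: vec_borel_def)

lemma space_psd_borel [simp]: "space (psd_borel d) = psd_mats d"
  by (auto simp: psd_borel_def space_restrict_space psd_mats_def)

lemma mat_entry_measurable:
  assumes "a < d" "b < d"
  shows "(\<lambda>A. A $$ (a,b)) \<in> borel_measurable (mat_borel d)"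
proof -
  have "(\<lambda>A. \<lambda>ij\<in>{..<d} \<times> {..<d}. A $$ ij) \<in> measurable (mat_borel d) (\<Pi>\<^sub>M ij\<in>{..<d} \<times> {..<d}. borel :: real measure)"
    unfolding mat_borel_def by (rule measurable_vimage_algebra1) (auto simp: space_PiM)
  from measurable_compose[OF this measurable_component_singleton[of "(a,b)"]] assms
  show ?thesis by simp
qed

lemma measurable_mat_borelI:
  assumes "\<And>x. x \<in> space N \<Longrightarrow> f x \<in> carrier_mat d d"
    and "\<And>a b. a < d \<Longrightarrow> b < d \<Longrightarrow> (\<lambda>x. f x $$ (a,b)) \<in> borel_measurable N"
  shows "f \<in> measurable N (mat_borel d)"
  unfolding mat_borel_def
proof (rule measurable_vimage_algebra2)
  show "(\<lambda>x. \<lambda>ij\<in>{..<d} \<times> {..<d}. f x $$ ij) \<in> measurable N (\<Pi>\<^sub>M ij\<in>{..<d} \<times> {..<d}. borel)"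
    using assms(2) by (intro measurable_restrict) auto
qed (use assms(1) in auto)

lemma vec_entry_measurable:
  assumes "a < d"
  shows "(\<lambda>v. v $ a) \<in> borel_measurable (vec_borel d)"
proof -
  have "(\<lambda>v. \<lambda>i\<in>{..<d}. v $ i) \<in> measurable (vec_borel d) (\<Pi>\<^sub>M i\<in>{..<d}. borel :: real measure)"
    unfolding vec_borel_def by (rule measurable_vimage_algebra1) (auto simp: space_PiM)
  from measurable_compose[OF this measurable_component_singleton[of a]] assms
  show ?thesis by simp
qed

lemma measurable_vec_borelI:
  assumes "\<And>x. x \<in> space N \<Longrightarrow> f x \<in> carrier_vec d"
    and "\<And>a. a < d \<Longrightarrow> (\<lambda>x. f x $ a) \<in> borel_measurable N"
  shows "f \<in> measurable N (vec_borel d)"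
  unfolding vec_borel_def
proof (rule measurable_vimage_algebra2)
  show "(\<lambda>x. \<lambda>i\<in>{..<d}. f x $ i) \<in> measurable N (\<Pi>\<^sub>M i\<in>{..<d}. borel)"
    using assms(2) by (intro measurable_restrict) auto
qed (use assms(1) in auto)

lemma mat_mult_measurable:
  assumes f: "f \<in> measurable N (mat_borel d)" and g: "g \<in> measurable N (mat_borel d)"
  shows "(\<lambda>x. f x * g x) \<in> measurable N (mat_borel d)"
proof (rule measurable_mat_borelI)
  have fc: "f x \<in> carrier_mat d d" and gc: "g x \<in> carrier_mat d d" if "x \<in> space N" for x
    using measurable_space[OF f that] measurable_space[OF g that] by auto
  show "f x * g x \<in> carrier_mat d d" if "x \<in> space N" for x
    using fc[OF that] gc[OF that] by simp
  fix a b assume ab: "a < d" "b < d"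
  have "(f x * g x) $$ (a,b) = (\<Sum>c<d. f x $$ (a,c) * g x $$ (c,b))" if "x \<in> space N" for x
    using fc[OF that] gc[OF that] ab by (simp add: scalar_prod_def atLeast0LessThan)
  moreover have "(\<lambda>x. \<Sum>c<d. f x $$ (a,c) * g x $$ (c,b)) \<in> borel_measurable N"
    using ab by (intro borel_measurable_sum borel_measurable_times
        measurable_compose[OF f mat_entry_measurable] measurable_compose[OF g mat_entry_measurable]) auto
  ultimately show "(\<lambda>x. (f x * g x) $$ (a,b)) \<in> borel_measurable N"
    by (simp cong: measurable_cong)
qed

lemma measurable_psd_borel_mat_borel: "(\<lambda>A. A) \<in> measurable (psd_borel d) (mat_borel d)"
  unfolding psd_borel_def by (rule measurable_restrict_space1) simp

lemma mat_pow_measurable: "(\<lambda>A. A ^\<^sub>m i) \<in> measurable (psd_borel d) (mat_borel d)"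
proof (induction i)
  case 0
  have "(\<lambda>A::real mat. 1\<^sub>m d) \<in> measurable (psd_borel d) (mat_borel d)" by simp
  then show ?case
    by (rule measurable_cong[THEN iffD1, rotated]) (auto dest: psd_matsD(1))
next
  case (Suc i)
  then show ?case using mat_mult_measurable[OF Suc measurable_psd_borel_mat_borel] by simp
qed

lemma mat_sqrt_measurable: "mat_sqrt \<in> measurable (psd_borel d) (mat_borel d)"
proof (rule measurable_mat_borelI)
  show "mat_sqrt A \<in> carrier_mat d d" if "A \<in> space (psd_borel d)" for A
    using mat_sqrt_psd(1)[of A d] psd_matsD(1) that by simp
  fix a b assume ab: "a < d" "b < d"
  obtain c N where lim: "\<And>d A a b. A \<in> psd_mats d \<Longrightarrow> a < d \<Longrightarrow> b < d \<Longrightarrow>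
      (\<lambda>n. \<Sum>i\<le>(N n :: nat). c n i * (A ^\<^sub>m i) $$ (a,b)) \<longlonglongrightarrow> mat_sqrt A $$ (a,b)"
    using mat_sqrt_polynomial_limit by blast
  show "(\<lambda>A. mat_sqrt A $$ (a,b)) \<in> borel_measurable (psd_borel d)"
  proof (rule borel_measurable_LIMSEQ_real)
    show "(\<lambda>n. \<Sum>i\<le>N n. c n i * (A ^\<^sub>m i) $$ (a,b)) \<longlonglongrightarrow> mat_sqrt A $$ (a,b)"
      if "A \<in> space (psd_borel d)" for A using lim that ab by simp
    show "(\<lambda>A. \<Sum>i\<le>N n. c n i * (A ^\<^sub>m i) $$ (a,b)) \<in> borel_measurable (psd_borel d)" for n
      using ab by (intro borel_measurable_sum borel_measurable_times borel_measurable_const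
          measurable_compose[OF mat_pow_measurable mat_entry_measurable])
  qed
qed

lemma second_moment_mat_measurable:
  "second_moment_mat d k \<in> measurable (PiM {..<k} (\<lambda>_. vec_borel d)) (mat_borel d)"
proof (rule measurable_mat_borelI)
  fix a b assume ab: "a < d" "b < d"
  have e: "(\<lambda>g. g i $ c) \<in> borel_measurable (PiM {..<k} (\<lambda>_. vec_borel d))" if "i < k" "c < d" for i c
    using that by (intro measurable_compose[OF measurable_component_singleton[of i "{..<k}" "\<lambda>_. vec_borel d"]
          vec_entry_measurable]) auto
  have "(\<lambda>g. 1 / real k * (\<Sum>i<k. g i $ a * g i $ b)) \<in> borel_measurable (PiM {..<k} (\<lambda>_. vec_borel d))"
    using ab by (intro borel_measurable_times borel_measurable_sum borel_measurable_const e) auto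
  then show "(\<lambda>g. second_moment_mat d k g $$ (a,b)) \<in> borel_measurable (PiM {..<k} (\<lambda>_. vec_borel d))"
    using ab by (simp add: second_moment_mat_def)
qed simp

text \<open>The output of the mechanism as a function of a standard sample, with the Gaussian
  vectors T z. Here \<open>T\<close> may be any factor of the covariance and not only its symmetric
  root, so that the factor common to A and B can take its place.\<close>

definition linear_sample_moment :: "nat \<Rightarrow> nat \<Rightarrow> real mat \<Rightarrow> (nat \<Rightarrow> nat \<Rightarrow> real) \<Rightarrow> real mat" where
  "linear_sample_moment d k T \<omega> = second_moment_mat d k (\<lambda>i. T *\<^sub>v vec d (\<omega> i))"

lemma second_moment_mat_cong:
  "(\<And>i. i < k \<Longrightarrow> f i = g i) \<Longrightarrow> second_moment_mat d k f = second_moment_mat d k g"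
  by (simp add: second_moment_mat_def)

lemma linear_map_measurable:
  assumes T: "T \<in> carrier_mat d d"
  shows "(\<lambda>z. T *\<^sub>v vec d z) \<in> measurable (gaussian d) (vec_borel d)"
proof (rule measurable_vec_borelI)
  fix a assume a: "a < d"
  have "(\<lambda>z. \<Sum>c<d. T $$ (a,c) * z c) \<in> borel_measurable (gaussian d)" by measurable
  then show "(\<lambda>z. (T *\<^sub>v vec d z) $ a) \<in> borel_measurable (gaussian d)"
    using T a by (simp add: scalar_prod_def atLeast0LessThan)
qed (use T in auto)

lemma linear_sample_measurable:
  assumes T: "T \<in> carrier_mat d d"
  shows "(\<lambda>\<omega>. \<lambda>i\<in>{..<k}. T *\<^sub>v vec d (\<omega> i)) \<in> measurable (gaussian_sample k d) (PiM {..<k} (\<lambda>_. vec_borel d))"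
  by (intro measurable_restrict
      measurable_compose[OF measurable_component_singleton[where M="\<lambda>_. gaussian d"] linear_map_measurable[OF T]])

lemma linear_sample_moment_restrict:
  \<comment> \<open>Only indices below k are read; the restricted family is a point of the product
    space, as measurability requires.\<close>
  "linear_sample_moment d k T \<omega> = second_moment_mat d k (\<lambda>i\<in>{..<k}. T *\<^sub>v vec d (\<omega> i))"
  unfolding linear_sample_moment_def by (rule second_moment_mat_cong) simp

lemma linear_sample_moment_measurable:
  assumes T: "T \<in> carrier_mat d d"
  shows "linear_sample_moment d k T \<in> measurable (gaussian_sample k d) (mat_borel d)"
  unfolding linear_sample_moment_restrict[abs_def]
  by (rule measurable_compose[OF linear_sample_measurable[OF T] second_moment_mat_measurable])

text \<open>A product of image measures is the image of the product measure. All covariances are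
  thereby realized on one and the same sample space.\<close>

lemma gauss_sampling_eq:
  assumes "\<Sigma> \<in> psd_mats d"
  shows "gauss_sampling d k \<Sigma> = distr (gaussian_sample k d) (mat_borel d) (linear_sample_moment d k (mat_sqrt \<Sigma>))"
proof -
  define T where "T = mat_sqrt \<Sigma>"
  have T: "T \<in> carrier_mat d d" using mat_sqrt_psd(1)[OF assms] psd_matsD(1) by (simp add: T_def)
  note f = linear_map_measurable[OF T]
  have "prob_space (distr (gaussian d) (vec_borel d) (\<lambda>z. T *\<^sub>v vec d z))"
    by (rule prob_space.prob_space_distr[OF prob_space_gaussian f])
  then have "PiM {..<k} (\<lambda>_. mvn d \<Sigma>) = distr (gaussian_sample k d) (PiM {..<k} (\<lambda>_. vec_borel d))
      (\<lambda>\<omega>. \<lambda>i\<in>{..<k}. T *\<^sub>v vec d (\<omega> i))"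
    unfolding mvn_def T_def[symmetric]
    by (intro distr_PiM_componentwise[symmetric, where f="\<lambda>_ z. T *\<^sub>v vec d z"] f
        prob_space_imp_sigma_finite prob_space_gaussian) auto
  then show ?thesis
    unfolding gauss_sampling_def T_def[symmetric]
    by (simp add: distr_distr[OF second_moment_mat_measurable linear_sample_measurable[OF T]]
        comp_def linear_sample_moment_restrict[abs_def])
qed

lemma linear_sample_moment_conj:
  assumes T: "T \<in> carrier_mat d d"
  shows "linear_sample_moment d k T \<omega> = T * linear_sample_moment d k (1\<^sub>m d) \<omega> * transpose_mat T"
  using second_moment_mat_mult[OF T, of k "\<lambda>i. vec d (\<omega> i)"] by (simp add: linear_sample_moment_def)

text \<open>Makes the composition with a random \<Sigma> meaningful. The randomness is one fixed
  standard sample, and the output is the root of \<Sigma> times its moment matrix times the root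
  again, which is jointly measurable in \<Sigma> and the sample.\<close>

lemma gauss_sampling_measurable:
  "gauss_sampling d k \<in> measurable (psd_borel d) (subprob_algebra (mat_borel d))"
proof -
  let ?G = "gaussian_sample k d"
  have G: "?G \<in> space (subprob_algebra ?G)"
    by (simp add: space_subprob_algebra prob_space_imp_subprob_space prob_space_gaussian_sample)
  let ?h = "\<lambda>\<Sigma> \<omega>. mat_sqrt \<Sigma> * linear_sample_moment d k (1\<^sub>m d) \<omega> * mat_sqrt \<Sigma>"
  have "(\<lambda>p. mat_sqrt (fst p) * linear_sample_moment d k (1\<^sub>m d) (snd p) * mat_sqrt (fst p))
      \<in> measurable (psd_borel d \<Otimes>\<^sub>M ?G) (mat_borel d)"
    by (intro mat_mult_measurable measurable_compose[OF measurable_fst mat_sqrt_measurable]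
        measurable_compose[OF measurable_snd linear_sample_moment_measurable]) simp
  then have "(\<lambda>\<Sigma>. distr ?G (mat_borel d) (?h \<Sigma>)) \<in> measurable (psd_borel d) (subprob_algebra (mat_borel d))"
    by (intro measurable_distr2[OF _ measurable_const[OF G]]) (simp add: split_beta')
  then show ?thesis
  proof (rule measurable_cong[THEN iffD1, rotated])
    fix \<Sigma> assume "\<Sigma> \<in> space (psd_borel d)"
    then have \<Sigma>: "\<Sigma> \<in> psd_mats d" by simp
    note R = psd_matsD(1,2)[OF mat_sqrt_psd(1)[OF \<Sigma>]]
    have "linear_sample_moment d k (mat_sqrt \<Sigma>) = ?h \<Sigma>"
      by (rule ext, subst linear_sample_moment_conj[OF R(1)], simp only: R(2))
    then show "distr ?G (mat_borel d) (?h \<Sigma>) = gauss_sampling d k \<Sigma>"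
      by (simp only: gauss_sampling_eq[OF \<Sigma>])
  qed
qed

text \<open>Applying \<open>T * U\<close> to a sample is applying \<open>T\<close> to the rotated
  sample, which has the same law. Hence orthogonal factors on the right of a root do not show in the
  output law.\<close>

lemma linear_sample_moment_orthonormal:
  assumes T: "T \<in> carrier_mat d d" and U: "orthonormal_mat d U"
  shows "distr (gaussian_sample k d) (mat_borel d) (linear_sample_moment d k (T * U))
    = distr (gaussian_sample k d) (mat_borel d) (linear_sample_moment d k T)"
proof -
  let ?G = "gaussian_sample k d"
  let ?rot = "\<lambda>\<omega>. \<lambda>i\<in>{..<k}. mat_act d U (\<omega> i)"
  note U' = orthonormal_matD(1)[OF U]
  have rot: "?rot \<in> measurable ?G ?G" by (rule measurable_restrict) measurable
  have "linear_sample_moment d k T (?rot \<omega>) = linear_sample_moment d k (T * U) \<omega>" for \<omega>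
    unfolding linear_sample_moment_def
    using T U' by (intro second_moment_mat_cong) (simp add: vec_mat_act[OF U'] assoc_mult_mat_vec[of _ d d _ d])
  then have "distr ?G (mat_borel d) (linear_sample_moment d k (T * U))
      = distr (distr ?G ?G ?rot) (mat_borel d) (linear_sample_moment d k T)"
    by (simp add: distr_distr[OF linear_sample_moment_measurable[OF T] rot] comp_def)
  then show ?thesis by (simp only: gaussian_sample_orthonormal_invariant[OF U])
qed

lemma linear_sample_moment_scale:
  assumes T: "T \<in> carrier_mat d d"
  shows "linear_sample_moment d k (T * mat_diag d h) \<omega> = linear_sample_moment d k T (scale_sample k d h \<omega>)"
  unfolding linear_sample_moment_def
proof (rule second_moment_mat_cong)
  fix i assume i: "i < k"
  have "mat_diag d h *\<^sub>v vec d (\<omega> i) = vec d (scale_sample k d h \<omega> i)"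
    using i by (auto simp: mat_diag_mult_vec scale_sample_def intro!: eq_vecI)
  then show "T * mat_diag d h *\<^sub>v vec d (\<omega> i) = T *\<^sub>v vec d (scale_sample k d h \<omega> i)"
    using assoc_mult_mat_vec[OF T mat_diag_dim, of "vec d (\<omega> i)" h] by simp
qed

text \<open>Both output laws are images under the same map \<open>?F\<close>, of the standard sample
  for A and of the scaled one for B. An event pulls back to one set \<open>?E\<close> for both, so
  the comparison takes place between the samples.\<close>

lemma gauss_sampling_private:
  assumes \<epsilon>: "0 < \<epsilon>" and \<delta>: "0 < \<delta>" "\<delta> < 1" and \<epsilon>8: "\<epsilon> / (8 * ln (1 / \<delta>)) < 1" and k: "1 \<le> k"
    and \<Delta>: "\<Delta> = min (\<epsilon> / sqrt (8 * real k * ln (1 / \<delta>))) (\<epsilon> / (8 * ln (1 / \<delta>)))"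
    and A: "A \<in> psd_mats d" and B: "B \<in> psd_mats d"
    and AB: "relatively_close d \<Delta> A B" and BA: "relatively_close d \<Delta> B A"
    and S: "S \<in> sets (mat_borel d)"
  shows "measure (gauss_sampling d k A) S \<le> exp \<epsilon> * measure (gauss_sampling d k B) S + \<delta>"
proof -
  obtain T U V \<mu> where T: "T \<in> carrier_mat d d" and U: "orthonormal_mat d U" and V: "orthonormal_mat d V"
    and AT: "mat_sqrt A = T * U" and BT: "mat_sqrt B = T * mat_diag d (\<lambda>i. 1 / sqrt (\<mu> i)) * V"
    and \<mu>: "\<And>i. i < d \<Longrightarrow> 0 < \<mu> i"
    and sum: "sqrt (\<Sum>i<d. (\<mu> i - 1)\<^sup>2) \<le> \<Delta>" and sum': "sqrt (\<Sum>i<d. (1 / \<mu> i - 1)\<^sup>2) \<le> \<Delta>"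
    by (rule relatively_close_factorization[OF A B AB BA]) (rule that)
  \<comment> \<open>Extended by zero beyond d, since the comparison of samples asks for the lower
    bound -1/2 at every index.\<close>
  define \<kappa> where "\<kappa> i = (if i < d then \<mu> i - 1 else 0)" for i
  have \<kappa>: "- 1 / 2 \<le> \<kappa> i" for i
  proof (cases "i < d")
    case True
    \<comment> \<open>The lower bound on \<mu> comes from the reversed comparison: 1/\<mu> - 1 < 1
      gives \<mu> > 1/2, whereas |\<mu> - 1| < 1 would give only \<mu> > 0.\<close>
    have "(1 / \<mu> i - 1)\<^sup>2 \<le> (\<Sum>i<d. (1 / \<mu> i - 1)\<^sup>2)"
      using True by (intro member_le_sum) auto
    then have "1 / \<mu> i - 1 \<le> sqrt (\<Sum>i<d. (1 / \<mu> i - 1)\<^sup>2)" by (rule real_le_rsqrt)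
    also have "\<dots> < 1" using sum' \<epsilon>8 min.cobounded2[of "\<epsilon> / sqrt (8 * real k * ln (1 / \<delta>))" "\<epsilon> / (8 * ln (1 / \<delta>))"]
      unfolding \<Delta> by linarith
    finally have "1 / \<mu> i < 2" by simp
    then have "1 / 2 < \<mu> i" using \<mu>[OF True] by (simp add: field_simps)
    then show ?thesis using True by (simp add: \<kappa>_def)
  qed (simp add: \<kappa>_def)
  have sum_\<kappa>: "sqrt (\<Sum>i<d. (\<kappa> i)\<^sup>2) \<le> \<Delta>" using sum by (simp add: \<kappa>_def)
  let ?G = "gaussian_sample k d"
  let ?F = "linear_sample_moment d k T"
  let ?h = "\<lambda>i. 1 / sqrt (1 + \<kappa> i)"
  let ?G' = "distr ?G ?G (scale_sample k d ?h)"
  note F = linear_sample_moment_measurable[OF T, of k]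
  have gA: "gauss_sampling d k A = distr ?G (mat_borel d) ?F"
    unfolding gauss_sampling_eq[OF A] AT by (rule linear_sample_moment_orthonormal[OF T U])
  have H: "mat_diag d (\<lambda>i. 1 / sqrt (\<mu> i)) = mat_diag d ?h"
    by (rule mat_diag_cong) (simp add: \<kappa>_def)
  have "gauss_sampling d k B = distr ?G (mat_borel d) (linear_sample_moment d k (T * mat_diag d ?h))"
    unfolding gauss_sampling_eq[OF B] BT H
    by (rule linear_sample_moment_orthonormal[OF mult_carrier_mat[OF T mat_diag_dim] V])
  also have "\<dots> = distr ?G' (mat_borel d) ?F"
    by (simp add: distr_distr[OF F scale_sample_measurable] comp_def linear_sample_moment_scale[OF T, abs_def])
  finally have gB: "gauss_sampling d k B = distr ?G' (mat_borel d) ?F" .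
  let ?E = "?F -` S \<inter> space ?G"
  have "measure ?G ?E \<le> exp \<epsilon> * measure ?G' ?E + \<delta>"
    by (rule gaussian_sample_scaling_private[OF \<epsilon> \<delta> \<epsilon>8 k \<Delta> \<kappa> sum_\<kappa> measurable_sets[OF F S]])
  moreover have "measure (gauss_sampling d k A) S = measure ?G ?E"
    unfolding gA by (rule measure_distr[OF F S])
  moreover have "measure (gauss_sampling d k B) S = measure ?G' ?E"
    unfolding gB using F S by (subst measure_distr) (auto simp: space_distr)
  ultimately show ?thesis by simp
qed

text \<open>The pointwise inequality is integrated against the coupling. Its left side depends on
  the first component and the first term on its right on the second, so the marginals turn the
  integrals into the two composed laws, and \<delta> is integrated against total mass one.\<close>

lemma coupled_bind_private:
  assumes M: "M \<in> space (prob_algebra N)" and M': "M' \<in> space (prob_algebra N)"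
    and K: "K \<in> measurable N (subprob_algebra L)"
    and P: "coupling P M M'"
    and close: "AE (A, B) in P. R A B"
    and R: "\<And>A B. A \<in> space N \<Longrightarrow> B \<in> space N \<Longrightarrow> R A B \<Longrightarrow>
      measure (K A) S \<le> exp \<epsilon> * measure (K B) S + \<delta>"
    and S: "S \<in> sets L" and \<delta>: "0 \<le> \<delta>"
  shows "measure (M \<bind> K) S \<le> exp \<epsilon> * measure (M' \<bind> K) S + \<delta>"
proof -
  have sets: "sets M = sets N" "sets M' = sets N" and prob: "prob_space M" "prob_space M'"
    using M M' by (auto simp: space_prob_algebra)
  have P': "sets P = sets (M \<Otimes>\<^sub>M M')" "distr P M fst = M" "distr P M' snd = M'"
    using P by (auto simp: coupling_def)
  have [measurable_cong]: "sets P = sets (N \<Otimes>\<^sub>M N)"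
    using P'(1) by (simp add: sets cong: sets_pair_measure_cong)
  have fstP: "fst \<in> measurable P M" and sndP: "snd \<in> measurable P M'"
    by (auto simp: measurable_cong_sets[OF P'(1) refl])
  have spaceP: "space P = space N \<times> space N"
    using sets_eq_imp_space_eq[OF P'(1)] sets_eq_imp_space_eq[OF sets(1)] sets_eq_imp_space_eq[OF sets(2)]
    by (simp add: space_pair_measure)
  \<comment> \<open>\<open>coupling\<close> does not state that \<open>P\<close> has mass one; the
    mass is inherited from the first marginal.\<close>
  have P1: "emeasure P (space P) = 1"
  proof -
    have "emeasure (distr P M fst) (space M) = 1"
      using prob_space.emeasure_space_1[OF prob(1)] by (simp only: P'(2))
    then show ?thesis using measurable_space[OF fstP] fstP
      by (subst (asm) emeasure_distr) (auto intro!: arg_cong[where f="emeasure P"] simp: Int_absorb1 subset_eq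
          elim!: back_subst[of "\<lambda>X. emeasure P X = 1"])
  qed
  have KM: "K \<in> measurable M (subprob_algebra L)" and KM': "K \<in> measurable M' (subprob_algebra L)"
    using K by (auto simp: measurable_cong_sets[OF sets(1) refl] measurable_cong_sets[OF sets(2) refl])
  have ne: "space M \<noteq> {}" "space M' \<noteq> {}" using prob_space.not_empty[OF prob(1)] prob_space.not_empty[OF prob(2)] by auto
  have sub: "subprob_space (K A)" if "A \<in> space N" for A
    using measurable_space[OF K that] by (simp add: space_subprob_algebra)
  have em: "(\<lambda>A. emeasure (K A) S) \<in> borel_measurable M" "(\<lambda>A. emeasure (K A) S) \<in> borel_measurable M'"
    using measurable_emeasure_kernel[OF KM S] measurable_emeasure_kernel[OF KM' S] by auto
  have "emeasure (M \<bind> K) S = (\<integral>\<^sup>+A. emeasure (K A) S \<partial>M)"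
    by (rule emeasure_bind[OF ne(1) KM S])
  also have "\<dots> = (\<integral>\<^sup>+A. emeasure (K A) S \<partial>distr P M fst)" by (simp only: P'(2))
  also have "\<dots> = (\<integral>\<^sup>+p. emeasure (K (fst p)) S \<partial>P)" by (rule nn_integral_distr[OF fstP]) (simp add: em)
  also have "\<dots> \<le> (\<integral>\<^sup>+p. ennreal (exp \<epsilon>) * emeasure (K (snd p)) S + ennreal \<delta> \<partial>P)"
  proof (rule nn_integral_mono_AE)
    show "AE p in P. emeasure (K (fst p)) S \<le> ennreal (exp \<epsilon>) * emeasure (K (snd p)) S + ennreal \<delta>"
      using close AE_space
    proof eventually_elim
      case (elim p)
      then have p: "fst p \<in> space N" "snd p \<in> space N" by (auto simp: spaceP)
      interpret A: subprob_space "K (fst p)" by (rule sub[OF p(1)])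
      interpret B: subprob_space "K (snd p)" by (rule sub[OF p(2)])
      have "measure (K (fst p)) S \<le> exp \<epsilon> * measure (K (snd p)) S + \<delta>"
        using R[OF p] elim by (simp add: split_beta')
      then show ?case
        using \<delta> by (simp add: A.emeasure_eq_measure B.emeasure_eq_measure ennreal_mult[symmetric]
            ennreal_plus[symmetric] ennreal_leI del: ennreal_plus)
    qed
  qed
  also have "\<dots> = ennreal (exp \<epsilon>) * (\<integral>\<^sup>+p. emeasure (K (snd p)) S \<partial>P) + ennreal \<delta>"
    using measurable_compose[OF sndP em(2)] by (simp add: nn_integral_add nn_integral_cmult P1)
  also have "(\<integral>\<^sup>+p. emeasure (K (snd p)) S \<partial>P) = (\<integral>\<^sup>+A. emeasure (K A) S \<partial>distr P M' snd)"
    by (rule nn_integral_distr[OF sndP, symmetric]) (simp add: em)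
  also have "\<dots> = emeasure (M' \<bind> K) S"
    unfolding P'(3) by (rule emeasure_bind[OF ne(2) KM' S, symmetric])
  finally have le: "emeasure (M \<bind> K) S \<le> ennreal (exp \<epsilon>) * emeasure (M' \<bind> K) S + ennreal \<delta>" .
  interpret B: subprob_space "M \<bind> K"
    using prob(1) KM by (intro subprob_space_bind prob_space_imp_subprob_space)
  interpret B': subprob_space "M' \<bind> K"
    using prob(2) KM' by (intro subprob_space_bind prob_space_imp_subprob_space)
  show ?thesis
    using le \<delta> by (simp add: B.emeasure_eq_measure B'.emeasure_eq_measure ennreal_mult[symmetric]
        ennreal_plus[symmetric] ennreal_le_iff del: ennreal_plus)
qed

section \<open>Accuracy for a fixed covariance\<close>

lemma frobenius_norm_sample_moment:
  "frobenius_norm (linear_sample_moment d k (1\<^sub>m d) \<omega> - 1\<^sub>m d)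
    = sqrt (\<Sum>a<d. \<Sum>b<d. (sample_deviation k \<omega> a b)\<^sup>2)"
proof -
  have "(linear_sample_moment d k (1\<^sub>m d) \<omega> - 1\<^sub>m d) $$ (a,b) = sample_deviation k \<omega> a b" if "a < d" "b < d" for a b
    using that by (simp add: linear_sample_moment_def second_moment_mat_def sample_deviation_def)
  then show ?thesis by (simp add: frobenius_norm_def)
qed

text \<open>With T the root of \<Sigma> and R its inverse, the output is T W T for the moment matrix
  W of the standard sample, so R (T W T) R = W. The event becomes one about W alone, with the same
  bound for every invertible \<Sigma>.\<close>

lemma gauss_sampling_accuracy:
  assumes d: "1 \<le> d" and k: "1 \<le> k" and \<gamma>: "0 < \<gamma>" "\<gamma> < 1"
    and \<Sigma>: "\<Sigma> \<in> psd_mats d" and inv: "invertible_mat \<Sigma>"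
  defines "t \<equiv> (real d)\<^sup>2 + ln (1 / \<gamma>)"
  shows "1 - \<gamma> \<le> \<P>(S in gauss_sampling d k \<Sigma>.
    frobenius_norm (mat_inv (mat_sqrt \<Sigma>) * S * mat_inv (mat_sqrt \<Sigma>) - 1\<^sub>m d)
      \<le> 128 * (sqrt (t / real k) + t / real k))"
proof -
  let ?G = "gaussian_sample k d"
  interpret G: prob_space ?G by (rule prob_space_gaussian_sample)
  define \<rho> where "\<rho> = 128 * (sqrt (t / real k) + t / real k)"
  obtain R where R: "R \<in> carrier_mat d d" "transpose_mat R = R"
    "mat_sqrt \<Sigma> * R = 1\<^sub>m d" "R * mat_sqrt \<Sigma> = 1\<^sub>m d" "mat_inv (mat_sqrt \<Sigma>) = R"
    by (rule mat_sqrt_invertible[OF \<Sigma> inv]) (rule that)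
  define T where "T = mat_sqrt \<Sigma>"
  have T: "T \<in> carrier_mat d d" "transpose_mat T = T" "T * R = 1\<^sub>m d" "R * T = 1\<^sub>m d"
    using psd_matsD(1,2)[OF mat_sqrt_psd(1)[OF \<Sigma>]] R by (auto simp: T_def)
  let ?W = "linear_sample_moment d k (1\<^sub>m d)"
  let ?F = "linear_sample_moment d k T"
  note F = linear_sample_moment_measurable[OF T(1), of k]
  have W: "?W \<omega> \<in> carrier_mat d d" for \<omega> by (simp add: linear_sample_moment_def)
  have RFR: "R * ?F \<omega> * R = ?W \<omega>" for \<omega>
  proof -
    have "R * ?F \<omega> * R = (R * T) * ?W \<omega> * (T * R)"
      unfolding linear_sample_moment_conj[OF T(1)] T(2)
      using R(1) T(1) W[of \<omega>] by (simp add: assoc_mult_mat[of _ d d _ d _ d])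
    then show ?thesis using T(3,4) W[of \<omega>] by simp
  qed
  have "(\<lambda>S. R * S * R) \<in> measurable (mat_borel d) (mat_borel d)"
    using R(1) by (intro mat_mult_measurable) auto
  note RSR = measurable_compose[OF this mat_entry_measurable]
  let ?S = "{S \<in> space (mat_borel d). frobenius_norm (R * S * R - 1\<^sub>m d) \<le> \<rho>}"
  have S: "?S \<in> sets (mat_borel d)"
  proof -
    have "(\<lambda>S. sqrt (\<Sum>a<d. \<Sum>b<d. ((R * S * R) $$ (a,b) - (if a = b then 1 else 0))\<^sup>2)) \<in> borel_measurable (mat_borel d)"
      by (intro measurable_compose[OF _ borel_measurable_sqrt] borel_measurable_sum borel_measurable_power
          borel_measurable_diff borel_measurable_const RSR) auto
    then have "(\<lambda>S. frobenius_norm (R * S * R - 1\<^sub>m d)) \<in> borel_measurable (mat_borel d)"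
      using R(1) by (auto simp: frobenius_norm_def cong: measurable_cong)
    then show ?thesis by (rule borel_measurable_le[OF _ borel_measurable_const])
  qed
  let ?B = "{\<omega> \<in> space ?G. \<rho> < sqrt (\<Sum>a<d. \<Sum>b<d. (sample_deviation k \<omega> a b)\<^sup>2)}"
  have pre: "?F -` ?S \<inter> space ?G = space ?G - ?B"
    using measurable_space[OF F] by (auto simp: RFR frobenius_norm_sample_moment)
  have "measure (gauss_sampling d k \<Sigma>) ?S = measure ?G (space ?G - ?B)"
    unfolding gauss_sampling_eq[OF \<Sigma>] T_def[symmetric] pre[symmetric] by (rule measure_distr[OF F S])
  also have "\<dots> = 1 - measure ?G ?B"
  proof (rule G.prob_compl)
    have "?B = space ?G - (?F -` ?S \<inter> space ?G)" unfolding pre by auto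
    then show "?B \<in> sets ?G" using measurable_sets[OF F S] by auto
  qed
  also have "\<dots> \<ge> 1 - \<gamma>"
    using sample_deviation_norm_bound[OF d k \<gamma>] by (simp add: \<rho>_def t_def)
  finally show ?thesis
    by (simp add: R(5) \<rho>_def gauss_sampling_eq[OF \<Sigma>])
qed

section \<open>Almost sure invertibility of the covariance\<close>

lemma invertible_mat_iff_det:
  fixes A :: "real mat"
  assumes A: "A \<in> carrier_mat d d"
  shows "invertible_mat A \<longleftrightarrow> det A \<noteq> 0"
proof
  assume "invertible_mat A"
  then obtain X where X: "X \<in> carrier_mat d d" "A * X = 1\<^sub>m d" by (rule invertible_mat_obtain[OF _ A])
  then have "det A * det X = 1" using det_mult[OF A X(1)] by simp
  then show "det A \<noteq> 0" by auto
next
  assume "det A \<noteq> 0"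
  from det_non_zero_imp_unit[OF A this, of "()"] obtain X where
    "X \<in> carrier_mat d d" "X * A = 1\<^sub>m d" "A * X = 1\<^sub>m d"
    by (auto simp: Units_def ring_mat_def)
  then show "invertible_mat A" using A
    by (auto simp: invertible_mat_def inverts_mat_def)
qed

text \<open>The Leibniz formula exhibits the determinant as a polynomial in the entries.
  Measurability of this set is what lets an almost everywhere statement pass from a coupling to its
  marginal.\<close>

lemma invertible_mat_measurable: "{A \<in> space (psd_borel d). invertible_mat A} \<in> sets (psd_borel d)"
proof -
  have "(\<lambda>A. \<Sum>p\<in>{p. p permutes {0..<d}}. signof p * (\<Prod>i = 0..<d. A $$ (i, p i))) \<in> borel_measurable (psd_borel d)"
    by (intro borel_measurable_sum borel_measurable_times borel_measurable_const borel_measurable_prod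
        measurable_compose[OF measurable_psd_borel_mat_borel mat_entry_measurable])
      (auto dest: permutes_in_image)
  then have "{A \<in> space (psd_borel d). (\<Sum>p\<in>{p. p permutes {0..<d}}. signof p * (\<Prod>i = 0..<d. A $$ (i, p i))) \<noteq> 0}
      \<in> sets (psd_borel d)"
    by (rule borel_measurable_neq[OF _ borel_measurable_const])
  moreover have "invertible_mat A \<longleftrightarrow> (\<Sum>p\<in>{p. p permutes {0..<d}}. signof p * (\<Prod>i = 0..<d. A $$ (i, p i))) \<noteq> 0"
    if "A \<in> space (psd_borel d)" for A
    using psd_matsD(1)[of A d] that by (auto simp: invertible_mat_iff_det det_def)
  ultimately show ?thesis by (simp cong: conj_cong)
qed

text \<open>The first point is replaced by a different vector, which takes a nonempty dataset and a
  space with more than one vector.\<close>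

lemma neighboring_exists:
  assumes Y: "Y \<in> datasets d n" and d: "1 \<le> d" and n: "1 \<le> n"
  obtains Y' where "Y' \<in> datasets d n" "neighboring Y Y'"
proof -
  define v where "v = (if Y ! 0 = 0\<^sub>v d then unit_vec d 0 else 0\<^sub>v d :: real vec)"
  have v: "v \<in> carrier_vec d" by (simp add: v_def)
  have "unit_vec d 0 \<noteq> (0\<^sub>v d :: real vec)"
    using d by (auto dest: arg_cong[where f="\<lambda>v. v $ 0"])
  then have neq: "Y ! 0 \<noteq> v" by (auto simp: v_def)
  have len: "length Y = n" "set Y \<subseteq> carrier_vec d" using Y by (auto simp: datasets_def)
  have "{i. i < length Y \<and> Y ! i \<noteq> Y[0 := v] ! i} = {0}"
    using neq n len by (auto simp: nth_list_update split: if_splits)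
  then have "neighboring Y (Y[0 := v])" by (simp add: neighboring_def)
  moreover have "Y[0 := v] \<in> datasets d n"
    using len v set_update_subset_insert[of Y 0 v] by (auto simp: datasets_def)
  ultimately show ?thesis using that by blast
qed

text \<open>Invertibility is asserted only where neighbors are compared, so an arbitrary neighbor is
  brought in. The reversed closeness, of B to A, is the one that inverts the first
  component.\<close>

lemma stable_mechanism_AE_invertible:
  assumes stable: "stable_mechanism d n \<Delta> M" and Y: "Y \<in> datasets d n" and d: "1 \<le> d" and n: "1 \<le> n"
    and M: "M Y \<in> space (prob_algebra (psd_borel d))"
  shows "AE \<Sigma> in M Y. \<Sigma> \<in> psd_mats d \<and> invertible_mat \<Sigma>"
proof -
  obtain Y' where "Y' \<in> datasets d n" "neighboring Y Y'" by (rule neighboring_exists[OF Y d n])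
  then obtain P where P: "coupling P (M Y) (M Y')"
    and close: "AE (A, B) in P. relatively_close d \<Delta> A B \<and> relatively_close d \<Delta> B A"
    using stable Y unfolding stable_mechanism_def by blast
  have sets: "sets (M Y) = sets (psd_borel d)" using M by (simp add: space_prob_algebra)
  have P': "sets P = sets (M Y \<Otimes>\<^sub>M M Y')" "distr P (M Y) fst = M Y" using P by (auto simp: coupling_def)
  have fstP: "fst \<in> measurable P (M Y)" by (auto simp: measurable_cong_sets[OF P'(1) refl])
  have "AE p in P. invertible_mat (fst p)"
    using close by eventually_elim (auto simp: relatively_close_def)
  moreover have "{A \<in> space (M Y). invertible_mat A} \<in> sets (M Y)"
    using invertible_mat_measurable[of d] sets_eq_imp_space_eq[OF sets] sets by simp
  ultimately have "AE \<Sigma> in distr P (M Y) fst. invertible_mat \<Sigma>" using fstP by (simp add: AE_distr_iff)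
  then have "AE \<Sigma> in M Y. invertible_mat \<Sigma>" by (simp only: P'(2))
  then show ?thesis using AE_space
    by eventually_elim (use sets_eq_imp_space_eq[OF sets] in auto)
qed

theorem theorem5p1:
  shows "\<exists>C>0::real. \<forall>(\<epsilon>::real) (\<delta>::real) (k::nat) (d::nat) (n::nat) (\<Delta>::real)
      (M :: real vec list \<Rightarrow> real mat measure).
    0 < \<epsilon> \<and> \<epsilon> < 1 \<and> 0 < \<delta> \<and> \<delta> < 1 \<and> 1 \<le> k \<and> 1 \<le> d \<and> 1 \<le> n \<and>
    \<Delta> = min (\<epsilon> / sqrt (8 * real k * ln (1 / \<delta>))) (\<epsilon> / (8 * ln (1 / \<delta>))) \<and> \<Delta> < 1 \<and>
    (\<forall>Y\<in>datasets d n. M Y \<in> space (prob_algebra (psd_borel d))) \<and>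
    stable_mechanism d n \<Delta> M
    \<longrightarrow>
    (\<epsilon> / (8 * ln (1 / \<delta>)) < 1 \<longrightarrow>
      differentially_private \<epsilon> \<delta> (datasets d n) (mat_borel d)
        (\<lambda>Y. M Y \<bind> gauss_sampling d k)) \<and>
    (\<forall>\<gamma>::real. 0 < \<gamma> \<and> \<gamma> < 1 \<longrightarrow>
      (\<exists>\<rho>. \<rho> \<le> C * (sqrt (((real d)\<^sup>2 + ln (1 / \<gamma>)) / real k) + ((real d)\<^sup>2 + ln (1 / \<gamma>)) / real k) \<and>
        (\<forall>Y\<in>datasets d n. AE \<Sigma> in M Y.
          \<P>(S in gauss_sampling d k \<Sigma>.
            frobenius_norm (mat_inv (mat_sqrt \<Sigma>) * S * mat_inv (mat_sqrt \<Sigma>) - 1\<^sub>m d) \<le> \<rho>) \<ge> 1 - \<gamma>)))"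
proof (rule exI[of _ 128], intro conjI allI impI, goal_cases)
  case 1
  then show ?case by simp
next
  case (2 \<epsilon> \<delta> k d n \<Delta> M)
  show ?case
    unfolding differentially_private_def
  proof (intro ballI impI)
    fix Y Y' S assume Y: "Y \<in> datasets d n" "Y' \<in> datasets d n" "neighboring Y Y'" and S: "S \<in> sets (mat_borel d)"
    have "stable_mechanism d n \<Delta> M" using 2 by blast
    with Y obtain P where P: "coupling P (M Y) (M Y')"
      and close: "AE (A, B) in P. relatively_close d \<Delta> A B \<and> relatively_close d \<Delta> B A"
      unfolding stable_mechanism_def by blast
    show "measure (M Y \<bind> gauss_sampling d k) S \<le> exp \<epsilon> * measure (M Y' \<bind> gauss_sampling d k) S + \<delta>"
    proof (rule coupled_bind_private[OF _ _ gauss_sampling_measurable P close _ S])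
      show "M Y \<in> space (prob_algebra (psd_borel d))" "M Y' \<in> space (prob_algebra (psd_borel d))" "0 \<le> \<delta>"
        using 2 Y by auto
      show "measure (gauss_sampling d k A) S \<le> exp \<epsilon> * measure (gauss_sampling d k B) S + \<delta>"
        if "A \<in> space (psd_borel d)" "B \<in> space (psd_borel d)"
          "relatively_close d \<Delta> A B \<and> relatively_close d \<Delta> B A" for A B
        using that 2 S by (intro gauss_sampling_private[where \<Delta>=\<Delta>]) auto
    qed
  qed
next
  case (3 \<epsilon> \<delta> k d n \<Delta> M \<gamma>)
  \<comment> \<open>The witness is the full bound with constant 128. It is fixed before the dataset
    and \<Sigma>, so one value serves all of them.\<close>
  let ?t = "(real d)\<^sup>2 + ln (1 / \<gamma>)"
  show ?case
  proof (intro exI[of _ "128 * (sqrt (?t / real k) + ?t / real k)"] conjI order_refl ballI)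
    fix Y assume Y: "Y \<in> datasets d n"
    have inv: "AE \<Sigma> in M Y. \<Sigma> \<in> psd_mats d \<and> invertible_mat \<Sigma>"
      using 3 Y by (intro stable_mechanism_AE_invertible) auto
    show "AE \<Sigma> in M Y. 1 - \<gamma> \<le> \<P>(S in gauss_sampling d k \<Sigma>.
        frobenius_norm (mat_inv (mat_sqrt \<Sigma>) * S * mat_inv (mat_sqrt \<Sigma>) - 1\<^sub>m d)
          \<le> 128 * (sqrt (?t / real k) + ?t / real k))"
      using inv
    proof eventually_elim
      case (elim \<Sigma>)
      then show ?case using 3 by (intro gauss_sampling_accuracy) auto
    qed
  qed
qed

end
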